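(* If a nice tree decomposition of width $w$ of an $n$-vertex graph $G$ is given, then $\{P_3\}$-TM-Deletion on $G$ (with any integer $k$) can be solved in time $\mathcal{O}(9^{w}\cdot w\cdot n)$.
   Context: $P_3$ is the path on $3$ vertices. $\{P_3\}$-TM-Deletion: given a graph $G$ and integer $k$, decide whether there is $S\subseteq V(G)$ with $|S|\le k$ such that $G\setminus S$ does not contain $P_3$ as a topological minor. A nice tree decomposition of $G$ is a tree decomposition $(T,\{X_t\})$ rooted at a node $r$ with $X_r=\emptyset$, in which every node has at most two children, every leaf has an empty bag, every node $t$ with exactly one child $t'$ is either an introduce node ($X_t=X_{t'}\cup\{v\}$, $v\notin X_{t'}$) or a forget node ($X_t=X_{t'}\setminus\{v\}$, $v\in X_{t'}$), and every node with two children $t',t''$ has $X_t=X_{t'}=X_{t''}$; its width is the maximum bag size minus one.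
   Formalization: The O(9^w·w·n) bound is proved for nice tree decompositions with O(w·n) nodes (any constant); with more nodes, time linear in the input length is added; w and n are replaced by max(1,w) and max(1,n), since for w=0 or n=0 the stated bound would be zero steps. *)

theory Defs
  imports Main
begin

section \<open>Finite simple graphs\<close>

record 'a graph =
  verts :: "'a set"
  edges :: "'a set set"

definition simple_graph :: "'a graph \<Rightarrow> bool" where
  "simple_graph G \<longleftrightarrow> finite (verts G) \<and>
     (\<forall>e \<in> edges G. \<exists>u v. u \<in> verts G \<and> v \<in> verts G \<and> u \<noteq> v \<and> e = {u, v})"

definition induced :: "'a graph \<Rightarrow> 'a set \<Rightarrow> 'a graph" where
  "induced G A = \<lparr>verts = verts G \<inter> A, edges = {e \<in> edges G. e \<subseteq> A}\<rparr>"

definition delete_verts :: "'a graph \<Rightarrow> 'a set \<Rightarrow> 'a graph" where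
  "delete_verts G S = induced G (verts G - S)"

definition is_path :: "'a graph \<Rightarrow> 'a list \<Rightarrow> bool" where
  "is_path G p \<longleftrightarrow> p \<noteq> [] \<and> distinct p \<and> set p \<subseteq> verts G \<and>
     successively (\<lambda>u v. {u, v} \<in> edges G) p"

definition is_cycle :: "'a graph \<Rightarrow> 'a list \<Rightarrow> bool" where
  "is_cycle G p \<longleftrightarrow> is_path G p \<and> length p \<ge> 3 \<and> {last p, hd p} \<in> edges G"

definition connected_graph :: "'a graph \<Rightarrow> bool" where
  "connected_graph G \<longleftrightarrow> verts G \<noteq> {} \<and>
     (\<forall>u \<in> verts G. \<forall>v \<in> verts G. \<exists>p. is_path G p \<and> hd p = u \<and> last p = v)"

definition is_tree :: "'a graph \<Rightarrow> bool" where
  "is_tree T \<longleftrightarrow> simple_graph T \<and> connected_graph T \<and> (\<nexists>p. is_cycle T p)"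


section \<open>Topological minors and vertex deletion\<close>

text \<open>
  A topological minor model: branch vertices \<open>\<phi> v\<close> and, for each edge \<open>e\<close> of \<open>H\<close>, a path
  \<open>P e\<close> joining the images of the two ends of \<open>e\<close>. The last two conditions say that an inner
  vertex of such a path is neither a branch vertex nor a vertex of another path.
\<close>

definition topological_minor :: "'b graph \<Rightarrow> 'a graph \<Rightarrow> bool" where
  "topological_minor H G \<longleftrightarrow>
     (\<exists>(\<phi> :: 'b \<Rightarrow> 'a) (P :: 'b set \<Rightarrow> 'a list).
        inj_on \<phi> (verts H) \<and> \<phi> ` verts H \<subseteq> verts G \<and>
        (\<forall>e \<in> edges H. is_path G (P e) \<and> {hd (P e), last (P e)} = \<phi> ` e) \<and>
        (\<forall>e \<in> edges H. set (P e) \<inter> \<phi> ` verts H = \<phi> ` e) \<and>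
        (\<forall>e \<in> edges H. \<forall>f \<in> edges H. e \<noteq> f \<longrightarrow> set (P e) \<inter> set (P f) \<subseteq> \<phi> ` verts H))"

definition P3 :: "nat graph" where
  "P3 = \<lparr>verts = {0, 1, 2}, edges = {{0, 1}, {1, 2}}\<rparr>"

definition TM_Deletion :: "'b graph set \<Rightarrow> 'a graph \<Rightarrow> int \<Rightarrow> bool" where
  "TM_Deletion F G k \<longleftrightarrow>
     (\<exists>S. S \<subseteq> verts G \<and> int (card S) \<le> k \<and>
          (\<forall>H \<in> F. \<not> topological_minor H (delete_verts G S)))"


section \<open>Nice tree decompositions\<close>

definition tree_decomposition :: "'a graph \<Rightarrow> 'b graph \<Rightarrow> ('b \<Rightarrow> 'a set) \<Rightarrow> bool" where
  "tree_decomposition G T X \<longleftrightarrow>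
     is_tree T \<and>
     (\<Union>t \<in> verts T. X t) = verts G \<and>
     (\<forall>e \<in> edges G. \<exists>t \<in> verts T. e \<subseteq> X t) \<and>
     (\<forall>v \<in> verts G. connected_graph (induced T {t \<in> verts T. v \<in> X t}))"

text \<open>The width is an integer because it is \<open>-1\<close> for the graph without vertices.\<close>

definition width :: "'b graph \<Rightarrow> ('b \<Rightarrow> 'a set) \<Rightarrow> int" where
  "width T X = int (Max ((\<lambda>t. card (X t)) ` verts T)) - 1"

definition children :: "'b graph \<Rightarrow> 'b \<Rightarrow> 'b \<Rightarrow> 'b set" where
  "children T r t = {t'. \<exists>p. is_path T (p @ [t, t']) \<and> hd (p @ [t, t']) = r}"

definition nice_tree_decomposition ::
  "'a graph \<Rightarrow> 'b graph \<Rightarrow> 'b \<Rightarrow> ('b \<Rightarrow> 'a set) \<Rightarrow> bool" where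
  "nice_tree_decomposition G T r X \<longleftrightarrow>
     tree_decomposition G T X \<and> r \<in> verts T \<and> X r = {} \<and>
     (\<forall>t \<in> verts T.
        card (children T r t) \<le> 2 \<and>
        (children T r t = {} \<longrightarrow> X t = {}) \<and>
        (\<forall>t'. children T r t = {t'} \<longrightarrow>
           (\<exists>v. v \<notin> X t' \<and> X t = insert v (X t')) \<or>
           (\<exists>v. v \<in> X t' \<and> X t = X t' - {v})) \<and>
        (\<forall>t' t''. t' \<noteq> t'' \<and> children T r t = {t', t''} \<longrightarrow> X t = X t' \<and> X t = X t''))"


section \<open>Random access machine\<close>

text \<open>
  A unit-cost random access machine with indirect addressing, whose only arithmetic operations
  are addition and subtraction, presented as a structured language. Cells are indexed by
  integers and hold integers. In particular there is no unit-cost multiplication, so one step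
  lengthens the largest number by at most one bit. Every operator that is evaluated and every
  command that is executed costs one.
\<close>

type_synonym memory = "int \<Rightarrow> int"

datatype aexp = Const int | Get aexp | Add aexp aexp | Sub aexp aexp

datatype bexp = Less aexp aexp | Neg bexp | Conj bexp bexp

datatype com =
    Skip
  | Put aexp aexp
  | Seq com com
  | Cond bexp com com
  | While bexp com

primrec aval :: "aexp \<Rightarrow> memory \<Rightarrow> int" where
  "aval (Const i) s = i"
| "aval (Get a) s = s (aval a s)"
| "aval (Add a b) s = aval a s + aval b s"
| "aval (Sub a b) s = aval a s - aval b s"

primrec acost :: "aexp \<Rightarrow> nat" where
  "acost (Const i) = 1"
| "acost (Get a) = 1 + acost a"
| "acost (Add a b) = 1 + acost a + acost b"
| "acost (Sub a b) = 1 + acost a + acost b"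

primrec bval :: "bexp \<Rightarrow> memory \<Rightarrow> bool" where
  "bval (Less a b) s \<longleftrightarrow> aval a s < aval b s"
| "bval (Neg b) s \<longleftrightarrow> \<not> bval b s"
| "bval (Conj b c) s \<longleftrightarrow> bval b s \<and> bval c s"

primrec bcost :: "bexp \<Rightarrow> nat" where
  "bcost (Less a b) = 1 + acost a + acost b"
| "bcost (Neg b) = 1 + bcost b"
| "bcost (Conj b c) = 1 + bcost b + bcost c"

text \<open>\<open>exec c s m s'\<close>: started in memory \<open>s\<close>, the program \<open>c\<close> halts in memory \<open>s'\<close> after \<open>m\<close> steps.\<close>

inductive exec :: "com \<Rightarrow> memory \<Rightarrow> nat \<Rightarrow> memory \<Rightarrow> bool" where
  exec_Skip: "exec Skip s 1 s"
| exec_Put: "exec (Put a b) s (1 + acost a + acost b) (s(aval a s := aval b s))"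
| exec_Seq: "exec c s m s' \<Longrightarrow> exec d s' m' s'' \<Longrightarrow> exec (Seq c d) s (m + m') s''"
| exec_CondT: "bval b s \<Longrightarrow> exec c s m s' \<Longrightarrow> exec (Cond b c d) s (1 + bcost b + m) s'"
| exec_CondF: "\<not> bval b s \<Longrightarrow> exec d s m s' \<Longrightarrow> exec (Cond b c d) s (1 + bcost b + m) s'"
| exec_WhileF: "\<not> bval b s \<Longrightarrow> exec (While b c) s (1 + bcost b) s"
| exec_WhileT: "bval b s \<Longrightarrow> exec c s m s' \<Longrightarrow> exec (While b c) s' m' s'' \<Longrightarrow>
    exec (While b c) s (1 + bcost b + m + m') s''"

inductive_cases exec_SkipE: "exec Skip s m s'"
inductive_cases exec_PutE: "exec (Put a b) s m s'"
inductive_cases exec_SeqE: "exec (Seq c d) s m s'"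
inductive_cases exec_CondE: "exec (Cond b c d) s m s'"
inductive_cases exec_WhileE: "exec (While b c) s m s'"

lemma exec_deterministic:
  "exec c s m s' \<Longrightarrow> exec c s n t' \<Longrightarrow> n = m \<and> t' = s'"
proof (induction arbitrary: n t' rule: exec.induct)
  case (exec_Seq c s m s' d m' s'')
  from exec_Seq.prems obtain i j u where "exec c s i u" "exec d u j t'" "n = i + j"
    by (rule exec_SeqE)
  with exec_Seq.IH show ?case by metis
next
  case (exec_CondT b s c m s' d)
  from exec_CondT.prems exec_CondT.hyps(1) obtain i
    where "exec c s i t'" "n = 1 + bcost b + i"
    by (elim exec_CondE) simp_all
  with exec_CondT.IH show ?case by simp
next
  case (exec_CondF b s d m s' c)
  from exec_CondF.prems exec_CondF.hyps(1) obtain i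
    where "exec d s i t'" "n = 1 + bcost b + i"
    by (elim exec_CondE) simp_all
  with exec_CondF.IH show ?case by simp
next
  case (exec_WhileF b s c)
  from exec_WhileF.prems show ?case
    by (rule exec_WhileE) (use exec_WhileF.hyps in simp_all)
next
  case (exec_WhileT b s c m s' m' s'')
  from exec_WhileT.prems obtain i j u
    where "exec c s i u" "exec (While b c) u j t'" "n = 1 + bcost b + i + j"
    by (rule exec_WhileE) (use exec_WhileT.hyps(1) in simp_all)
  with exec_WhileT.IH show ?case by metis
qed (auto elim: exec_SkipE exec_PutE)

definition load :: "int list \<Rightarrow> memory" where
  "load xs = (\<lambda>i. if 0 \<le> i \<and> i < int (length xs) then xs ! nat i else 0)"


section \<open>Encoding of instances\<close>

text \<open>
  The vertices of the graph and the nodes of the decomposition tree are numbered from 0. The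
  graph is given by its edges, each listed once; the rooted tree by the list of children and the
  bag of each node. All these lists may come in any order, and the ends of an edge too, so one
  instance has several encodings.
\<close>

definition encodes ::
  "int list \<Rightarrow> nat graph \<Rightarrow> int \<Rightarrow> nat graph \<Rightarrow> nat \<Rightarrow> (nat \<Rightarrow> nat set) \<Rightarrow> bool" where
  "encodes xs G k T r X \<longleftrightarrow>
     (\<exists>(n :: nat) (N :: nat) (es :: (nat \<times> nat) list)
        (cs :: nat \<Rightarrow> nat list) (bs :: nat \<Rightarrow> nat list).
        verts G = {..<n} \<and> verts T = {..<N} \<and>
        distinct (map (\<lambda>(u, v). {u, v}) es) \<and> (\<lambda>(u, v). {u, v}) ` set es = edges G \<and>
        (\<forall>t < N. distinct (cs t) \<and> set (cs t) = children T r t) \<and>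
        (\<forall>t < N. distinct (bs t) \<and> set (bs t) = X t) \<and>
        xs = [int n, k, int (length es)] @ concat (map (\<lambda>(u, v). [int u, int v]) es) @
             [int N, int r] @
             concat (map (\<lambda>t. int (length (cs t)) # map int (cs t) @
                              int (length (bs t)) # map int (bs t)) [0..<N]))"

end

theory Submission imports Defs begin

text \<open>
  Deleting vertices so that no \<open>P\<^sub>3\<close> topological minor remains means leaving a graph of maximum degree
  at most one. Number the bags in breadth-first order from the root; a vertex is eliminated at
  the first bag that contains it, and by niceness this bag determines the vertex. Eliminating in
  reverse order, the other vertices of that bag all lie in the bag of the last one of them to be
  introduced, into which the information is merged. A table assigns to every 3-state labelling of
  a bag the largest number of eliminated vertices that can be kept. A merge splits each
  label among the two sides, in 4 ways per vertex, so it runs through \<open>4\<^bsup>w+1\<^esup>\<close> codes with \<open>O(w)\<close> work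
  each, and there are only \<open>n\<close> merges: introduce nodes and trivial joins cost no more than reading them.
  Working with the number of kept vertices makes every fresh, hence zero, memory cell a correct initial
  value.
\<close>

section \<open>A language of arrays of natural numbers\<close>

text \<open>Exponential work cannot be charged to nodes: joins of equal bags may be repeated at
  will, so their number is unbounded in terms of \<open>w\<close> and \<open>n\<close>. This is why
  tables are touched once per vertex. States are upper bounds on the number of kept neighbours, so
  the empty set always fits and no table entry is infeasible. For the same reason it suffices to
  split state 2 as (1,2) or (2,1), state 1 as (1,1) and state 0 as (0,0), which makes four codes.
  The algorithm itself works in base 4; the base 9 appears only as an upper bound in the closing
  arithmetic. The machine offers neither multiplication nor division, and its costs count every
  operator. Programs are therefore written over arrays of naturals, where only loop iterations are
  counted, and a verified translation adds a constant factor. Multiples of \<open>n\<close>, powers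
  of 4 and quotients by 4 are tabulated by additions while reading. The adjacency matrix may spread
  over \<open>n * n\<close> cells because these need no initialisation.\<close>

datatype 'v nexp = Lit nat | Cell 'v "'v nexp" | Plus "'v nexp" "'v nexp"

datatype 'v ntest = Lt "'v nexp" "'v nexp" | No "'v ntest" | Both "'v ntest" "'v ntest"

datatype 'v ncom =
    Nop
  | Store 'v "'v nexp" "'v nexp"
  | Decr 'v
  | Then "'v ncom" "'v ncom" (infixr ";;" 55)
  | Branch "'v ntest" "'v ncom" "'v ncom"
  | Loop "'v ntest" "'v ncom"

type_synonym 'v store = "'v \<Rightarrow> nat \<Rightarrow> nat"

primrec nval :: "'v nexp \<Rightarrow> 'v store \<Rightarrow> nat" where
  "nval (Lit i) s = i"
| "nval (Cell x a) s = s x (nval a s)"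
| "nval (Plus a b) s = nval a s + nval b s"

primrec ntrue :: "'v ntest \<Rightarrow> 'v store \<Rightarrow> bool" where
  "ntrue (Lt a b) s \<longleftrightarrow> nval a s < nval b s"
| "ntrue (No b) s \<longleftrightarrow> \<not> ntrue b s"
| "ntrue (Both b c) s \<longleftrightarrow> ntrue b s \<and> ntrue c s"

definition upd :: "'v store \<Rightarrow> 'v \<Rightarrow> nat \<Rightarrow> nat \<Rightarrow> 'v store" where
  "upd s x i a = s(x := (s x)(i := a))"

text \<open>Only loop iterations are counted: everything between two of them costs at most the size
  of the program.\<close>

inductive nexec :: "'v ncom \<Rightarrow> 'v store \<Rightarrow> nat \<Rightarrow> 'v store \<Rightarrow> bool" where
  nexec_Nop: "nexec Nop s 0 s"
| nexec_Store: "nexec (Store x a b) s 0 (upd s x (nval a s) (nval b s))"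
| nexec_Decr: "nexec (Decr x) s 0 (upd s x 0 (s x 0 - 1))"
| nexec_Then: "nexec c s m s' \<Longrightarrow> nexec d s' m' s'' \<Longrightarrow> nexec (c ;; d) s (m + m') s''"
| nexec_BranchT: "ntrue b s \<Longrightarrow> nexec c s m s' \<Longrightarrow> nexec (Branch b c d) s m s'"
| nexec_BranchF: "\<not> ntrue b s \<Longrightarrow> nexec d s m s' \<Longrightarrow> nexec (Branch b c d) s m s'"
| nexec_LoopF: "\<not> ntrue b s \<Longrightarrow> nexec (Loop b c) s 0 s"
| nexec_LoopT: "ntrue b s \<Longrightarrow> nexec c s m s' \<Longrightarrow> nexec (Loop b c) s' m' s'' \<Longrightarrow>
    nexec (Loop b c) s (1 + m + m') s''"

inductive_cases nexec_NopE: "nexec Nop s m s'"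
inductive_cases nexec_StoreE: "nexec (Store x a b) s m s'"
inductive_cases nexec_DecrE: "nexec (Decr x) s m s'"
inductive_cases nexec_ThenE: "nexec (c ;; d) s m s'"
inductive_cases nexec_BranchE: "nexec (Branch b c d) s m s'"

section \<open>Total correctness with a bound on loop iterations\<close>

definition runs :: "'v ncom \<Rightarrow> 'v store \<Rightarrow> nat \<Rightarrow> ('v store \<Rightarrow> bool) \<Rightarrow> bool" where
  "runs c s m Q \<longleftrightarrow> (\<exists>m' s'. nexec c s m' s' \<and> m' \<le> m \<and> Q s')"

lemma runs_mono: "runs c s m Q \<Longrightarrow> m \<le> m' \<Longrightarrow> (\<And>s'. Q s' \<Longrightarrow> Q' s') \<Longrightarrow> runs c s m' Q'"
  unfolding runs_def by (meson order_trans)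

lemma nexec_Nop_iff: "nexec Nop s m s' \<longleftrightarrow> m = 0 \<and> s' = s"
  by (auto intro: nexec_Nop elim: nexec_NopE)

lemma nexec_Store_iff:
  "nexec (Store x a b) s m s' \<longleftrightarrow> m = 0 \<and> s' = upd s x (nval a s) (nval b s)"
  by (auto intro: nexec_Store elim: nexec_StoreE)

lemma nexec_Decr_iff: "nexec (Decr x) s m s' \<longleftrightarrow> m = 0 \<and> s' = upd s x 0 (s x 0 - 1)"
  by (metis nexec_Decr nexec_DecrE)

lemma nexec_Then_iff:
  "nexec (c ;; d) s m s'' \<longleftrightarrow> (\<exists>i j s'. nexec c s i s' \<and> nexec d s' j s'' \<and> m = i + j)"
  by (metis nexec_Then nexec_ThenE)

lemma nexec_Branch_iff:
  "nexec (Branch b c d) s m s' \<longleftrightarrow> (if ntrue b s then nexec c s m s' else nexec d s m s')"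
  by (auto intro: nexec_BranchT nexec_BranchF elim: nexec_BranchE)

lemmas nexec_iffs = nexec_Nop_iff nexec_Store_iff nexec_Decr_iff nexec_Then_iff nexec_Branch_iff

text \<open>Every command is treated together with the continuation that follows it, so rewriting
  executes straight-line code symbolically and only loops need an explicit invariant. A branch
  copies its continuation into both alternatives.\<close>

lemma runs_simps [simp]:
  "runs Nop s m Q \<longleftrightarrow> Q s"
  "runs (Store x a b) s m Q \<longleftrightarrow> Q (upd s x (nval a s) (nval b s))"
  "runs (Decr x) s m Q \<longleftrightarrow> Q (upd s x 0 (s x 0 - 1))"
  "runs (Branch t c d) s m Q \<longleftrightarrow> (if ntrue t s then runs c s m Q else runs d s m Q)"
  "runs (Nop ;; d) s m Q \<longleftrightarrow> runs d s m Q"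
  "runs (Store x a b ;; d) s m Q \<longleftrightarrow> runs d (upd s x (nval a s) (nval b s)) m Q"
  "runs (Decr x ;; d) s m Q \<longleftrightarrow> runs d (upd s x 0 (s x 0 - 1)) m Q"
  "runs (Branch t c d ;; e) s m Q \<longleftrightarrow>
    (if ntrue t s then runs (c ;; e) s m Q else runs (d ;; e) s m Q)"
  by (auto simp: runs_def nexec_iffs)

lemma runs_Then_assoc [simp]: "runs ((c ;; d) ;; e) s m Q \<longleftrightarrow> runs (c ;; d ;; e) s m Q"
proof -
  have "nexec (c ;; d ;; e) s i s'" if "nexec ((c ;; d) ;; e) s i s'" for i s'
    using that by (elim nexec_ThenE) (simp add: add.assoc nexec_Then)
  moreover have "nexec ((c ;; d) ;; e) s i s'" if "nexec (c ;; d ;; e) s i s'" for i s'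
    using that by (elim nexec_ThenE) (simp add: add.assoc[symmetric], blast intro: nexec_Then)
  ultimately have "nexec ((c ;; d) ;; e) s i s' \<longleftrightarrow> nexec (c ;; d ;; e) s i s'" for i s'
    by blast
  then show ?thesis by (simp add: runs_def)
qed

lemma runs_Then:
  assumes "runs c s m (\<lambda>s'. runs d s' m' Q)"
  shows "runs (c ;; d) s (m + m') Q"
  using assms unfolding runs_def by (meson nexec_Then add_mono)

text \<open>Meant for loops whose number \<open>M\<close> of iterations is known in advance: the
  invariant carries the iteration number, which replaces a termination measure, and
  \<open>f k\<close> bounds the inner iterations of round \<open>k\<close>.\<close>

lemma runs_for:
  assumes "I 0 s"
    and step: "\<And>k s. k < M \<Longrightarrow> I k s \<Longrightarrow> ntrue b s \<and> runs c s (f k) (I (Suc k))"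
    and stop: "\<And>s. I M s \<Longrightarrow> \<not> ntrue b s \<and> Q s"
  shows "runs (Loop b c) s (\<Sum>k<M. 1 + f k) Q"
proof -
  \<comment> \<open>Generalised to a start at round \<open>i\<close>, so that induction on the
    remaining \<open>M - i\<close> applies.\<close>
  have "runs (Loop b c) s (\<Sum>k=i..<M. 1 + f k) Q" if "i \<le> M" "I i s" for i s
    using that
  proof (induction "M - i" arbitrary: i s)
    case 0
    then have "\<not> ntrue b s" "Q s" using stop by auto
    then show ?case unfolding runs_def by (meson nexec_LoopF le0)
  next
    case (Suc d)
    then have i: "i < M" by simp
    with step Suc.prems obtain m' s' where 1: "ntrue b s" "nexec c s m' s'" "m' \<le> f i"
        "I (Suc i) s'"
      unfolding runs_def by blast
    have "runs (Loop b c) s' (\<Sum>k=Suc i..<M. 1 + f k) Q"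
      using Suc.hyps(1)[of "Suc i"] Suc.hyps(2) i 1(4) by simp
    then obtain m'' s'' where "nexec (Loop b c) s' m'' s''" "m'' \<le> (\<Sum>k=Suc i..<M. 1 + f k)" "Q s''"
      unfolding runs_def by blast
    moreover have "(\<Sum>k=i..<M. 1 + f k) = 1 + f i + (\<Sum>k=Suc i..<M. 1 + f k)"
      using i by (simp add: sum.atLeast_Suc_lessThan)
    ultimately show ?case
      unfolding runs_def using nexec_LoopT[OF 1(1,2)] 1(3) by (metis add_mono le_refl)
  qed
  from this[of 0 s] assms(1) show ?thesis by (simp add: lessThan_atLeast0)
qed

lemma runs_for_Then:
  assumes "I 0 s"
    and "\<And>k s. k < M \<Longrightarrow> I k s \<Longrightarrow> ntrue b s \<and> runs c s (f k) (I (Suc k))"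
    and "\<And>s. I M s \<Longrightarrow> \<not> ntrue b s \<and> runs d s m Q"
    and "(\<Sum>k<M. 1 + f k) + m \<le> m'"
  shows "runs (Loop b c ;; d) s m' Q"
proof -
  have "runs (Loop b c) s (\<Sum>k<M. 1 + f k) (\<lambda>s'. runs d s' m Q)"
    using assms(1-3) by (rule runs_for)
  from runs_Then[OF this] show ?thesis using assms(4) by (rule runs_mono) simp_all
qed

section \<open>Compilation to the random access machine\<close>

text \<open>Multiplication by a fixed number unfolds into additions because the machine cannot
  multiply. It is used with the number \<open>K\<close> of arrays, so addressing has constant
  cost.\<close>

primrec times :: "nat \<Rightarrow> aexp \<Rightarrow> aexp" where
  "times 0 a = Const 0"
| "times (Suc k) a = Add a (times k a)"

lemma aval_times [simp]: "aval (times k a) s = int k * aval a s"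
  by (induction k) (simp_all add: algebra_simps)

text \<open>The price of one counted iteration: one pass over the program text, with each loop test
  and body taken once and both branches of a conditional charged.\<close>

primrec csize :: "com \<Rightarrow> nat" where
  "csize Skip = 1"
| "csize (Put a b) = 1 + acost a + acost b"
| "csize (Seq c d) = csize c + csize d"
| "csize (Cond b c d) = 1 + bcost b + csize c + csize d"
| "csize (While b c) = 1 + bcost b + csize c"

text \<open>Array number 0 is the input, in its original place; the others are interleaved on the
  negative addresses. Address -1 stays unused.\<close>

locale layout =
  fixes num :: "'v \<Rightarrow> nat" and K :: nat
  assumes inj_num: "inj num" and num_less: "num x < K"
begin

definition addr :: "'v \<Rightarrow> int \<Rightarrow> int" where
  "addr x i = (if num x = 0 then i else - 1 - int (num x) - int K * i)"

definition addr_exp :: "'v \<Rightarrow> aexp \<Rightarrow> aexp" where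
  "addr_exp x a = (if num x = 0 then a else Sub (Const (- 1 - int (num x))) (times K a))"

primrec comp_exp :: "'v nexp \<Rightarrow> aexp" where
  "comp_exp (Lit i) = Const (int i)"
| "comp_exp (Cell x a) = Get (addr_exp x (comp_exp a))"
| "comp_exp (Plus a b) = Add (comp_exp a) (comp_exp b)"

primrec comp_test :: "'v ntest \<Rightarrow> bexp" where
  "comp_test (Lt a b) = Less (comp_exp a) (comp_exp b)"
| "comp_test (No b) = Neg (comp_test b)"
| "comp_test (Both b c) = Conj (comp_test b) (comp_test c)"

primrec compile :: "'v ncom \<Rightarrow> com" where
  "compile Nop = Skip"
| "compile (Store x a b) = Put (addr_exp x (comp_exp a)) (comp_exp b)"
| "compile (Decr x) =
    Cond (Less (Const 0) (Get (addr_exp x (Const 0))))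
      (Put (addr_exp x (Const 0)) (Sub (Get (addr_exp x (Const 0))) (Const 1))) Skip"
| "compile (c ;; d) = Seq (compile c) (compile d)"
| "compile (Branch b c d) = Cond (comp_test b) (compile c) (compile d)"
| "compile (Loop b c) = While (comp_test b) (compile c)"

definition represents :: "memory \<Rightarrow> 'v store \<Rightarrow> bool" where
  "represents s \<sigma> \<longleftrightarrow> (\<forall>x i. s (addr x (int i)) = int (\<sigma> x i))"

lemma aval_addr_exp: "aval (addr_exp x a) s = addr x (aval a s)"
  by (simp add: addr_exp_def addr_def)

lemma addr_neq: "addr x (int i) \<noteq> - 1"
proof -
  have "0 \<le> int K * int i" by simp
  then show ?thesis unfolding addr_def by (cases "num x = 0"; simp only: if_True if_False simp_thms; linarith)
qed

text \<open>The sign separates the input from the other arrays; among those, residue and quotient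
  modulo \<open>K\<close> recover the array and the index. Hence a write changes a single abstract
  cell.\<close>

lemma addr_eq_iff: "addr x (int i) = addr y (int j) \<longleftrightarrow> x = y \<and> i = j"
proof
  assume eq: "addr x (int i) = addr y (int j)"
  have neg: "- 1 - int a - int K * int b \<noteq> int c" for a b c
  proof -
    have "0 \<le> int K * int b" by simp
    then show ?thesis by linarith
  qed
  show "x = y \<and> i = j"
  proof (cases "num x = 0")
    case True
    then have "num y = 0" using eq neg[of "num y" j i] by (auto simp: addr_def split: if_splits)
    with True eq inj_num show ?thesis by (simp add: addr_def inj_def)
  next
    case False
    then have "num y \<noteq> 0" using eq neg[of "num x" i j] by (auto simp: addr_def split: if_splits)
    with False eq have "int (num x) + int K * int i = int (num y) + int K * int j"
      by (simp add: addr_def)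
    then have eq': "num x + K * i = num y + K * j"
      by (simp only: of_nat_mult[symmetric] of_nat_add[symmetric] of_nat_eq_iff)
    have "num x = (num x + K * i) mod K" "num y = (num y + K * j) mod K"
      using num_less by simp_all
    then have "num x = num y" using eq' by simp
    moreover from this have "i = j" using eq' num_less[of x] by simp
    ultimately show ?thesis using inj_num by (simp add: inj_eq)
  qed
qed simp

lemma represents_upd:
  assumes "represents s \<sigma>"
  shows "represents (s(addr x (int i) := int a)) (upd \<sigma> x i a)"
  using assms by (auto simp: represents_def addr_eq_iff upd_def)

lemma aval_comp_exp [simp]: "represents s \<sigma> \<Longrightarrow> aval (comp_exp a) s = int (nval a \<sigma>)"
  by (induction a) (simp_all add: aval_addr_exp represents_def)

lemma bval_comp_test [simp]: "represents s \<sigma> \<Longrightarrow> bval (comp_test b) s = ntrue b \<sigma>"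
  by (induction b) simp_all

text \<open>Each iteration pays one copy of \<open>csize\<close> for its test and body; the summand
  1 pays for what lies outside all iterations, such as a failing loop test. The clause on address -1
  lets a value stored there survive the computation.\<close>

theorem compile_correct:
  assumes "nexec c \<sigma> t \<sigma>'" "represents s \<sigma>"
  shows "\<exists>m s'. exec (compile c) s m s' \<and> represents s' \<sigma>' \<and> s' (- 1) = s (- 1) \<and>
    m \<le> csize (compile c) * (1 + t)"
  using assms
proof (induction arbitrary: s rule: nexec.induct)
  case (nexec_Nop \<sigma>)
  have "exec (compile Nop) s 1 s" unfolding compile.simps by (rule exec_Skip)
  with nexec_Nop show ?case by fastforce
next
  case (nexec_Store x a b \<sigma>)
  let ?s = "s(addr x (int (nval a \<sigma>)) := int (nval b \<sigma>))"
  have "exec (compile (Store x a b)) s (csize (compile (Store x a b))) ?s"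
    using exec_Put[of "addr_exp x (comp_exp a)" "comp_exp b" s] nexec_Store
    by (simp add: aval_addr_exp)
  moreover have "?s (- 1) = s (- 1)" using addr_neq[of x "nval a \<sigma>"] by simp
  ultimately show ?case using represents_upd[OF nexec_Store] by fastforce
next
  case (nexec_Decr x \<sigma>)
  have s: "s (addr x 0) = int (\<sigma> x 0)"
    using nexec_Decr unfolding represents_def by (metis of_nat_0)
  have ne: "addr x 0 \<noteq> - 1" using addr_neq[of x 0] by simp
  show ?case
  proof (cases "\<sigma> x 0 = 0")
    case True
    \<comment> \<open>Truncated subtraction: \<open>0 - 1 = 0\<close>, so the update writes back the
      old value and \<open>Skip\<close> is correct.\<close>
    then have "represents s (upd \<sigma> x 0 (\<sigma> x 0 - 1))"
      using nexec_Decr by (simp add: upd_def fun_upd_idem)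
    moreover have "exec (compile (Decr x)) s (1 + bcost (Less (Const 0) (Get (addr_exp x (Const 0)))) + 1) s"
      unfolding compile.simps by (rule exec_CondF, simp add: aval_addr_exp s True, rule exec_Skip)
    ultimately show ?thesis by (intro exI conjI) (assumption, assumption, simp_all)
  next
    case False
    then have "represents (s(addr x 0 := int (\<sigma> x 0) - 1)) (upd \<sigma> x 0 (\<sigma> x 0 - 1))"
      using represents_upd[OF nexec_Decr, of x 0 "\<sigma> x 0 - 1"] by (simp add: of_nat_diff)
    moreover have "exec (compile (Decr x)) s (1 + bcost (Less (Const 0) (Get (addr_exp x (Const 0))))
        + (1 + acost (addr_exp x (Const 0)) + acost (Sub (Get (addr_exp x (Const 0))) (Const 1))))
        (s(addr x 0 := int (\<sigma> x 0) - 1))"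
      unfolding compile.simps
      using exec_CondT[OF _ exec_Put, of "Less (Const 0) (Get (addr_exp x (Const 0)))" s
          "addr_exp x (Const 0)" "Sub (Get (addr_exp x (Const 0))) (Const 1)" Skip] False
      by (simp add: aval_addr_exp s)
    moreover from ne have "(s(addr x 0 := int (\<sigma> x 0) - 1)) (- 1) = s (- 1)" by simp
    ultimately show ?thesis by (intro exI conjI) (assumption, assumption, assumption, simp)
  qed
next
  case (nexec_Then c \<sigma> m \<sigma>' d m' \<sigma>'')
  obtain i s' where 1: "exec (compile c) s i s'" "represents s' \<sigma>'" "s' (- 1) = s (- 1)"
      "i \<le> csize (compile c) * (1 + m)"
    using nexec_Then.IH(1)[OF nexec_Then.prems] by blast
  obtain j s'' where 2: "exec (compile d) s' j s''" "represents s'' \<sigma>''" "s'' (- 1) = s' (- 1)"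
      "j \<le> csize (compile d) * (1 + m')"
    using nexec_Then.IH(2)[OF 1(2)] by blast
  have "exec (compile (c ;; d)) s (i + j) s''" using exec_Seq[OF 1(1) 2(1)] by simp
  moreover have "s'' (- 1) = s (- 1)" using 1(3) 2(3) by simp
  moreover have "i + j \<le> csize (compile (c ;; d)) * (1 + (m + m'))"
    using add_mono[OF 1(4) 2(4)] by (simp add: algebra_simps)
  ultimately show ?case using 2(2) by blast
next
  case (nexec_BranchT b \<sigma> c m \<sigma>' d)
  then obtain i s' where 1: "exec (compile c) s i s'" "represents s' \<sigma>'" "s' (- 1) = s (- 1)"
      "i \<le> csize (compile c) * (1 + m)" by blast
  have "exec (compile (Branch b c d)) s (1 + bcost (comp_test b) + i) s'"
    unfolding compile.simps using nexec_BranchT 1 by (intro exec_CondT) auto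
  moreover have "1 + bcost (comp_test b) + i \<le> csize (compile (Branch b c d)) * (1 + m)"
    using 1(4) by (simp add: algebra_simps)
  ultimately show ?case using 1 by blast
next
  case (nexec_BranchF b \<sigma> d m \<sigma>' c)
  then obtain i s' where 1: "exec (compile d) s i s'" "represents s' \<sigma>'" "s' (- 1) = s (- 1)"
      "i \<le> csize (compile d) * (1 + m)" by blast
  have "exec (compile (Branch b c d)) s (1 + bcost (comp_test b) + i) s'"
    unfolding compile.simps using nexec_BranchF 1 by (intro exec_CondF) auto
  moreover have "1 + bcost (comp_test b) + i \<le> csize (compile (Branch b c d)) * (1 + m)"
    using 1(4) by (simp add: algebra_simps)
  ultimately show ?case using 1 by blast
next
  case (nexec_LoopF b \<sigma> c)
  have "exec (compile (Loop b c)) s (1 + bcost (comp_test b)) s"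
    unfolding compile.simps using nexec_LoopF by (intro exec_WhileF) auto
  with nexec_LoopF.prems show ?case by (intro exI conjI) (assumption, assumption, simp_all)
next
  case (nexec_LoopT b \<sigma> c m \<sigma>' m' \<sigma>'')
  obtain i s' where 1: "exec (compile c) s i s'" "represents s' \<sigma>'" "s' (- 1) = s (- 1)"
      "i \<le> csize (compile c) * (1 + m)"
    using nexec_LoopT.IH(1)[OF nexec_LoopT.prems] by blast
  obtain j s'' where 2: "exec (compile (Loop b c)) s' j s''" "represents s'' \<sigma>''"
      "s'' (- 1) = s' (- 1)" "j \<le> csize (compile (Loop b c)) * (1 + m')"
    using nexec_LoopT.IH(2)[OF 1(2)] by blast
  have "exec (compile (Loop b c)) s (1 + bcost (comp_test b) + i + j) s''"
    unfolding compile.simps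
    using nexec_LoopT.hyps(1) nexec_LoopT.prems 1(1) 2(1) by (intro exec_WhileT[of _ _ _ _ s']) auto
  moreover have "1 + bcost (comp_test b) + i + j \<le> csize (compile (Loop b c)) * (1 + (1 + m + m'))"
    using add_mono[OF 1(4) 2(4)] by (simp add: algebra_simps)
  moreover have "s'' (- 1) = s (- 1)" using 1(3) 2(3) by simp
  ultimately show ?case using 2(2) by blast
qed

end

section \<open>Induced matchings with prescribed boundary states\<close>

text \<open>The state of a vertex outside \<open>F\<close> is 0 if it is deleted, 1 if it is kept and has no neighbour
  in \<open>R\<close>, and 2 if it is kept and has at most one neighbour in \<open>R\<close>.\<close>

definition present :: "'a set \<Rightarrow> ('a \<Rightarrow> nat) \<Rightarrow> 'a set \<Rightarrow> 'a \<Rightarrow> bool" where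
  "present F f R y \<longleftrightarrow> y \<in> R \<or> y \<notin> F \<and> f y \<noteq> 0"

text \<open>\<open>R\<close> is the set of kept vertices within \<open>F\<close>. The degree
  condition concerns vertices of \<open>R\<close> only, but counts kept neighbours on both sides;
  edges between two vertices outside \<open>F\<close> are checked later, when one of their ends is
  eliminated.\<close>

definition extends :: "('a \<Rightarrow> 'a \<Rightarrow> bool) \<Rightarrow> 'a set \<Rightarrow> ('a \<Rightarrow> nat) \<Rightarrow> 'a set \<Rightarrow> bool" where
  "extends E F f R \<longleftrightarrow> R \<subseteq> F \<and>
     (\<forall>x\<in>R. \<forall>y z. E x y \<longrightarrow> E x z \<longrightarrow> present F f R y \<longrightarrow> present F f R z \<longrightarrow> y = z) \<and>
     (\<forall>y. y \<notin> F \<longrightarrow> f y = 1 \<longrightarrow> (\<forall>x\<in>R. \<not> E y x)) \<and>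
     (\<forall>y. y \<notin> F \<longrightarrow> f y = 2 \<longrightarrow> (\<forall>x\<in>R. \<forall>x'\<in>R. E y x \<longrightarrow> E y x' \<longrightarrow> x = x'))"

text \<open>The empty set extends every labelling, so for finite \<open>F\<close> the maximum ranges
  over a nonempty finite set and no value for infeasibility is needed.\<close>

definition best :: "('a \<Rightarrow> 'a \<Rightarrow> bool) \<Rightarrow> 'a set \<Rightarrow> ('a \<Rightarrow> nat) \<Rightarrow> nat" where
  "best E F f = Max (card ` {R. extends E F f R})"

lemma extendsD:
  assumes "extends E F f R"
  shows "R \<subseteq> F"
    and "\<And>x y z. x \<in> R \<Longrightarrow> E x y \<Longrightarrow> E x z \<Longrightarrow> present F f R y \<Longrightarrow> present F f R z \<Longrightarrow> y = z"
    and "\<And>y x. y \<notin> F \<Longrightarrow> f y = 1 \<Longrightarrow> x \<in> R \<Longrightarrow> \<not> E y x"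
    and "\<And>y x x'. y \<notin> F \<Longrightarrow> f y = 2 \<Longrightarrow> x \<in> R \<Longrightarrow> x' \<in> R \<Longrightarrow> E y x \<Longrightarrow> E y x' \<Longrightarrow> x = x'"
  using assms by (simp_all add: extends_def)

lemma finite_extends: "finite F \<Longrightarrow> finite {R. extends E F f R}"
  by (rule finite_subset[of _ "Pow F"]) (auto simp: extends_def)

lemma extends_empty: "extends E F f {}"
  by (simp add: extends_def)

lemma card_le_best: "finite F \<Longrightarrow> extends E F f R \<Longrightarrow> card R \<le> best E F f"
  unfolding best_def by (rule Max_ge) (auto intro: finite_extends)

lemma best_attained:
  assumes "finite F"
  obtains R where "extends E F f R" "card R = best E F f"
proof -
  have "best E F f \<in> card ` {R. extends E F f R}"
    unfolding best_def using finite_extends[OF assms] extends_empty[of E F f]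
    by (intro Max_in) auto
  then show ?thesis using that by auto
qed

lemma best_empty [simp]: "best E {} f = 0"
  by (rule best_attained[of "{}" E f]) (auto simp: extends_def)

text \<open>A labelling matters only on the outside neighbours of \<open>F\<close>. This is what
  reduces a table to the labellings of one bag.\<close>

lemma extends_cong:
  assumes "\<And>x y. x \<in> F \<Longrightarrow> E x y \<Longrightarrow> y \<notin> F \<Longrightarrow> f y = g y" and "symp E" and "extends E F f R"
  shows "extends E F g R"
proof -
  have R: "R \<subseteq> F" using assms(3) by (simp add: extends_def)
  have p: "present F g R y \<longleftrightarrow> present F f R y" if "x \<in> R" "E x y" for x y
    using assms(1)[of x y] that R by (auto simp: present_def)
  have f: "f y = g y" if "x \<in> R" "E y x" "y \<notin> F" for x y
    using assms(1)[of x y] that R sympD[OF assms(2)] by auto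
  show ?thesis
    unfolding extends_def
  proof (intro conjI ballI allI impI)
    fix x y z assume "x \<in> R" "E x y" "E x z" "present F g R y" "present F g R z"
    then show "y = z" using assms(3) p unfolding extends_def by blast
  next
    fix y x assume "y \<notin> F" "g y = 1" "x \<in> R"
    then show "\<not> E y x" using assms(3) f[of x y] unfolding extends_def by auto
  next
    fix y x x' assume "y \<notin> F" "g y = 2" "x \<in> R" "x' \<in> R" "E y x" "E y x'"
    then show "x = x'" using assms(3) f[of x y] unfolding extends_def by auto
  qed (rule R)
qed

lemma best_cong:
  assumes "\<And>x y. x \<in> F \<Longrightarrow> E x y \<Longrightarrow> y \<notin> F \<Longrightarrow> f y = g y" and "symp E"
  shows "best E F f = best E F g"
proof -
  have "extends E F f R \<longleftrightarrow> extends E F g R" for R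
    using extends_cong[of F E f g R] extends_cong[of F E g f R] assms by metis
  then show ?thesis by (simp add: best_def)
qed

subsection \<open>Disjoint unions\<close>

text \<open>A code below 4 assigns states to a vertex with respect to two sets, and the resulting state
  with respect to their union: in state 2 the only neighbour may lie in either set.\<close>

definition code_left :: "nat \<Rightarrow> nat" where
  "code_left d = (if d = 0 then 0 else if d = 3 then 2 else 1)"

definition code_right :: "nat \<Rightarrow> nat" where
  "code_right d = (if d = 0 then 0 else if d = 2 then 2 else 1)"

definition code_union :: "nat \<Rightarrow> nat" where
  "code_union d = min d 2"

text \<open>No edge joins the two sets, so a kept vertex sees only its own side and the outside. A
  vertex in state 2 is granted its neighbour on exactly one side, since no code stands for the pair
  (2,2).\<close>

lemma extends_Un:
  assumes "F1 \<inter> F2 = {}" and "\<And>x y. x \<in> F1 \<Longrightarrow> y \<in> F2 \<Longrightarrow> \<not> E x y \<and> \<not> E y x"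
    and "\<And>y. D y \<le> 3"
    and "extends E F1 (code_left \<circ> D) R1" "extends E F2 (code_right \<circ> D) R2"
  shows "extends E (F1 \<union> F2) (code_union \<circ> D) (R1 \<union> R2)"
proof -
  let ?f1 = "code_left \<circ> D" and ?f2 = "code_right \<circ> D" and ?f = "code_union \<circ> D"
  note e1 = extendsD[OF assms(4)] and e2 = extendsD[OF assms(5)]
  have sub: "R1 \<subseteq> F1" "R2 \<subseteq> F2" using e1(1) e2(1) by blast+
  have nz: "?f1 y \<noteq> 0" "?f2 y \<noteq> 0" if "?f y \<noteq> 0" for y
    using that by (auto simp: code_left_def code_right_def code_union_def)
  have p1: "present F1 ?f1 R1 y" if "x \<in> R1" "E x y" "present (F1 \<union> F2) ?f (R1 \<union> R2) y" for x y
    using that sub assms(2)[of x y] nz(1)[of y] by (auto simp: present_def)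
  have p2: "present F2 ?f2 R2 y" if "x \<in> R2" "E x y" "present (F1 \<union> F2) ?f (R1 \<union> R2) y" for x y
    using that sub assms(2)[of y x] nz(2)[of y] by (auto simp: present_def)
  have 1: "?f1 y = 1 \<and> ?f2 y = 1" if "?f y = 1" for y
    using that by (auto simp: code_left_def code_right_def code_union_def min_def split: if_splits)
  have 2: "?f1 y = 1 \<and> ?f2 y = 2 \<or> ?f1 y = 2 \<and> ?f2 y = 1" if "?f y = 2" for y
    using that assms(3)[of y]
    by (auto simp: code_left_def code_right_def code_union_def min_def split: if_splits)
  show ?thesis
    unfolding extends_def
  proof (intro conjI ballI allI impI)
    show "R1 \<union> R2 \<subseteq> F1 \<union> F2" using sub by blast
  next
    fix x y z
    assume "x \<in> R1 \<union> R2" "E x y" "E x z"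
      "present (F1 \<union> F2) ?f (R1 \<union> R2) y" "present (F1 \<union> F2) ?f (R1 \<union> R2) z"
    then consider "x \<in> R1" "present F1 ?f1 R1 y" "present F1 ?f1 R1 z"
      | "x \<in> R2" "present F2 ?f2 R2 y" "present F2 ?f2 R2 z"
      using p1 p2 by blast
    then show "y = z" using \<open>E x y\<close> \<open>E x z\<close> e1(2) e2(2) by cases blast+
  next
    fix y x
    assume "y \<notin> F1 \<union> F2" "?f y = 1" "x \<in> R1 \<union> R2"
    then show "\<not> E y x" using 1[of y] e1(3)[of y x] e2(3)[of y x] by auto
  next
    fix y x x'
    assume y: "y \<notin> F1 \<union> F2" "?f y = 2" "x \<in> R1 \<union> R2" "x' \<in> R1 \<union> R2" "E y x" "E y x'"
    from 2[OF y(2)] show "x = x'"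
    proof
      assume f: "?f1 y = 1 \<and> ?f2 y = 2"
      then have "x \<in> R2" "x' \<in> R2" using y f e1(3)[of y x] e1(3)[of y x'] by auto
      then show ?thesis using f y e2(4)[of y x x'] by auto
    next
      assume f: "?f1 y = 2 \<and> ?f2 y = 1"
      then have "x \<in> R1" "x' \<in> R1" using y f e2(3)[of y x] e2(3)[of y x'] by auto
      then show ?thesis using f y e1(4)[of y x x'] by auto
    qed
  qed
qed

lemma extends_UnE:
  assumes "F1 \<inter> F2 = {}" and "\<And>x y. x \<in> F1 \<Longrightarrow> y \<in> F2 \<Longrightarrow> \<not> E x y \<and> \<not> E y x"
    and "\<And>y. f y \<le> 2" and "extends E (F1 \<union> F2) f R"
  obtains D where "\<And>y. D y \<le> 3" "code_union \<circ> D = f"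
    "extends E F1 (code_left \<circ> D) (R \<inter> F1)" "extends E F2 (code_right \<circ> D) (R \<inter> F2)"
proof -
  \<comment> \<open>Code 3 hands the permitted neighbour to \<open>F1\<close> if there is one in
    \<open>F1\<close>; code 2 hands it to \<open>F2\<close>, also when there is no kept neighbour at
    all.\<close>
  define D where "D y = (if f y = 2 then if \<exists>x\<in>R \<inter> F1. E y x then 3 else 2 else f y)" for y
  note R = extendsD(1)[OF assms(4)] and deg = extendsD(2)[OF assms(4)]
    and one = extendsD(3)[OF assms(4)] and two = extendsD(4)[OF assms(4)]
  have le3: "D y \<le> 3" for y using assms(3)[of y] by (simp add: D_def)
  have un: "code_union \<circ> D = f"
    using assms(3) by (auto simp: fun_eq_iff code_union_def D_def min_def intro: antisym)
  have z: "D y = 0 \<longleftrightarrow> f y = 0" for y by (auto simp: D_def)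
  have p: "present (F1 \<union> F2) f R y"
    if "x \<in> R" "E x y" "x \<in> F1 \<and> present F1 (code_left \<circ> D) (R \<inter> F1) y \<or>
      x \<in> F2 \<and> present F2 (code_right \<circ> D) (R \<inter> F2) y" for x y
    using that assms(2)[of x y] assms(2)[of y x] z[of y] R
    by (auto simp: present_def code_left_def code_right_def split: if_splits)
  have "extends E F1 (code_left \<circ> D) (R \<inter> F1)"
    unfolding extends_def
  proof (intro conjI ballI allI impI)
    fix x y z
    assume "x \<in> R \<inter> F1" "E x y" "E x z" "present F1 (code_left \<circ> D) (R \<inter> F1) y"
      "present F1 (code_left \<circ> D) (R \<inter> F1) z"
    then show "y = z" using deg[of x y z] p[of x] by blast
  next
    fix y x
    assume "y \<notin> F1" "(code_left \<circ> D) y = 1" "x \<in> R \<inter> F1"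
    moreover have "f y = 1 \<or> f y = 2 \<and> \<not> (\<exists>x\<in>R \<inter> F1. E y x)"
      using \<open>(code_left \<circ> D) y = 1\<close> assms(3)[of y]
      by (auto simp: D_def code_left_def split: if_splits)
    ultimately show "\<not> E y x" using one[of y x] assms(2)[of x y] by blast
  next
    fix y x x'
    assume "y \<notin> F1" "(code_left \<circ> D) y = 2" "x \<in> R \<inter> F1" "x' \<in> R \<inter> F1" "E y x" "E y x'"
    moreover have "f y = 2"
      using \<open>(code_left \<circ> D) y = 2\<close> assms(3)[of y]
      by (auto simp: D_def code_left_def split: if_splits)
    ultimately show "x = x'" using two[of y x x'] assms(2)[of x y] by blast
  qed blast
  moreover have "extends E F2 (code_right \<circ> D) (R \<inter> F2)"
    unfolding extends_def
  proof (intro conjI ballI allI impI)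
    fix x y z
    assume "x \<in> R \<inter> F2" "E x y" "E x z" "present F2 (code_right \<circ> D) (R \<inter> F2) y"
      "present F2 (code_right \<circ> D) (R \<inter> F2) z"
    then show "y = z" using deg[of x y z] p[of x] by blast
  next
    fix y x
    assume a: "y \<notin> F2" "(code_right \<circ> D) y = 1" "x \<in> R \<inter> F2"
    have "f y = 1 \<or> f y = 2 \<and> (\<exists>x\<in>R \<inter> F1. E y x)"
      using \<open>(code_right \<circ> D) y = 1\<close> assms(3)[of y]
      by (auto simp: D_def code_right_def split: if_splits)
    then show "\<not> E y x"
    proof
      assume "f y = 1"
      then show ?thesis using one[of y x] assms(2)[of y x] a by blast
    next
      assume "f y = 2 \<and> (\<exists>x\<in>R \<inter> F1. E y x)"
      \<comment> \<open>The neighbour in \<open>F1\<close> exhausts state 2, so another one in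
        \<open>F2\<close> would coincide with it, against disjointness.\<close>
      then obtain x' where "f y = 2" "x' \<in> R \<inter> F1" "E y x'" by blast
      then show ?thesis using two[of y x x'] assms(1) assms(2)[of y x] a by blast
    qed
  next
    fix y x x'
    assume "y \<notin> F2" "(code_right \<circ> D) y = 2" "x \<in> R \<inter> F2" "x' \<in> R \<inter> F2" "E y x" "E y x'"
    moreover have "f y = 2"
      using \<open>(code_right \<circ> D) y = 2\<close> assms(3)[of y]
      by (auto simp: D_def code_right_def split: if_splits)
    ultimately show "x = x'" using two[of y x x'] assms(2)[of y x] by blast
  qed blast
  ultimately show ?thesis using that le3 un by blast
qed

text \<open>Every coding yields a lower bound here, and by \<open>best_Un_le\<close> some coding
  attains the optimum; so the table of a union is a maximum over codings.\<close>

lemma best_Un_ge: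
  assumes "finite F1" "finite F2" "F1 \<inter> F2 = {}"
    and "\<And>x y. x \<in> F1 \<Longrightarrow> y \<in> F2 \<Longrightarrow> \<not> E x y \<and> \<not> E y x" and "\<And>y. D y \<le> 3"
  shows "best E F1 (code_left \<circ> D) + best E F2 (code_right \<circ> D) \<le> best E (F1 \<union> F2) (code_union \<circ> D)"
proof -
  obtain R1 where R1: "extends E F1 (code_left \<circ> D) R1" "card R1 = best E F1 (code_left \<circ> D)"
    using best_attained[OF assms(1)] by blast
  obtain R2 where R2: "extends E F2 (code_right \<circ> D) R2" "card R2 = best E F2 (code_right \<circ> D)"
    using best_attained[OF assms(2)] by blast
  have sub: "R1 \<subseteq> F1" "R2 \<subseteq> F2" using R1 R2 by (simp_all add: extends_def)
  have "card (R1 \<union> R2) = card R1 + card R2"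
    using sub assms(1-3) by (intro card_Un_disjoint) (auto intro: finite_subset)
  moreover have "extends E (F1 \<union> F2) (code_union \<circ> D) (R1 \<union> R2)"
    using assms(3-5) R1(1) R2(1) by (rule extends_Un)
  ultimately show ?thesis using card_le_best[of "F1 \<union> F2"] assms(1,2) R1(2) R2(2) by (metis finite_UnI)
qed

lemma best_Un_le:
  assumes "finite F1" "finite F2" "F1 \<inter> F2 = {}"
    and "\<And>x y. x \<in> F1 \<Longrightarrow> y \<in> F2 \<Longrightarrow> \<not> E x y \<and> \<not> E y x" and "\<And>y. f y \<le> 2"
  obtains D where "\<And>y. D y \<le> 3" "code_union \<circ> D = f"
    "best E (F1 \<union> F2) f \<le> best E F1 (code_left \<circ> D) + best E F2 (code_right \<circ> D)"
proof -
  obtain R where R: "extends E (F1 \<union> F2) f R" "card R = best E (F1 \<union> F2) f"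
    using best_attained[of "F1 \<union> F2"] assms(1,2) by blast
  obtain D where D: "\<And>y. D y \<le> 3" "code_union \<circ> D = f"
    "extends E F1 (code_left \<circ> D) (R \<inter> F1)" "extends E F2 (code_right \<circ> D) (R \<inter> F2)"
    using extends_UnE[OF assms(3-5) R(1)] by blast
  have "R = (R \<inter> F1) \<union> (R \<inter> F2)" using R(1) by (auto simp: extends_def)
  then have "card R \<le> card (R \<inter> F1) + card (R \<inter> F2)" by (metis card_Un_le)
  also have "\<dots> \<le> best E F1 (code_left \<circ> D) + best E F2 (code_right \<circ> D)"
    using D assms(1,2) by (intro add_mono card_le_best)
  finally show ?thesis using that D(1,2) R(2) by metis
qed

subsection \<open>Adding one vertex\<close>

definition boundary :: "('a \<Rightarrow> 'a \<Rightarrow> bool) \<Rightarrow> 'a set \<Rightarrow> ('a \<Rightarrow> nat) \<Rightarrow> 'a \<Rightarrow> 'a set" where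
  "boundary E F f v = {u. u \<notin> F \<and> E v u \<and> f u \<noteq> 0}"

text \<open>A neighbour in state 1 must push the sum beyond 1 on its own, whence the weight 2; a
  single counter then decides all cases.\<close>

definition load_of :: "nat \<Rightarrow> nat" where
  "load_of d = (if d < 2 then 2 else 1)"

text \<open>The vertex \<open>v\<close> can be kept only if it has at most one kept neighbour outside \<open>F\<close>, and that one is
  in state 2; the weights add up to 0 or 1 exactly in these cases.\<close>

definition step_value :: "('a \<Rightarrow> 'a \<Rightarrow> bool) \<Rightarrow> 'a set \<Rightarrow> ('a \<Rightarrow> nat) \<Rightarrow> 'a \<Rightarrow> nat" where
  "step_value E F f v =
    (let a = best E F (f(v := 0)); k = (\<Sum>u\<in>boundary E F f v. load_of (f u)) in
     if k = 0 then max a (1 + best E F (f(v := 2)))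
     else if k = 1 then max a (1 + best E F (\<lambda>u. if u = v \<or> u \<in> boundary E F f v then 1 else f u))
     else a)"

lemma extends_insert_delete:
  assumes "v \<notin> F" "extends E F (f(v := 0)) R"
  shows "extends E (insert v F) f R"
proof -
  have R: "R \<subseteq> F" using assms(2) by (simp add: extends_def)
  then have p: "present (insert v F) f R y = present F (f(v := 0)) R y" for y
    using assms(1) by (auto simp: present_def)
  note e = extendsD[OF assms(2)]
  show ?thesis
    unfolding extends_def p
  proof (intro conjI ballI allI impI)
    fix x y z assume "x \<in> R" "E x y" "E x z" "present F (f(v := 0)) R y" "present F (f(v := 0)) R z"
    then show "y = z" by (rule e(2))
  next
    fix y x assume "y \<notin> insert v F" "f y = 1" "x \<in> R"
    then show "\<not> E y x" using e(3)[of y x] by auto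
  next
    fix y x x' assume "y \<notin> insert v F" "f y = 2" "x \<in> R" "x' \<in> R" "E y x" "E y x'"
    then show "x = x'" using e(4)[of y x x'] by auto
  qed (use R in blast)
qed

text \<open>Without a kept neighbour outside \<open>F\<close>, the vertex \<open>v\<close> may still
  have one inside, so with respect to \<open>F\<close> it is in state 2.\<close>

lemma extends_insert_keep0:
  assumes "v \<notin> F" "\<not> E v v" "symp E" "boundary E F f v = {}" "extends E F (f(v := 2)) R"
  shows "extends E (insert v F) f (insert v R)"
proof -
  note R = extendsD(1)[OF assms(5)] and deg = extendsD(2)[OF assms(5)]
    and one = extendsD(3)[OF assms(5)] and two = extendsD(4)[OF assms(5)]
  have p: "present (insert v F) f (insert v R) y \<longleftrightarrow> present F (f(v := 2)) R y" for y
    using assms(1) R by (auto simp: present_def)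
  have inR: "y \<in> R" if "E v y" "present F (f(v := 2)) R y" for y
    using that assms(2,4) by (auto simp: present_def boundary_def split: if_splits)
  have nb: "\<not> E y v" if "y \<notin> F" "f y \<noteq> 0" for y
    using that assms(3,4) by (auto simp: boundary_def dest: sympD)
  show ?thesis
    unfolding extends_def p
  proof (intro conjI ballI allI impI)
    fix x y z
    assume "x \<in> insert v R" "E x y" "E x z" "present F (f(v := 2)) R y" "present F (f(v := 2)) R z"
    then show "y = z" using deg[of x y z] inR two[of v y z] assms(1) by auto
  next
    fix y x assume "y \<notin> insert v F" "f y = 1" "x \<in> insert v R"
    then show "\<not> E y x" using one[of y x] nb[of y] by auto
  next
    fix y x x' assume "y \<notin> insert v F" "f y = 2" "x \<in> insert v R" "x' \<in> insert v R" "E y x" "E y x'"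
    then show "x = x'" using two[of y x x'] nb[of y] by auto
  qed (use R in blast)
qed

text \<open>The outside neighbour \<open>u\<close> is the partner of \<open>v\<close>. Both are then
  saturated, so neither may have a kept neighbour in \<open>F\<close>, which is state 1 for
  both.\<close>

lemma extends_insert_keep1:
  assumes "v \<notin> F" "\<not> E v v" "symp E" "boundary E F f v = {u}" "f u = 2"
    "extends E F (f(u := 1, v := 1)) R"
  shows "extends E (insert v F) f (insert v R)"
proof -
  let ?g = "f(u := 1, v := 1)"
  have u: "u \<notin> F" "E v u" "u \<noteq> v" "E u v"
    using assms(2,3,4) by (auto simp: boundary_def dest: sympD)
  note R = extendsD(1)[OF assms(6)] and deg = extendsD(2)[OF assms(6)]
    and one = extendsD(3)[OF assms(6)] and two = extendsD(4)[OF assms(6)]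
  have p: "present (insert v F) f (insert v R) y \<longleftrightarrow> present F ?g R y" for y
    using assms(1,5) R u by (auto simp: present_def)
  have inR: "y = u" if "E v y" "present F ?g R y" for y
  proof (cases "y \<in> R")
    case True
    then show ?thesis using one[of v y] that(1) assms(1) by simp
  next
    case False
    then have "y \<in> boundary E F f v"
      using that assms(2,5) by (auto simp: present_def boundary_def split: if_splits)
    then show ?thesis using assms(4) by simp
  qed
  have nb: "y = u" if "E y v" "y \<notin> F" "f y \<noteq> 0" for y
    using that assms(3,4) by (auto simp: boundary_def dest: sympD)
  show ?thesis
    unfolding extends_def p
  proof (intro conjI ballI allI impI)
    fix x y z
    assume "x \<in> insert v R" "E x y" "E x z" "present F ?g R y" "present F ?g R z"
    then show "y = z" using deg[of x y z] inR by auto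
  next
    fix y x assume "y \<notin> insert v F" "f y = 1" "x \<in> insert v R"
    then show "\<not> E y x" using one[of y x] nb[of y] assms(5) by (cases "y = u") auto
  next
    fix y x x' assume "y \<notin> insert v F" "f y = 2" "x \<in> insert v R" "x' \<in> insert v R" "E y x" "E y x'"
    then show "x = x'" using two[of y x x'] nb[of y] one[of y x] one[of y x'] by (cases "y = u") auto
  qed (use R in blast)
qed

text \<open>The cases are exhaustive because two kept neighbours of \<open>v\<close> outside
  \<open>F\<close> would violate the degree bound at \<open>v\<close>.\<close>

lemma extends_insertE:
  assumes "v \<notin> F" "\<not> E v v" "symp E" "\<And>y. f y \<le> 2" "extends E (insert v F) f R"
  shows "v \<notin> R \<and> extends E F (f(v := 0)) R \<or>
    v \<in> R \<and> boundary E F f v = {} \<and> extends E F (f(v := 2)) (R - {v}) \<or>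
    v \<in> R \<and> (\<exists>u. boundary E F f v = {u} \<and> f u = 2 \<and> extends E F (f(u := 1, v := 1)) (R - {v}))"
proof -
  note R = extendsD(1)[OF assms(5)] and deg = extendsD(2)[OF assms(5)]
    and one = extendsD(3)[OF assms(5)] and two = extendsD(4)[OF assms(5)]
  show ?thesis
  proof (cases "v \<in> R")
    case False
    have sub: "R \<subseteq> F" using R False by blast
    have p: "present F (f(v := 0)) R y = present (insert v F) f R y" for y
      using sub assms(1) by (auto simp: present_def)
    have "extends E F (f(v := 0)) R"
      unfolding extends_def p
    proof (intro conjI ballI allI impI)
      fix x y z assume "x \<in> R" "E x y" "E x z" "present (insert v F) f R y" "present (insert v F) f R z"
      then show "y = z" by (rule deg)
    next
      fix y x assume "y \<notin> F" "(f(v := 0)) y = 1" "x \<in> R"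
      then show "\<not> E y x" using one[of y x] by (auto split: if_splits)
    next
      fix y x x' assume "y \<notin> F" "(f(v := 0)) y = 2" "x \<in> R" "x' \<in> R" "E y x" "E y x'"
      then show "x = x'" using two[of y x x'] by (auto split: if_splits)
    qed (rule sub)
    with False show ?thesis by blast
  next
    case True
    have sub: "R - {v} \<subseteq> F" using R by blast
    have bd: "E v y" "y \<noteq> v" "present (insert v F) f R y" if "y \<in> boundary E F f v" for y
      using that assms(2) by (auto simp: boundary_def present_def)
    show ?thesis
    proof (cases "boundary E F f v = {}")
      case emp: True
      have p: "present F (f(v := 2)) (R - {v}) y = present (insert v F) f R y" for y
        using R True assms(1) by (auto simp: present_def)
      have "extends E F (f(v := 2)) (R - {v})"
        unfolding extends_def p
      proof (intro conjI ballI allI impI)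
        fix x y z assume "x \<in> R - {v}" "E x y" "E x z" "present (insert v F) f R y"
          "present (insert v F) f R z"
        then show "y = z" using deg by blast
      next
        fix y x assume "y \<notin> F" "(f(v := 2)) y = 1" "x \<in> R - {v}"
        then show "\<not> E y x" using one[of y x] by (auto split: if_splits)
      next
        fix y x x' assume "y \<notin> F" "(f(v := 2)) y = 2" "x \<in> R - {v}" "x' \<in> R - {v}" "E y x" "E y x'"
        then show "x = x'"
          using two[of y x x'] deg[of v x x'] True by (cases "y = v") (auto simp: present_def)
      qed (rule sub)
      with True emp show ?thesis by blast
    next
      case ne: False
      then obtain u where u: "u \<in> boundary E F f v" by blast
      have all: "y = u" if "E v y" "present (insert v F) f R y" for y
        using deg[OF True that(1) bd(1)[OF u] that(2) bd(3)[OF u]] .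
      then have b: "boundary E F f v = {u}" using u bd by blast
      have u': "u \<notin> F" "E u v" "u \<noteq> v" "f u \<noteq> 0"
        using u bd(2)[OF u] assms(3) by (auto simp: boundary_def dest: sympD)
      have "f u \<noteq> 1" using one[of u v] u' True by blast
      then have f2: "f u = 2" using u'(4) assms(4)[of u] by linarith
      have p: "present F (f(u := 1, v := 1)) (R - {v}) y = present (insert v F) f R y" for y
        using R True assms(1) u' by (auto simp: present_def)
      have "extends E F (f(u := 1, v := 1)) (R - {v})"
        unfolding extends_def p
      proof (intro conjI ballI allI impI)
        fix x y z assume "x \<in> R - {v}" "E x y" "E x z" "present (insert v F) f R y"
          "present (insert v F) f R z"
        then show "y = z" using deg by blast
      next
        fix y x assume y: "y \<notin> F" "(f(u := 1, v := 1)) y = 1" "x \<in> R - {v}"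
        consider "y = v" | "y = u" | "y \<noteq> u" "y \<noteq> v" by blast
        then show "\<not> E y x"
        proof cases
          case 1
          then show ?thesis using all[of x] y(3) u' R by (auto simp: present_def)
        next
          case 2
          then show ?thesis using two[of u v x] u' f2 True y(3) by blast
        next
          case 3
          then show ?thesis using one[of y x] y by auto
        qed
      next
        fix y x x' assume "y \<notin> F" "(f(u := 1, v := 1)) y = 2" "x \<in> R - {v}" "x' \<in> R - {v}" "E y x" "E y x'"
        then show "x = x'" using two[of y x x'] by (auto split: if_splits)
      qed (rule sub)
      with True b f2 show ?thesis by blast
    qed
  qed
qed

text \<open>One elimination reduces the optimum to at most two lookups for the smaller set: the
  three insertion lemmas give the lower bound and \<open>extends_insertE\<close> the upper
  one.\<close>

lemma best_insert:
  assumes "finite F" "v \<notin> F" "\<not> E v v" "symp E" "\<And>y. f y \<le> 2" "finite (boundary E F f v)"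
  shows "best E (insert v F) f = step_value E F f v"
proof (rule antisym)
  define k where "k = (\<Sum>u\<in>boundary E F f v. load_of (f u))"
  have ge: "load_of d \<ge> 1" for d by (simp add: load_of_def)
  have k0: "k = 0 \<longleftrightarrow> boundary E F f v = {}"
    unfolding k_def using assms(6) ge by (auto simp: sum_eq_0_iff load_of_def)
  \<comment> \<open>All weights are at least 1, so a total of 1 means one neighbour of weight 1,
    that is, in state 2.\<close>
  have k1: "\<exists>u. boundary E F f v = {u} \<and> f u = 2" if k: "k = 1"
  proof -
    have "card (boundary E F f v) \<le> k"
      unfolding k_def using sum_mono[of "boundary E F f v" "\<lambda>_. 1" "\<lambda>u. load_of (f u)"] ge by simp
    then have "card (boundary E F f v) \<le> 1" using k by simp
    moreover have "boundary E F f v \<noteq> {}" using k k0 by simp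
    ultimately have "card (boundary E F f v) = 1" using assms(6) by (simp add: le_Suc_eq)
    then obtain u where u: "boundary E F f v = {u}" by (auto simp: card_1_singleton_iff)
    then have "load_of (f u) = 1" using k by (simp add: k_def)
    then have "f u = 2" using assms(5)[of u] by (simp add: load_of_def split: if_splits)
    with u show ?thesis by blast
  qed
  have upd: "(\<lambda>w. if w = v \<or> w \<in> {u} then 1 else f w) = f(u := 1, v := 1)" for u
    by (auto simp: fun_eq_iff)
  obtain R where R: "extends E (insert v F) f R" "card R = best E (insert v F) f"
    using best_attained[of "insert v F"] assms(1) by blast
  then have fin: "finite R" using assms(1) by (auto simp: extends_def intro: finite_subset)
  from extends_insertE[OF assms(2-5) R(1)]
  show "best E (insert v F) f \<le> step_value E F f v"
  proof (elim disjE conjE exE)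
    assume "extends E F (f(v := 0)) R"
    then have "card R \<le> best E F (f(v := 0))" using assms(1) by (intro card_le_best)
    then show ?thesis unfolding step_value_def Let_def R(2)[symmetric] by auto
  next
    assume "v \<in> R" "boundary E F f v = {}" "extends E F (f(v := 2)) (R - {v})"
    moreover from this have "card (R - {v}) \<le> best E F (f(v := 2))"
      using assms(1) by (intro card_le_best)
    ultimately have "card R \<le> 1 + best E F (f(v := 2))" using fin by (simp add: card_Diff_singleton)
    then show ?thesis
      using \<open>boundary E F f v = {}\<close> unfolding step_value_def Let_def R(2)[symmetric] by auto
  next
    fix u assume u: "v \<in> R" "boundary E F f v = {u}" "f u = 2"
      "extends E F (f(u := 1, v := 1)) (R - {v})"
    then have "card (R - {v}) \<le> best E F (f(u := 1, v := 1))"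
      using assms(1) by (intro card_le_best)
    then have "card R \<le> 1 + best E F (f(u := 1, v := 1))"
      using fin u(1) by (simp add: card_Diff_singleton)
    then show ?thesis
      using u(2,3) unfolding step_value_def Let_def R(2)[symmetric] u(2) upd
      by (simp add: load_of_def)
  qed
  have a: "best E F (f(v := 0)) \<le> best E (insert v F) f"
  proof -
    obtain R where "extends E F (f(v := 0)) R" "card R = best E F (f(v := 0))"
      using best_attained[OF assms(1)] by blast
    then show ?thesis
      using card_le_best[OF _ extends_insert_delete[OF assms(2)]] assms(1) by (metis finite_insert)
  qed
  have b: "1 + best E F g \<le> best E (insert v F) f"
    if g: "\<And>R. extends E F g R \<Longrightarrow> extends E (insert v F) f (insert v R)" for g
  proof -
    obtain R where R: "extends E F g R" "card R = best E F g"
      using best_attained[OF assms(1)] by blast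
    then have "R \<subseteq> F" by (simp add: extends_def)
    then have "card (insert v R) = 1 + card R"
      using assms(1,2) finite_subset[of R F] by (subst card_insert_disjoint) auto
    then show ?thesis using card_le_best[OF _ g[OF R(1)]] assms(1) R(2) by simp
  qed
  show "step_value E F f v \<le> best E (insert v F) f"
  proof -
    have c0: "1 + best E F (f(v := 2)) \<le> best E (insert v F) f" if "k = 0"
      using that k0 assms(2-4) by (intro b extends_insert_keep0) auto
    have c1: "1 + best E F (\<lambda>u. if u = v \<or> u \<in> boundary E F f v then 1 else f u) \<le>
      best E (insert v F) f" if k: "k = 1"
    proof -
      obtain u where u: "boundary E F f v = {u}" "f u = 2" using k1[OF k] by blast
      show ?thesis unfolding u(1) upd using u assms(2-4) by (intro b extends_insert_keep1) auto
    qed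
    show ?thesis unfolding step_value_def Let_def k_def[symmetric] using a c0 c1 by simp
  qed
qed

section \<open>Deletion to maximum degree one\<close>

lemma path_neighbour:
  assumes "is_path G p" "{hd p, last p} = {a, b}" "a \<noteq> b"
  obtains c where "c \<in> set p" "{a, c} \<in> edges G" "c \<noteq> a"
proof -
  have p: "p \<noteq> []" "distinct p" "successively (\<lambda>u v. {u, v} \<in> edges G) p"
    using assms(1) by (simp_all add: is_path_def)
  consider "hd p = a" "last p = b" | "last p = a" "hd p = b"
    using assms(2) by (auto simp: doubleton_eq_iff)
  then show ?thesis
  proof cases
    case 1
    then obtain q where "p = a # q" using p(1) by (cases p) auto
    moreover from this obtain c q' where "q = c # q'" using 1 assms(3) by (cases q) auto
    ultimately show ?thesis using that[of c] p by auto
  next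
    case 2
    then obtain q where q: "p = q @ [a]" using p(1) by (metis append_butlast_last_id)
    then obtain c q' where "q = q' @ [c]" using 2 assms(3) by (cases q rule: rev_cases) auto
    with q show ?thesis using that[of c] p by (auto simp: successively_append_iff insert_commute)
  qed
qed

text \<open>The paths of a model leave the image of the middle vertex through different neighbours;
  conversely, two neighbours give a model whose paths are single edges.\<close>

lemma topological_minor_P3_iff:
  assumes "simple_graph G"
  shows "topological_minor P3 G \<longleftrightarrow> (\<exists>x y z. y \<noteq> z \<and> {x, y} \<in> edges G \<and> {x, z} \<in> edges G)"
proof
  assume "topological_minor P3 G"
  then obtain \<phi> :: "nat \<Rightarrow> 'a" and P where tm: "inj_on \<phi> (verts P3)"
    "\<forall>e\<in>edges P3. is_path G (P e) \<and> {hd (P e), last (P e)} = \<phi> ` e"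
    "\<forall>e\<in>edges P3. set (P e) \<inter> \<phi> ` verts P3 = \<phi> ` e"
    "\<forall>e\<in>edges P3. \<forall>f\<in>edges P3. e \<noteq> f \<longrightarrow> set (P e) \<inter> set (P f) \<subseteq> \<phi> ` verts P3"
    unfolding topological_minor_def by (elim exE conjE)
  have V: "verts P3 = {0, 1, 2}" and E: "edges P3 = {{0, 1}, {1, 2}}" by (simp_all add: P3_def)
  have inj: "inj_on \<phi> {0, 1, 2}" using tm(1) V by simp
  have path: "is_path G (P e) \<and> {hd (P e), last (P e)} = \<phi> ` e" if "e \<in> {{0, 1}, {1, 2}}" for e
    using tm(2) that unfolding E by (rule bspec)
  have br: "set (P e) \<inter> \<phi> ` {0, 1, 2} = \<phi> ` e" if "e \<in> {{0, 1}, {1, 2}}" for e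
    using tm(3) that unfolding E V by (rule bspec)
  have dj: "set (P e) \<inter> set (P f) \<subseteq> \<phi> ` {0, 1, 2}"
    if "e \<in> {{0, 1}, {1, 2}}" "f \<in> {{0, 1}, {1, 2}}" "e \<noteq> f" for e f
    using bspec[OF bspec[OF tm(4)]] that unfolding E V by simp
  have ne: "\<phi> 0 \<noteq> \<phi> 1" "\<phi> 2 \<noteq> \<phi> 1" "\<phi> 0 \<noteq> \<phi> 2" using inj by (auto simp: inj_on_def)
  have e: "{0, 1} \<noteq> {1, 2 :: nat}" by (auto simp: doubleton_eq_iff)
  obtain y where y: "y \<in> set (P {0, 1})" "{\<phi> 1, y} \<in> edges G" "y \<noteq> \<phi> 1"
    using path_neighbour[of G "P {0, 1}" "\<phi> 1" "\<phi> 0"] path[of "{0, 1}"] ne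
    by (auto simp: insert_commute)
  obtain z where z: "z \<in> set (P {1, 2})" "{\<phi> 1, z} \<in> edges G" "z \<noteq> \<phi> 1"
    using path_neighbour[of G "P {1, 2}" "\<phi> 1" "\<phi> 2"] path[of "{1, 2}"] ne by auto
  \<comment> \<open>A common first step would lie on both paths and hence be a branch vertex on
    both, but only the middle one is.\<close>
  have "y \<noteq> z"
  proof
    assume "y = z"
    then have "y \<in> \<phi> ` {0, 1, 2}" using dj[of "{0, 1}" "{1, 2}"] e y(1) z(1) by blast
    then have "y \<in> \<phi> ` {0, 1}" "y \<in> \<phi> ` {1, 2}"
      using br[of "{0, 1}"] br[of "{1, 2}"] y(1) z(1) \<open>y = z\<close> by blast+
    then show False using y(3) ne by auto
  qed
  with y z show "\<exists>x y z. y \<noteq> z \<and> {x, y} \<in> edges G \<and> {x, z} \<in> edges G" by blast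
next
  assume "\<exists>x y z. y \<noteq> z \<and> {x, y} \<in> edges G \<and> {x, z} \<in> edges G"
  then obtain x y z where xyz: "y \<noteq> z" "{x, y} \<in> edges G" "{x, z} \<in> edges G" by blast
  then have v: "x \<in> verts G" "y \<in> verts G" "z \<in> verts G" "x \<noteq> y" "x \<noteq> z"
    using assms unfolding simple_graph_def by (fastforce simp: doubleton_eq_iff)+
  define \<phi> :: "nat \<Rightarrow> 'a" where "\<phi> i = (if i = 0 then y else if i = 1 then x else z)" for i
  define P :: "nat set \<Rightarrow> 'a list" where "P e = (if e = {0, 1} then [y, x] else [x, z])" for e
  have e: "{1, 2} \<noteq> {0, 1 :: nat}" by (auto simp: doubleton_eq_iff)
  have [simp]: "\<phi> 0 = y" "\<phi> (Suc 0) = x" "\<phi> 2 = z" "P {0, Suc 0} = [y, x]" "P {Suc 0, 2} = [x, z]"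
    using e by (simp_all add: \<phi>_def P_def)
  have "inj_on \<phi> (verts P3)" using xyz(1) v by (auto simp: P3_def)
  then show "topological_minor P3 G"
    unfolding topological_minor_def using v xyz e
    by (intro exI[of _ \<phi>] exI[of _ P]) (auto simp: P3_def is_path_def insert_commute)
qed

text \<open>Deleted and kept sets are complements of each other. No edge leaves
  \<open>verts G\<close>, so \<open>best\<close> has the same value for every labelling
  \<open>f\<close>.\<close>

lemma TM_Deletion_P3_iff:
  assumes "simple_graph G"
  shows "TM_Deletion {P3} G k \<longleftrightarrow>
    int (card (verts G)) \<le> k + int (best (\<lambda>u v. {u, v} \<in> edges G) (verts G) f)"
proof -
  let ?V = "verts G" and ?E = "\<lambda>u v. {u, v} \<in> edges G"
  have fin: "finite ?V" using assms by (simp add: simple_graph_def)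
  have EV: "u \<in> ?V \<and> v \<in> ?V" if "?E u v" for u v
    using assms that unfolding simple_graph_def by (fastforce simp: doubleton_eq_iff)
  have free: "\<not> topological_minor P3 (delete_verts G S) \<longleftrightarrow> extends ?E ?V f (?V - S)" for S
  proof -
    have "simple_graph (delete_verts G S)"
      using assms fin unfolding simple_graph_def delete_verts_def induced_def by fastforce
    then have "topological_minor P3 (delete_verts G S) \<longleftrightarrow>
        (\<exists>x y z. y \<noteq> z \<and> ?E x y \<and> ?E x z \<and> {x, y} \<subseteq> ?V - S \<and> {x, z} \<subseteq> ?V - S)"
      by (subst topological_minor_P3_iff) (auto simp: delete_verts_def induced_def)
    also have "\<dots> \<longleftrightarrow> \<not> extends ?E ?V f (?V - S)"
    proof -
      have p: "present ?V f (?V - S) y \<longleftrightarrow> y \<in> ?V - S" if "?E x y" for x y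
        using EV[OF that] by (auto simp: present_def)
      have "extends ?E ?V f (?V - S) \<longleftrightarrow>
          (\<forall>x\<in>?V - S. \<forall>y z. ?E x y \<longrightarrow> ?E x z \<longrightarrow> y \<in> ?V - S \<longrightarrow> z \<in> ?V - S \<longrightarrow> y = z)"
        unfolding extends_def using EV p by (smt (verit) Diff_subset)
      then show ?thesis by auto
    qed
    finally show ?thesis by blast
  qed
  show ?thesis
  proof
    assume "TM_Deletion {P3} G k"
    then obtain S where S: "S \<subseteq> ?V" "int (card S) \<le> k" "extends ?E ?V f (?V - S)"
      unfolding TM_Deletion_def using free by auto
    have "card (?V - S) \<le> best ?E ?V f" using S(3) fin by (intro card_le_best)
    moreover have "card (?V - S) + card S = card ?V"
      using S(1) fin by (metis card_Diff_subset card_mono finite_subset le_add_diff_inverse2)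
    ultimately show "int (card ?V) \<le> k + int (best ?E ?V f)" using S(2) by linarith
  next
    assume le: "int (card ?V) \<le> k + int (best ?E ?V f)"
    obtain R where R: "extends ?E ?V f R" "card R = best ?E ?V f"
      using best_attained[OF fin] by blast
    have sub: "R \<subseteq> ?V" using R(1) by (simp add: extends_def)
    then have "?V - (?V - R) = R" by blast
    then have "\<not> topological_minor P3 (delete_verts G (?V - R))" using R(1) free[of "?V - R"] by simp
    moreover have "card (?V - R) + card R = card ?V"
      using sub fin by (metis card_Diff_subset card_mono finite_subset le_add_diff_inverse2)
    ultimately show "TM_Deletion {P3} G k"
      unfolding TM_Deletion_def using le R(2) by (intro exI[of _ "?V - R"]) auto
  qed
qed

section \<open>Breadth-first order of a rooted tree\<close>

text \<open>The path is built from the back: prepending a vertex that already occurs cuts off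
  everything before that occurrence.\<close>

lemma walk_to_path:
  assumes "xs \<noteq> []" "successively P xs"
  shows "\<exists>ys. ys \<noteq> [] \<and> distinct ys \<and> successively P ys \<and> hd ys = hd xs \<and> last ys = last xs \<and>
    set ys \<subseteq> set xs"
  using assms
proof (induction xs)
  case (Cons x xs)
  show ?case
  proof (cases "xs = []")
    case True
    then show ?thesis by (intro exI[of _ "[x]"]) simp
  next
    case False
    then obtain ys where ys: "ys \<noteq> []" "distinct ys" "successively P ys" "hd ys = hd xs"
        "last ys = last xs" "set ys \<subseteq> set xs"
      using Cons by (auto simp: successively_Cons)
    show ?thesis
    proof (cases "x \<in> set ys")
      case True
      then obtain as bs where "ys = as @ x # bs" by (auto simp: in_set_conv_decomp)
      with ys False show ?thesis
        by (intro exI[of _ "x # bs"]) (auto simp: successively_append_iff)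
    next
      case nin: False
      have "P x (hd ys)" using Cons.prems False ys(4) by (simp add: successively_Cons)
      with ys nin False show ?thesis
        by (intro exI[of _ "x # ys"]) (auto simp: successively_Cons)
    qed
  qed
qed simp

locale rooted_tree =
  fixes T :: "'b graph" and r :: 'b
  assumes tree: "is_tree T" and root: "r \<in> verts T"
begin

lemma path_from_root:
  assumes "t \<in> verts T"
  obtains p where "is_path T p" "hd p = r" "last p = t"
  using assms root tree unfolding is_tree_def connected_graph_def by blast

lemma children_verts: "t \<in> children T r s \<Longrightarrow> t \<in> verts T \<and> s \<in> verts T"
  by (auto simp: children_def is_path_def)

lemma root_not_child: "r \<notin> children T r s"
proof
  assume "r \<in> children T r s"
  then obtain p where "distinct (p @ [s, r])" "hd (p @ [s, r]) = r"
    by (auto simp: children_def is_path_def)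
  then show False by (cases p) auto
qed

text \<open>Otherwise the walk from \<open>a\<close> up to the root and down to \<open>b\<close>
  avoids \<open>t\<close>; shortened to a path and closed through \<open>t\<close>, it becomes a
  cycle.\<close>

lemma parent_unique:
  assumes "t \<in> children T r a" "t \<in> children T r b"
  shows "a = b"
proof (rule ccontr)
  assume "a \<noteq> b"
  let ?E = "\<lambda>u v. {u, v} \<in> edges T"
  obtain p where p: "is_path T (p @ [a, t])" "hd (p @ [a, t]) = r" using assms(1) by (auto simp: children_def)
  obtain q where q: "is_path T (q @ [b, t])" "hd (q @ [b, t]) = r" using assms(2) by (auto simp: children_def)
  define u where "u = p @ [a]"
  define w where "w = q @ [b]"
  have u: "u \<noteq> []" "hd u = r" "last u = a" "successively ?E u" "set u \<subseteq> verts T" "t \<notin> set u" "?E a t"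
    using p unfolding u_def by (auto simp: is_path_def successively_append_iff hd_append split: if_splits)
  have w: "w \<noteq> []" "hd w = r" "last w = b" "successively ?E w" "set w \<subseteq> verts T" "t \<notin> set w" "?E b t"
    using q unfolding w_def by (auto simp: is_path_def successively_append_iff hd_append split: if_splits)
  have t: "t \<in> verts T" using assms(1) children_verts by blast
  have su: "successively ?E (rev u)" using u(4) by (simp add: insert_commute)
  have sw: "successively ?E (tl w)" "tl w \<noteq> [] \<longrightarrow> ?E r (hd (tl w))" "last (r # tl w) = b" "set (tl w) \<subseteq> set w"
    using w(1-4) by (cases w; auto simp: successively_Cons)+
  have "successively ?E (rev u @ tl w)"
    using su sw u(1,2) by (auto simp: successively_append_iff last_rev)
  moreover have "rev u @ tl w \<noteq> []" "hd (rev u @ tl w) = a" "last (rev u @ tl w) = b"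
    using u(1-3) sw(3) by (auto simp: hd_rev last_append last_rev split: if_splits)
  ultimately obtain ys where ys: "ys \<noteq> []" "distinct ys" "successively ?E ys" "hd ys = a" "last ys = b"
      "set ys \<subseteq> set (rev u @ tl w)"
    using walk_to_path[of "rev u @ tl w" ?E] by metis
  have sub: "set ys \<subseteq> verts T" "t \<notin> set ys" using ys(6) u(5,6) w(5,6) sw(4) by auto
  have "length ys \<ge> 2"
    using ys(1,4,5) \<open>a \<noteq> b\<close> by (cases ys; cases "tl ys") auto
  then have "is_cycle T (ys @ [t])"
    using ys sub t u(7) w(7) by (auto simp: is_cycle_def is_path_def successively_append_iff insert_commute)
  then show False using tree by (auto simp: is_tree_def)
qed

text \<open>Take a path from the root to \<open>a\<close>. If it misses \<open>b\<close>, it can be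
  prolonged to \<open>b\<close>; if \<open>b\<close> comes immediately before \<open>a\<close>, it
  shows \<open>a\<close> to be a child; an earlier occurrence of \<open>b\<close> would close a
  cycle.\<close>

lemma edge_child:
  assumes "{a, b} \<in> edges T"
  shows "a \<in> children T r b \<or> b \<in> children T r a"
proof -
  have ab: "a \<in> verts T" "b \<in> verts T" "a \<noteq> b"
    using assms tree unfolding is_tree_def simple_graph_def by (fastforce simp: doubleton_eq_iff)+
  obtain p where p: "is_path T p" "hd p = r" "last p = a" using path_from_root[OF ab(1)] by blast
  then obtain q where q: "p = q @ [a]" by (metis append_butlast_last_id is_path_def)
  show ?thesis
  proof (cases "b \<in> set p")
    case False
    then have "is_path T (q @ [a, b])"
      using p q assms ab by (auto simp: is_path_def successively_append_iff)
    moreover have "hd (q @ [a, b]) = r" using p(2) q by (cases q) auto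
    ultimately show ?thesis unfolding children_def by blast
  next
    case True
    then have "b \<in> set q" using q ab(3) by simp
    then obtain p1 p2 where p12: "q = p1 @ b # p2" by (auto simp: in_set_conv_decomp)
    show ?thesis
    proof (cases "p2 = []")
      case True
      then show ?thesis using p q p12 unfolding children_def by auto
    next
      case False
      have "is_path T (b # p2 @ [a])"
        using p(1) q p12 by (auto simp: is_path_def successively_append_iff)
      then have "is_cycle T (b # p2 @ [a])"
        using False assms by (cases p2) (auto simp: is_cycle_def)
      then show ?thesis using tree by (auto simp: is_tree_def)
    qed
  qed
qed

text \<open>Induction along paths from the root. It guarantees that the search cannot run dry before
  all nodes are found.\<close>

lemma verts_subset_closed:
  assumes "r \<in> A" and closed: "\<And>s t. s \<in> A \<Longrightarrow> t \<in> children T r s \<Longrightarrow> t \<in> A"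
  shows "verts T \<subseteq> A"
proof
  fix t assume "t \<in> verts T"
  then obtain p where p: "is_path T p" "hd p = r" "last p = t" by (rule path_from_root)
  have "last p \<in> A" using p(1,2)
  proof (induction p rule: rev_induct)
    case (snoc x q)
    show ?case
    proof (cases "q = []")
      case True
      then show ?thesis using snoc.prems assms(1) by simp
    next
      case False
      have "is_path T q" "hd q = r"
        using snoc.prems False by (auto simp: is_path_def successively_append_iff)
      then have "last q \<in> A" by (rule snoc.IH)
      moreover have "is_path T (butlast q @ [last q, x]) \<and> hd (butlast q @ [last q, x]) = r"
        using snoc.prems False append_butlast_last_id[OF False]
        by (metis append.assoc append_Cons append_Nil)
      then have "x \<in> children T r (last q)" unfolding children_def by blast
      ultimately show ?thesis using closed by simp
    qed
  qed (simp add: is_path_def)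
  with p(3) show "t \<in> A" by simp
qed

text \<open>The first edge goes down since \<open>x\<close> is no child of a later vertex. From then
  on the parent of each vertex has just been passed and cannot recur, so all further edges go down
  too.\<close>

lemma descending_path:
  fixes pos :: "'b \<Rightarrow> nat"
  assumes "\<And>s t. t \<in> children T r s \<Longrightarrow> pos s < pos t"
    and "successively (\<lambda>u v. {u, v} \<in> edges T) (x # ps)" "distinct (x # ps)"
    and "\<And>y. y \<in> set ps \<Longrightarrow> x \<notin> children T r y"
  shows "pos x \<le> pos (last (x # ps))"
  using assms(2-4)
proof (induction ps arbitrary: x)
  case (Cons y ys)
  have "{x, y} \<in> edges T" using Cons.prems(1) by simp
  then have y: "y \<in> children T r x" using edge_child Cons.prems(3)[of y] by auto
  have "y \<notin> children T r z" if "z \<in> set ys" for z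
    using parent_unique[OF y, of z] that Cons.prems(2) by auto
  then have "pos y \<le> pos (last (y # ys))" using Cons.prems by (intro Cons.IH) auto
  then show ?case using assms(1)[OF y] by simp
qed simp

end

section \<open>The breadth-first queue and its numbering of the nodes\<close>

locale numbered_tree = rooted_tree T r for T :: "nat graph" and r +
  fixes N :: nat and cs :: "nat \<Rightarrow> nat list"
  assumes verts_T: "verts T = {..<N}"
    and cs: "\<And>t. t < N \<Longrightarrow> distinct (cs t) \<and> set (cs t) = children T r t"
begin

text \<open>This is the queue after \<open>h\<close> nodes have been expanded. Nothing is ever
  removed, and entry \<open>h\<close> is the next to be expanded.\<close>

primrec bfs_upto :: "nat \<Rightarrow> nat list" where
  "bfs_upto 0 = [r]"
| "bfs_upto (Suc h) = bfs_upto h @ cs (bfs_upto h ! h)"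

definition bfs :: "nat list" where
  "bfs = bfs_upto N"

lemma bfs_upto_invariant:
  assumes "h \<le> N"
  shows "distinct (bfs_upto h) \<and> set (bfs_upto h) \<subseteq> {..<N} \<and> h \<le> length (bfs_upto h) \<and>
    (\<forall>i < length (bfs_upto h). 0 < i \<longrightarrow>
      (\<exists>j<i. j < h \<and> bfs_upto h ! i \<in> children T r (bfs_upto h ! j))) \<and>
    (\<forall>j<h. children T r (bfs_upto h ! j) \<subseteq> set (bfs_upto h)) \<and>
    (h < N \<longrightarrow> h < length (bfs_upto h)) \<and> bfs_upto h ! 0 = r \<and> bfs_upto h \<noteq> []"
  using assms
proof (induction h)
  case 0
  then show ?case using root verts_T by auto
next
  case (Suc h)
  let ?q = "bfs_upto h" and ?q' = "bfs_upto (Suc h)"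
  have IH: "distinct ?q" "set ?q \<subseteq> {..<N}" "h < length ?q" "?q ! 0 = r"
    "\<And>i. i < length ?q \<Longrightarrow> 0 < i \<Longrightarrow> \<exists>j<i. j < h \<and> ?q ! i \<in> children T r (?q ! j)"
    "\<And>j. j < h \<Longrightarrow> children T r (?q ! j) \<subseteq> set ?q"
    using Suc by auto
  have t: "?q ! h < N" using IH(2,3) nth_mem by blast
  \<comment> \<open>A queued node is the root or a child of a node expanded earlier, and parents are
    unique.\<close>
  have disj: "set ?q \<inter> children T r (?q ! h) = {}"
  proof (rule ccontr)
    assume "set ?q \<inter> children T r (?q ! h) \<noteq> {}"
    then obtain i where i: "i < length ?q" "?q ! i \<in> children T r (?q ! h)"
      by (metis IntE all_not_in_conv in_set_conv_nth)
    have "i \<noteq> 0" using i(2) IH(4) root_not_child by metis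
    then obtain j where "j < h" "?q ! i \<in> children T r (?q ! j)" using IH(5)[of i] i(1) by blast
    then show False
      using parent_unique[OF i(2)] IH(1,3) nth_eq_iff_index_eq[of ?q h j] by force
  qed
  have dist: "distinct ?q'" using IH(1) cs[OF t] disj by auto
  have sub: "set ?q' \<subseteq> {..<N}"
    using IH(2) cs[OF t] children_verts verts_T by auto
  have q: "?q' ! j = ?q ! j" if "j \<le> h" for j using that IH(3) by (simp add: nth_append)
  have par: "\<exists>j<i. j < Suc h \<and> ?q' ! i \<in> children T r (?q' ! j)"
    if i: "i < length ?q'" "0 < i" for i
  proof (cases "i < length ?q")
    case True
    then obtain j where "j < i" "j < h" "?q ! i \<in> children T r (?q ! j)" using IH(5)[OF True i(2)] by blast
    moreover have "?q' ! i = ?q ! i" using True by (simp add: nth_append)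
    moreover have "?q' ! j = ?q ! j" using \<open>j < h\<close> q[of j] by simp
    ultimately show ?thesis by (intro exI[of _ j]) (simp del: bfs_upto.simps)
  next
    case False
    then have "?q' ! i = cs (?q ! h) ! (i - length ?q)" by (simp add: nth_append)
    moreover have "i - length ?q < length (cs (?q ! h))" using i(1) False by simp
    ultimately have "?q' ! i \<in> children T r (?q ! h)" using cs[OF t] nth_mem by metis
    moreover have "?q' ! h = ?q ! h" using q[of h] by simp
    ultimately show ?thesis using IH(3) False by (intro exI[of _ h]) (simp del: bfs_upto.simps)
  qed
  have closed: "children T r (?q' ! j) \<subseteq> set ?q'" if "j < Suc h" for j
  proof (cases "j < h")
    case True
    then show ?thesis using q[of j] IH(6) by auto
  next
    case False
    then show ?thesis using that q[of h] cs[OF t] by (simp add: less_Suc_eq)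
  qed
  have len: "Suc h \<le> length ?q'" using IH(3) by simp
  \<comment> \<open>Were the queue exhausted, it would be closed under children and hence contain
    all \<open>N\<close> nodes.\<close>
  have "Suc h < length ?q'" if "Suc h < N"
  proof (rule ccontr)
    assume "\<not> Suc h < length ?q'"
    then have l: "length ?q' = Suc h" using len by linarith
    have "verts T \<subseteq> set ?q'"
    proof (rule verts_subset_closed)
      have "?q ! 0 \<in> set ?q" using IH(3) by (intro nth_mem) linarith
      then show "r \<in> set ?q'" using IH(4) by simp
    next
      fix s t assume s: "s \<in> set ?q'" and t: "t \<in> children T r s"
      obtain j where "j < length ?q'" "s = ?q' ! j" using s unfolding in_set_conv_nth by blast
      then show "t \<in> set ?q'" using closed[of j] l t by auto
    qed
    then have "card {..<N} \<le> card (set ?q')" using verts_T by (intro card_mono) auto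
    then show False using l that card_length[of ?q'] by simp
  qed
  moreover have "?q' ! 0 = r" using q[of 0] IH(4) by simp
  moreover have "?q' \<noteq> []" using len by auto
  ultimately show ?case using dist sub par closed len by blast
qed

lemma length_bfs: "length bfs = N"
proof -
  have "card (set bfs) \<le> card {..<N}"
    using bfs_upto_invariant[of N] by (intro card_mono) (auto simp: bfs_def)
  then show ?thesis using bfs_upto_invariant[of N] distinct_card[of bfs] by (simp add: bfs_def)
qed

lemma distinct_bfs: "distinct bfs" and bfs_0: "bfs ! 0 = r"
  using bfs_upto_invariant[of N] by (simp_all add: bfs_def)

lemma set_bfs: "set bfs = {..<N}"
  using bfs_upto_invariant[of N] length_bfs distinct_bfs
  by (intro card_subset_eq) (auto simp: bfs_def distinct_card)

lemma bfs_less: "i < N \<Longrightarrow> bfs ! i < N"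
  using nth_mem[of i bfs] by (simp add: set_bfs length_bfs)

lemma bfs_parent: "0 < i \<Longrightarrow> i < N \<Longrightarrow> \<exists>j<i. bfs ! i \<in> children T r (bfs ! j)"
  using bfs_upto_invariant[of N] length_bfs unfolding bfs_def by fastforce

lemma bfs_upto_append:
  assumes "h \<le> h'" shows "\<exists>ys. bfs_upto h' = bfs_upto h @ ys"
  using assms by (induction h' rule: dec_induct) auto

lemma bfs_upto_nth: "h \<le> N \<Longrightarrow> i < length (bfs_upto h) \<Longrightarrow> bfs_upto h ! i = bfs ! i"
  using bfs_upto_append[of h N] by (auto simp: bfs_def nth_append)

lemma length_bfs_upto: "h \<le> N \<Longrightarrow> length (bfs_upto h) \<le> N \<and> (h < N \<longrightarrow> h < length (bfs_upto h))"
proof -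
  assume h: "h \<le> N"
  obtain ys where "bfs = bfs_upto h @ ys" using bfs_upto_append[OF h] unfolding bfs_def by blast
  then have "length (bfs_upto h) \<le> N" using length_bfs by simp
  then show ?thesis using bfs_upto_invariant[OF h] by blast
qed

definition pos :: "nat \<Rightarrow> nat" where
  "pos t = (LEAST i. bfs ! i = t)"

lemma pos_bfs: "i < N \<Longrightarrow> pos (bfs ! i) = i"
  unfolding pos_def
proof (rule Least_equality)
  fix j assume "i < N" "bfs ! j = bfs ! i"
  then show "i \<le> j"
    using nth_eq_iff_index_eq[OF distinct_bfs, of j i] length_bfs by (cases "j < N") auto
qed simp

lemma bfs_pos: "t < N \<Longrightarrow> pos t < N \<and> bfs ! pos t = t"
proof -
  assume "t < N"
  then have "t \<in> set bfs" by (simp add: set_bfs)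
  then obtain i where "i < N" "bfs ! i = t" unfolding in_set_conv_nth length_bfs by blast
  then show ?thesis using pos_bfs by auto
qed

lemma pos_child:
  assumes "t \<in> children T r s" shows "pos s < pos t"
proof -
  have st: "s < N" "t < N" using children_verts[OF assms] verts_T by auto
  have "pos t \<noteq> 0" using bfs_pos[OF st(2)] bfs_0 assms root_not_child by metis
  then obtain j where "j < pos t" "t \<in> children T r (bfs ! j)"
    using bfs_parent[of "pos t"] bfs_pos[OF st(2)] by auto
  moreover from this have "bfs ! j = s" using parent_unique assms by blast
  moreover have "j < N" using \<open>j < pos t\<close> bfs_pos[OF st(2)] by simp
  ultimately show ?thesis using pos_bfs by auto
qed

end

section \<open>First bags in breadth-first order\<close>

locale nice_decomposition = numbered_tree T r N cs
  for T :: "nat graph" and r N :: nat and cs :: "nat \<Rightarrow> nat list" +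
  fixes G :: "nat graph" and X :: "nat \<Rightarrow> nat set" and n :: nat
  assumes simple: "simple_graph G" and verts_G: "verts G = {..<n}"
    and nice: "nice_tree_decomposition G T r X"
begin

definition first :: "nat \<Rightarrow> nat" where
  "first v = (LEAST i. i < N \<and> v \<in> X (bfs ! i))"

lemma decomposition: "tree_decomposition G T X"
  using nice by (simp add: nice_tree_decomposition_def)

lemma Union_bags: "(\<Union>t<N. X t) = {..<n}"
  and connected_bags: "v < n \<Longrightarrow> connected_graph (induced T {t \<in> verts T. v \<in> X t})"
  and edge_in_bag: "e \<in> edges G \<Longrightarrow> \<exists>t<N. e \<subseteq> X t"
  using decomposition verts_T verts_G by (auto simp: tree_decomposition_def)

lemma bag_subset: "t < N \<Longrightarrow> X t \<subseteq> {..<n}"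
  using Union_bags by auto

lemma bag_root: "X r = {}"
  using nice by (simp add: nice_tree_decomposition_def)

lemma first:
  assumes "v < n" shows "first v < N \<and> v \<in> X (bfs ! first v)"
proof -
  obtain t where "t < N" "v \<in> X t"
    using assms Union_bags by (metis UN_E lessThan_iff)
  then have "pos t < N \<and> v \<in> X (bfs ! pos t)" using bfs_pos by simp
  then show ?thesis unfolding first_def by (rule LeastI)
qed

lemma first_le: "i < N \<Longrightarrow> v \<in> X (bfs ! i) \<Longrightarrow> first v \<le> i"
  unfolding first_def by (rule Least_le) simp

lemma first_pos: "v < n \<Longrightarrow> 0 < first v"
  using first[of v] bfs_0 bag_root by (metis empty_iff gr0I)

text \<open>If the parent lacked \<open>v\<close>, the path through bags containing \<open>v\<close>
  from position \<open>i\<close> to the first such position could only descend, so \<open>i\<close>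
  would not exceed \<open>first v\<close>.\<close>

lemma parent_bag:
  assumes i: "i < N" "v \<in> X (bfs ! i)" "i \<noteq> first v" and child: "bfs ! i \<in> children T r s"
  shows "v \<in> X s"
proof (rule ccontr)
  assume nin: "v \<notin> X s"
  have "v < n" using i bag_subset bfs_less by blast
  then have m: "first v < N" "v \<in> X (bfs ! first v)" using first by auto
  let ?C = "{t \<in> verts T. v \<in> X t}"
  have C: "bfs ! i \<in> verts (induced T ?C)" "bfs ! first v \<in> verts (induced T ?C)"
    using i m bfs_less verts_T by (auto simp: induced_def)
  have "connected_graph (induced T ?C)"
    using \<open>v < n\<close> by (rule connected_bags)
  then obtain p where p: "is_path (induced T ?C) p" "hd p = bfs ! i" "last p = bfs ! first v"
    using C unfolding connected_graph_def by blast
  then obtain ps where ps: "p = bfs ! i # ps" by (cases p) (auto simp: is_path_def)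
  have sub: "set p \<subseteq> ?C" and dist: "distinct p"
    using p(1) by (auto simp: is_path_def induced_def)
  have "successively (\<lambda>u v. {u, v} \<in> edges (induced T ?C)) p" using p(1) by (simp add: is_path_def)
  then have succ: "successively (\<lambda>u v. {u, v} \<in> edges T) p"
    by (rule successively_mono) (simp add: induced_def)
  have "pos (bfs ! i) \<le> pos (last (bfs ! i # ps))"
  proof (rule descending_path)
    fix y assume "y \<in> set ps"
    then have "v \<in> X y" using sub ps by auto
    then show "bfs ! i \<notin> children T r y" using parent_unique[OF child] nin by blast
  qed (use pos_child succ dist ps in auto)
  then have "i \<le> first v" using p(3) ps pos_bfs i(1) m(1) by simp
  moreover have "first v \<le> i" using first_le i by blast
  ultimately show False using i(3) by simp
qed

text \<open>Climb from the shared bag to its parents: by \<open>parent_bag\<close> both vertices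
  persist until position \<open>first v\<close> is reached, as \<open>u\<close> is first seen no
  later. This is the clique property behind the elimination order.\<close>

lemma first_bag:
  assumes "i < N" "u \<in> X (bfs ! i)" "v \<in> X (bfs ! i)" "first u \<le> first v"
  shows "u \<in> X (bfs ! first v)"
  using assms(1-3)
proof (induction i rule: less_induct)
  case (less i)
  show ?case
  proof (cases "i = first v")
    case True
    then show ?thesis using less.prems by simp
  next
    case False
    then have "first v < i" using first_le less.prems by (metis le_neq_implies_less)
    then have i: "0 < i" "i \<noteq> first u" using assms(4) by auto
    obtain j where j: "j < i" "bfs ! i \<in> children T r (bfs ! j)"
      using bfs_parent[OF i(1) less.prems(1)] by blast
    have "v \<in> X (bfs ! j)" using parent_bag less.prems False j(2) by blast
    moreover have "u \<in> X (bfs ! j)" using parent_bag less.prems i(2) j(2) by blast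
    ultimately show ?thesis using less.IH[OF j(1)] j(1) less.prems(1) by simp
  qed
qed

text \<open>The parent of the first node containing a vertex forgets exactly this vertex.\<close>

lemma first_inj:
  assumes "u < n" "v < n" "first u = first v"
  shows "u = v"
proof -
  define m where "m = first v"
  have m: "m < N" "v \<in> X (bfs ! m)" "u \<in> X (bfs ! m)"
    using first assms unfolding m_def by metis+
  \<comment> \<open>The root bag is empty, so \<open>first v\<close> is positive and this node has a
    parent.\<close>
  obtain j where j: "j < m" "bfs ! m \<in> children T r (bfs ! j)"
    using bfs_parent[of m] m(1) first_pos[OF assms(2)] m_def by auto
  define s where "s = bfs ! j"
  have s: "s \<in> verts T" "bfs ! m \<in> children T r s" using j(2) children_verts s_def by auto
  have nin: "u \<notin> X s" "v \<notin> X s"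
    using first_le[of j] j(1) m(1) assms(3) unfolding s_def m_def by fastforce+
  from nice have "\<forall>t \<in> verts T.
      card (children T r t) \<le> 2 \<and>
      (children T r t = {} \<longrightarrow> X t = {}) \<and>
      (\<forall>t'. children T r t = {t'} \<longrightarrow>
         (\<exists>v. v \<notin> X t' \<and> X t = insert v (X t')) \<or> (\<exists>v. v \<in> X t' \<and> X t = X t' - {v})) \<and>
      (\<forall>t' t''. t' \<noteq> t'' \<and> children T r t = {t', t''} \<longrightarrow> X t = X t' \<and> X t = X t'')"
    unfolding nice_tree_decomposition_def by (elim conjE)
  note c = bspec[OF this s(1)]
  have fin: "finite (children T r s)"
    by (rule finite_subset[of _ "{..<N}"]) (use children_verts verts_T in auto)
  show ?thesis
  proof (cases "children T r s = {bfs ! m}")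
    case True
    then have "(\<exists>v. v \<notin> X (bfs ! m) \<and> X s = insert v (X (bfs ! m))) \<or>
        (\<exists>v. v \<in> X (bfs ! m) \<and> X s = X (bfs ! m) - {v})"
      using c by simp
    then show ?thesis using nin m by auto
  next
    case False
    then obtain t where t: "t \<in> children T r s" "t \<noteq> bfs ! m" using s(2) by blast
    \<comment> \<open>With at most two children these are all of them, so \<open>s\<close> is a join
      and its bag would contain \<open>v\<close>.\<close>
    have "{bfs ! m, t} = children T r s"
      using t s(2) c fin by (intro card_seteq) auto
    then have "X s = X (bfs ! m)" using c t(2) by metis
    then show ?thesis using nin m by simp
  qed
qed

lemma edge_bag:
  assumes "{u, v} \<in> edges G"
  shows "\<exists>i<N. u \<in> X (bfs ! i) \<and> v \<in> X (bfs ! i)"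
proof -
  obtain t where "t < N" "{u, v} \<subseteq> X t"
    using edge_in_bag[OF assms] by blast
  then show ?thesis using bfs_pos by (intro exI[of _ "pos t"]) simp
qed

end

section \<open>Dynamic programming along an elimination order\<close>

text \<open>What remains of the decomposition once its nodes are numbered: \<open>B i\<close> lists
  the bag at position \<open>i\<close>, and \<open>first_B\<close> is the clique property that
  replaces the tree.\<close>

locale elimination =
  fixes n N :: nat and E :: "nat \<Rightarrow> nat \<Rightarrow> bool" and B :: "nat \<Rightarrow> nat list" and first :: "nat \<Rightarrow> nat"
  assumes sym: "symp E" and irrefl: "\<not> E v v" and E_less: "E u v \<Longrightarrow> u < n"
    and N_pos: "0 < N" and B_0: "B 0 = []"
    and B_less: "i < N \<Longrightarrow> set (B i) \<subseteq> {..<n}" and B_distinct: "i < N \<Longrightarrow> distinct (B i)"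
    and first_pos: "v < n \<Longrightarrow> 0 < first v" and first_less: "v < n \<Longrightarrow> first v < N"
    and first_in: "v < n \<Longrightarrow> v \<in> set (B (first v))"
    and first_le: "i < N \<Longrightarrow> v \<in> set (B i) \<Longrightarrow> first v \<le> i"
    and first_inj: "u < n \<Longrightarrow> v < n \<Longrightarrow> first u = first v \<Longrightarrow> u = v"
    and first_B: "i < N \<Longrightarrow> u \<in> set (B i) \<Longrightarrow> v \<in> set (B i) \<Longrightarrow> first u \<le> first v \<Longrightarrow>
      u \<in> set (B (first v))"
    and edge_B: "E u v \<Longrightarrow> \<exists>i<N. u \<in> set (B i) \<and> v \<in> set (B i)"
begin

text \<open>The bag into which the vertex \<open>v\<close>, first seen in bag \<open>h\<close>, is merged; 0 is the bag of the root.\<close>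

definition target :: "nat \<Rightarrow> nat \<Rightarrow> nat" where
  "target h v = Max (insert 0 (first ` (set (B h) - {v})))"

text \<open>\<open>F j\<close> is the set of vertices eliminated so far whose information sits in the table of bag \<open>j\<close>,
  when the bags from \<open>h\<close> on have been processed.\<close>

definition parts :: "nat \<Rightarrow> (nat \<Rightarrow> nat set) \<Rightarrow> bool" where
  "parts h F \<longleftrightarrow>
     (\<forall>j<h. \<forall>k<h. j \<noteq> k \<longrightarrow> F j \<inter> F k = {}) \<and>
     (\<Union>j<h. F j) = {v. v < n \<and> h \<le> first v} \<and>
     (\<forall>j<h. \<forall>x\<in>F j. \<forall>y. E x y \<longrightarrow> y \<in> F j \<union> set (B j)) \<and>
     (\<forall>j<h. F j \<noteq> {} \<longrightarrow> j = 0 \<or> (\<exists>v<n. first v = j))"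

lemma parts_start: "parts N (\<lambda>_. {})"
  using first_less by (fastforce simp: parts_def)

lemma parts_stop: "parts 1 F \<Longrightarrow> F 0 = {..<n}"
  using first_pos by (fastforce simp: parts_def)

text \<open>By the last clause of \<open>parts\<close>, only the root bag and first bags ever
  receive information. A bag in which no vertex is new thus has an empty part and needs no
  work.\<close>

lemma parts_skip:
  assumes "parts (Suc h) F" "0 < h" "\<And>v. v < n \<Longrightarrow> first v \<noteq> h"
  shows "parts h F"
proof -
  have "F h = {}" using assms unfolding parts_def by blast
  then have "(\<Union>j<Suc h. F j) = (\<Union>j<h. F j)" by (simp add: lessThan_Suc)
  moreover have "{v. v < n \<and> Suc h \<le> first v} = {v. v < n \<and> h \<le> first v}"
    using assms(3) by (auto simp: Suc_le_eq le_less)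
  ultimately show ?thesis using assms(1) unfolding parts_def by auto
qed

lemma finite_part: "parts h F \<Longrightarrow> j < h \<Longrightarrow> finite (F j)"
  by (rule finite_subset[of _ "{..<n}"]) (auto simp: parts_def)

lemma target:
  assumes "h < N" "v \<in> set (B h)" "first v = h"
  shows target_less: "target h v < h"
    and target_B: "set (B h) - {v} \<subseteq> set (B (target h v))"
    and target_cases: "target h v = 0 \<or> (\<exists>u<n. first u = target h v)"
proof -
  have vn: "u < n" if "u \<in> set (B h)" for u using B_less[OF assms(1)] that by blast
  have lt: "first u < h" if "u \<in> set (B h) - {v}" for u
    using first_le[OF assms(1), of u] first_inj[of u v] vn[of u] vn[OF assms(2)] assms(3) that
    by fastforce
  have mem: "target h v \<in> insert 0 (first ` (set (B h) - {v}))"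
    unfolding target_def by (rule Max_in) auto
  have pos: "0 < h" using first_pos[OF vn[OF assms(2)]] assms(3) by simp
  have alt: "target h v = 0 \<or> (\<exists>u. u \<in> set (B h) - {v} \<and> target h v = first u)"
    using mem by (auto simp: image_iff)
  then show "target h v < h" using pos lt by metis
  from alt show "target h v = 0 \<or> (\<exists>u<n. first u = target h v)"
    using vn by (metis DiffD1)
  show "set (B h) - {v} \<subseteq> set (B (target h v))"
  proof
    fix u assume u: "u \<in> set (B h) - {v}"
    have le: "first u \<le> target h v" unfolding target_def using u by (intro Max_ge) auto
    then have "target h v \<noteq> 0" using first_pos[of u] vn[of u] u by auto
    then obtain w where "w \<in> set (B h) - {v}" "target h v = first w" using alt by metis
    then show "u \<in> set (B (target h v))" using first_B[OF assms(1), of u w] u le by auto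
  qed
qed

section \<open>Eliminating one vertex: its part is merged into the target part\<close>

context
  fixes h v F
  assumes h: "h < N" and v: "v < n" "first v = h" and parts: "parts (Suc h) F"
begin

private lemma v_in: "v \<in> set (B h)"
  using first_in v by blast

private lemmas tgt = target_less[OF h v_in v(2)] target_B[OF h v_in v(2)] target_cases[OF h v_in v(2)]

private lemma part_closed: "j \<le> h \<Longrightarrow> x \<in> F j \<Longrightarrow> E x y \<Longrightarrow> y \<in> F j \<or> y \<in> set (B j)"
  using parts unfolding parts_def by (metis UnE le_imp_less_Suc)

private lemma part_first: "j \<le> h \<Longrightarrow> x \<in> F j \<Longrightarrow> x < n \<and> h < first x"
  using parts unfolding parts_def by (metis (mono_tags, lifting) UN_I Suc_le_eq lessThan_iff
      le_imp_less_Suc mem_Collect_eq)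

private lemma part_disjoint: "j \<le> h \<Longrightarrow> k \<le> h \<Longrightarrow> j \<noteq> k \<Longrightarrow> F j \<inter> F k = {}"
  using parts unfolding parts_def by (metis le_imp_less_Suc)

private lemma part_B: "j \<le> h \<Longrightarrow> i \<le> h \<Longrightarrow> x \<in> F j \<Longrightarrow> x \<notin> set (B i)"
  using part_first[of j x] first_le[of i x] h by fastforce

text \<open>A neighbour first seen after \<open>h\<close> is already eliminated, and the bag of its
  part must contain \<open>v\<close>, which leaves only part \<open>h\<close>. Any other neighbour
  shares a bag with \<open>v\<close> and is pulled into bag \<open>h\<close> by
  \<open>first_B\<close>.\<close>

lemma neighbour_of_eliminated:
  assumes "E v w" shows "w \<in> F h \<or> w \<in> set (B h) - {v}"
proof (cases "h < first w")
  case True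
  have "w < n" using assms E_less sym by (meson sympD)
  then have "w \<in> (\<Union>j<Suc h. F j)"
    using True parts unfolding parts_def by auto
  then obtain j where j: "j \<le> h" "w \<in> F j" by (auto simp: less_Suc_eq_le)
  have "v \<notin> F j" using part_first[OF j(1), of v] v by auto
  then have "v \<in> set (B j)" using part_closed[OF j] assms sym by (meson sympD)
  then have "h \<le> j" using first_le[of j v] j(1) h v by simp
  then show ?thesis using j by simp
next
  case False
  obtain i where "i < N" "v \<in> set (B i)" "w \<in> set (B i)" using edge_B[OF assms] by blast
  then have "w \<in> set (B h)" using first_B[of i w v] False v(2) by simp
  then show ?thesis using assms irrefl by auto
qed

lemma finite_boundary: "finite (boundary E (F h) f v)"
  by (rule finite_subset[of _ "{..<n}"]) (use E_less sym in \<open>auto simp: boundary_def dest: sympD\<close>)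

lemma boundary_eq: "boundary E (F h) f v = {u \<in> set (B h). u \<noteq> v \<and> E v u \<and> f u \<noteq> 0}"
  using neighbour_of_eliminated part_B[of h h] by (auto simp: boundary_def irrefl)

private lemma new_closed:
  assumes "x \<in> insert v (F h)" "E x y" shows "y \<in> insert v (F h) \<or> y \<in> set (B (target h v))"
proof (cases "x = v")
  case True
  then show ?thesis using neighbour_of_eliminated assms(2) tgt(2) by blast
next
  case False
  then show ?thesis using part_closed[of h x y] assms tgt(2) by blast
qed

text \<open>Edges of a part end in the part or in its bag. The new vertices are in neither: parts
  are disjoint, and these vertices are first seen at \<open>h\<close> or later, while the target bag
  comes earlier.\<close>

private lemma separated:
  assumes "x \<in> F (target h v)" "y \<in> insert v (F h)"
  shows "\<not> E x y \<and> \<not> E y x"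
proof -
  let ?p = "target h v"
  have y: "y \<notin> set (B ?p)"
    using assms(2) tgt(1) first_le[of ?p v] h v part_B[of h ?p y] by auto
  have "y \<notin> F ?p"
    using assms(2) part_first[of ?p v] v part_disjoint[of ?p h] tgt(1) by auto
  then have "\<not> E x y" using part_closed[of ?p x y] assms(1) tgt(1) y by auto
  then show ?thesis using sym by (meson sympD)
qed

private lemma disjoint: "F (target h v) \<inter> insert v (F h) = {}"
  using part_first[of "target h v" v] v part_disjoint[of "target h v" h] tgt(1) by auto

text \<open>Entry \<open>h\<close> keeps a stale value, which is harmless because
  \<open>parts h\<close> looks only below \<open>h\<close>.\<close>

lemma parts_step: "parts h (F(target h v := F (target h v) \<union> insert v (F h)))"
proof -
  let ?p = "target h v"
  let ?F = "F(?p := F ?p \<union> insert v (F h))"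
  have nv: "v \<notin> F j" if "j \<le> h" for j using part_first[OF that, of v] v by auto
  have "?F j \<inter> ?F k = {}" if "j < h" "k < h" "j \<noteq> k" for j k
    using part_disjoint[of j k] part_disjoint[of j h] part_disjoint[of k h] nv[of j] nv[of k] that
    by auto
  moreover have "(\<Union>j<h. ?F j) = {u. u < n \<and> h \<le> first u}"
  proof -
    have "(\<Union>j<h. ?F j) = (\<Union>j<h. F j) \<union> F h \<union> {v}" using tgt(1) by auto
    also have "\<dots> = (\<Union>j<Suc h. F j) \<union> {v}" by (auto simp: lessThan_Suc)
    also have "(\<Union>j<Suc h. F j) = {v. v < n \<and> Suc h \<le> first v}"
      using parts unfolding parts_def by blast
    also have "\<dots> \<union> {v} = {u. u < n \<and> h \<le> first u}"
      using v first_inj by (auto simp: Suc_le_eq le_less)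
    finally show ?thesis .
  qed
  moreover have "y \<in> ?F j \<union> set (B j)" if "j < h" "x \<in> ?F j" "E x y" for j x y
    using that part_closed[of j x y] new_closed[of x y] by (cases "j = ?p") auto
  moreover have "j = 0 \<or> (\<exists>v<n. first v = j)" if "j < h" "?F j \<noteq> {}" for j
    using that tgt(3) parts unfolding parts_def by (cases "j = ?p") auto
  ultimately show ?thesis unfolding parts_def by blast
qed

definition merge_value :: "(nat \<Rightarrow> nat) \<Rightarrow> nat" where
  "merge_value D = best E (F (target h v)) (code_left \<circ> D) + step_value E (F h) (code_right \<circ> D) v"

private lemma best_new: "best E (insert v (F h)) (code_right \<circ> D) = step_value E (F h) (code_right \<circ> D) v"
  using finite_part[OF parts, of h] part_first[of h v] v irrefl sym finite_boundary
  by (intro best_insert) (auto simp: code_right_def)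

lemma merge_value_le:
  assumes "\<And>u. D u \<le> 3"
  shows "merge_value D \<le> best E (F (target h v) \<union> insert v (F h)) (code_union \<circ> D)"
  unfolding merge_value_def best_new[symmetric]
  using finite_part[OF parts] tgt(1) disjoint separated assms by (intro best_Un_ge) auto

lemma merge_value_ge:
  assumes "\<And>u. f u \<le> 2"
  obtains D where "\<And>u. D u \<le> 3" "code_union \<circ> D = f"
    "best E (F (target h v) \<union> insert v (F h)) f \<le> merge_value D"
proof -
  have "finite (F (target h v))" "finite (insert v (F h))"
    using finite_part[OF parts] tgt(1) by auto
  from best_Un_le[of "F (target h v)" "insert v (F h)" E f, OF this disjoint separated assms]
  obtain D where "\<And>u. D u \<le> 3" "code_union \<circ> D = f"
    "best E (F (target h v) \<union> insert v (F h)) f \<le> best E (F (target h v)) (code_left \<circ> D) +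
      best E (insert v (F h)) (code_right \<circ> D)"
    by blast
  then show ?thesis using that unfolding best_new merge_value_def by blast
qed

text \<open>The right summand, too, depends only on the target bag, because that bag contains bag
  \<open>h\<close> without \<open>v\<close>. Hence it suffices to run through the codes of the
  target bag.\<close>

lemma merge_value_cong:
  assumes "\<And>u. u \<in> set (B (target h v)) \<Longrightarrow> D u = D' u"
  shows "merge_value D = merge_value D'"
  unfolding merge_value_def best_new[symmetric]
proof (intro arg_cong2[of _ _ _ _ plus] best_cong sym)
  show "(code_left \<circ> D) y = (code_left \<circ> D') y" if "x \<in> F (target h v)" "E x y" "y \<notin> F (target h v)" for x y
    using part_closed[of "target h v" x y] that tgt(1) assms by auto
  show "(code_right \<circ> D) y = (code_right \<circ> D') y" if "x \<in> insert v (F h)" "E x y" "y \<notin> insert v (F h)" for x y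
    using new_closed[of x y] that assms by auto
qed

lemma best_merged_cong:
  assumes "\<And>u. u \<in> set (B (target h v)) \<Longrightarrow> f u = g u"
  shows "best E (F (target h v) \<union> insert v (F h)) f = best E (F (target h v) \<union> insert v (F h)) g"
proof (intro best_cong sym)
  show "f y = g y"
    if "x \<in> F (target h v) \<union> insert v (F h)" "E x y" "y \<notin> F (target h v) \<union> insert v (F h)" for x y
    using part_closed[of "target h v" x y] new_closed[of x y] that tgt(1) assms by auto
qed

end

end

section \<open>Positional codes\<close>

definition horner :: "nat list \<Rightarrow> nat" where
  "horner = foldl (\<lambda>a d. 4 * a + d) 0"

lemma horner_Nil [simp]: "horner [] = 0"
  by (simp add: horner_def)

lemma horner_snoc [simp]: "horner (ds @ [d]) = 4 * horner ds + d"
  by (simp add: horner_def)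

lemma horner_less: "(\<And>d. d \<in> set ds \<Longrightarrow> d < 4) \<Longrightarrow> horner ds < 4 ^ length ds"
proof (induction ds rule: rev_induct)
  case (snoc d ds)
  then have "horner ds < 4 ^ length ds" "d < 4" by auto
  then show ?case by simp
qed simp

lemma horner_inj:
  assumes "length ds = length es" "\<And>d. d \<in> set ds \<Longrightarrow> d < 4" "\<And>d. d \<in> set es \<Longrightarrow> d < 4"
    "horner ds = horner es"
  shows "ds = es"
  using assms
proof (induction ds arbitrary: es rule: rev_induct)
  case (snoc d ds)
  from snoc.prems(1) obtain e es' where es: "es = es' @ [e]" by (cases es rule: rev_cases) auto
  have "4 * horner ds + d = 4 * horner es' + e" "d < 4" "e < 4" using snoc.prems es by auto
  then have "horner ds = horner es' \<and> d = e" by presburger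
  then show ?case using snoc es by auto
qed simp

text \<open>The first entry is the least significant digit, so that repeated division reads a code
  in list order, whereas \<open>horner\<close> makes it the most significant one. The two orders
  need not agree: \<open>decode\<close> only enumerates codings, \<open>horner\<close> only
  addresses tables.\<close>

primrec decode :: "nat list \<Rightarrow> nat \<Rightarrow> nat \<Rightarrow> nat" where
  "decode [] c = (\<lambda>_. 0)"
| "decode (b # bs) c = (decode bs (c div 4))(b := c mod 4)"

lemma decode_le: "decode bs c u \<le> 3"
  by (induction bs arbitrary: c) (auto simp: le_less_Suc_eq less_Suc_eq_le[symmetric])

lemma decode_nth:
  assumes "distinct bs" "j < length bs"
  shows "decode bs c (bs ! j) = c div 4 ^ j mod 4"
  using assms
proof (induction bs arbitrary: c j)
  case (Cons b bs)
  show ?case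
  proof (cases j)
    case (Suc i)
    then have "bs ! i \<noteq> b" using Cons.prems by auto
    with Suc Cons show ?thesis by (simp add: div_mult2_eq)
  qed simp
qed simp

lemma encode_exists:
  assumes "distinct bs" "\<And>u. D u \<le> 3"
  shows "\<exists>c < 4 ^ length bs. \<forall>u \<in> set bs. decode bs c u = D u"
  using assms(1)
proof (induction bs)
  case (Cons b bs)
  then obtain c where c: "c < 4 ^ length bs" "\<forall>u \<in> set bs. decode bs c u = D u" by auto
  have d: "D b < 4" using assms(2)[of b] by simp
  have "4 * c + D b < 4 ^ length (b # bs)" using c(1) d by simp
  moreover have "\<forall>u \<in> set (b # bs). decode (b # bs) (4 * c + D b) u = D u"
    using c(2) d Cons.prems by auto
  ultimately show ?case by blast
qed simp

section \<open>The program\<close>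

datatype var =
    Input | Row | Adj | Off | Queue | Bag | Seen | New | Base | Tab | Quot | Rem | Codes | Val
  | Ix | Jx | Ptr | Ver | Hd | Tl | Num | Wid | Free | Fv | Par | Cd | Rs | Dg
  | Ia | Ir | Idel | Ikeep | Imat | Cnt | Opt

abbreviation sc :: "var \<Rightarrow> var nexp" where
  "sc x \<equiv> Cell x (Lit 0)"

abbreviation assign :: "var \<Rightarrow> var nexp \<Rightarrow> var ncom" (infix "::=" 60) where
  "x ::= a \<equiv> Store x (Lit 0) a"

abbreviation inc :: "var \<Rightarrow> var ncom" where
  "inc x \<equiv> x ::= Plus (sc x) (Lit 1)"

abbreviation Eq :: "var nexp \<Rightarrow> var nexp \<Rightarrow> var ntest" where
  "Eq a b \<equiv> Both (No (Lt a b)) (No (Lt b a))"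

abbreviation push :: "var \<Rightarrow> var nexp \<Rightarrow> var ncom" where
  "push x d \<equiv> x ::= Plus (Plus (Plus (sc x) (sc x)) (Plus (sc x) (sc x))) d"

text \<open>It runs over any list stored in the input at \<open>Ptr\<close> behind its length, so it
  also serves for lists of children.\<close>

definition for_bag :: "var ncom \<Rightarrow> var ncom" where
  "for_bag c = (Jx ::= Lit 0 ;;
     Loop (Lt (sc Jx) (Cell Input (sc Ptr)))
       (Ver ::= Cell Input (Plus (sc Ptr) (Plus (Lit 1) (sc Jx))) ;; c ;; inc Jx))"

text \<open>Right states are stored by vertex, since the bag of the eliminated vertex may list its
  entries in another order than the target bag. The left states and the resulting ones become table
  indices at once.\<close>

definition decode_digit :: "var ncom" where
  "decode_digit =
    (Dg ::= Cell Rem (sc Rs) ;; Rs ::= Cell Quot (sc Rs) ;;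
     Branch (Lt (sc Dg) (Lit 1))
       (Store Val (sc Ver) (Lit 0) ;; push Ia (Lit 0) ;; push Ir (Lit 0))
     (Branch (Lt (sc Dg) (Lit 2))
       (Store Val (sc Ver) (Lit 1) ;; push Ia (Lit 1) ;; push Ir (Lit 1))
     (Branch (Lt (sc Dg) (Lit 3))
       (Store Val (sc Ver) (Lit 2) ;; push Ia (Lit 1) ;; push Ir (Lit 2))
       (Store Val (sc Ver) (Lit 1) ;; push Ia (Lit 2) ;; push Ir (Lit 2)))))"

definition decode_code :: "var ncom" where
  "decode_code =
    (Ia ::= Lit 0 ;; Ir ::= Lit 0 ;; Rs ::= sc Cd ;; Ptr ::= Cell Bag (sc Par) ;;
     for_bag decode_digit)"

text \<open>A single pass prepares the three lookups of \<open>step_value\<close>: vertex deleted,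
  kept without an outside neighbour, kept with one. \<open>Imat\<close> marks every kept neighbour
  with 1, but is read only if \<open>Cnt\<close> is 1, when there is exactly one.\<close>

definition scan_vertex :: "var ncom" where
  "scan_vertex =
    Branch (Eq (sc Ver) (sc Fv))
      (push Idel (Lit 0) ;; push Ikeep (Lit 2) ;; push Imat (Lit 1))
      (Dg ::= Cell Val (sc Ver) ;; push Idel (sc Dg) ;; push Ikeep (sc Dg) ;;
       Branch (Both (Lt (Lit 0) (sc Dg)) (Lt (Lit 0) (Cell Adj (Plus (Cell Row (sc Fv)) (sc Ver)))))
         (push Imat (Lit 1) ;;
          Branch (Lt (sc Dg) (Lit 2)) (Cnt ::= Plus (sc Cnt) (Lit 2)) (Cnt ::= Plus (sc Cnt) (Lit 1)))
         (push Imat (sc Dg)))"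

definition scan_forgotten :: "var ncom" where
  "scan_forgotten =
    (Idel ::= Lit 0 ;; Ikeep ::= Lit 0 ;; Imat ::= Lit 0 ;; Cnt ::= Lit 0 ;; Ptr ::= Cell Bag (sc Hd) ;;
     for_bag scan_vertex)"

abbreviation improve :: "var \<Rightarrow> var ncom" where
  "improve x \<equiv> Rs ::= Plus (Lit 1) (Cell Tab (Plus (Cell Base (sc Hd)) (sc x))) ;;
     Branch (Lt (sc Opt) (sc Rs)) (Opt ::= sc Rs) Nop"

definition choose_value :: "var ncom" where
  "choose_value =
    (Opt ::= Cell Tab (Plus (Cell Base (sc Hd)) (sc Idel)) ;;
     Branch (Lt (sc Cnt) (Lit 1)) (improve Ikeep)
       (Branch (Lt (sc Cnt) (Lit 2)) (improve Imat) Nop))"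

definition record_value :: "var ncom" where
  "record_value =
    (Opt ::= Plus (Cell Tab (Plus (Cell Base (sc Par)) (sc Ia))) (sc Opt) ;;
     Branch (Lt (Cell Tab (Plus (sc Free) (sc Ir))) (sc Opt))
       (Store Tab (Plus (sc Free) (sc Ir)) (sc Opt)) Nop)"

definition raise_target :: "var ncom" where
  "raise_target =
    Branch (Both (No (Eq (sc Ver) (sc Fv))) (Lt (sc Par) (Cell Seen (sc Ver))))
      (Par ::= Cell Seen (sc Ver)) Nop"

definition find_target :: "var ncom" where
  "find_target = (Par ::= Lit 0 ;; Ptr ::= Cell Bag (sc Hd) ;; for_bag raise_target)"

abbreviation try_code :: "var ncom" where
  "try_code \<equiv>
    decode_code ;; scan_forgotten ;; choose_value ;; record_value ;; inc Cd"

abbreviation replace_table :: "var ncom" where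
  "replace_table \<equiv>
    Store Base (sc Par) (sc Free) ;; Free ::= Plus (sc Free) (sc Wid)"

text \<open>\<open>New\<close> holds the vertex plus one, hence \<open>Decr\<close>. The merged
  table goes to a fresh block, and only the pointer in \<open>Base\<close> is redirected.\<close>

definition eliminate :: "var ncom" where
  "eliminate =
    (Fv ::= Cell New (sc Hd) ;; Decr Fv ;; find_target ;;
     Cd ::= Lit 0 ;;
     Loop (Lt (sc Cd) (Cell Codes (sc Par)))
       (try_code) ;;
     replace_table)"

text \<open>The first \<open>Wid\<close> cells of \<open>Tab\<close> form an all-zero table that all
  bags share initially, as every \<open>Base\<close> entry is 0. The loop stops before position 0,
  the root, whose bag is empty.\<close>

definition eliminate_all :: "var ncom" where
  "eliminate_all =
    (Free ::= sc Wid ;; Hd ::= sc Num ;;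
     Loop (Lt (Lit 1) (sc Hd))
       (Decr Hd ;; Branch (Lt (Lit 0) (Cell New (sc Hd))) eliminate Nop))"

section \<open>Correctness of the elimination phase\<close>

lemma upd_simps [simp]:
  "upd s x i a x = (s x)(i := a)"
  "x \<noteq> y \<Longrightarrow> upd s x i a y = s y"
  by (simp_all add: upd_def)

definition same_except :: "var set \<Rightarrow> var store \<Rightarrow> var store \<Rightarrow> bool" where
  "same_except S s s' \<longleftrightarrow> (\<forall>x. x \<notin> S \<longrightarrow> s' x = s x)"

lemma same_except_refl [simp]: "same_except S s s"
  by (simp add: same_except_def)

lemma same_except_upd [simp]: "x \<in> S \<Longrightarrow> same_except S s (upd s' x i a) \<longleftrightarrow> same_except S s s'"
  by (auto simp: same_except_def upd_def)

lemma same_exceptD: "same_except S s s' \<Longrightarrow> x \<notin> S \<Longrightarrow> s' x = s x"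
  by (simp add: same_except_def)

definition bag_at :: "var store \<Rightarrow> nat \<Rightarrow> nat list \<Rightarrow> bool" where
  "bag_at s p bs \<longleftrightarrow> s Input p = length bs \<and> (\<forall>j<length bs. s Input (p + Suc j) = bs ! j)"

text \<open>The body has budget 0: iterations are counted once per list entry, and none of the
  bodies contains a loop.\<close>

lemma runs_for_bag:
  assumes bag: "bag_at s (s Ptr 0) bs" and "I 0 (upd s Jx 0 0)"
    and step: "\<And>j s'. j < length bs \<Longrightarrow> I j s' \<Longrightarrow> s' Jx 0 = j \<Longrightarrow> s' Ptr 0 = s Ptr 0 \<Longrightarrow>
      s' Input = s Input \<Longrightarrow>
      runs (c ;; inc Jx) (upd s' Ver 0 (bs ! j)) 0
        (\<lambda>s''. s'' Jx 0 = Suc j \<and> s'' Ptr 0 = s Ptr 0 \<and> s'' Input = s Input \<and> I (Suc j) s'')"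
    and stop: "\<And>s'. I (length bs) s' \<Longrightarrow> runs d s' m Q" and "length bs + m \<le> m'"
  shows "runs (for_bag c ;; d) s m' Q"
  unfolding for_bag_def runs_Then_assoc runs_simps
proof (rule runs_for_Then[where M = "length bs" and f = "\<lambda>_. 0" and m = m and
      I = "\<lambda>j s'. I j s' \<and> s' Jx 0 = j \<and> s' Ptr 0 = s Ptr 0 \<and> s' Input = s Input"])
  fix j s' assume j: "j < length bs"
    and s': "I j s' \<and> s' Jx 0 = j \<and> s' Ptr 0 = s Ptr 0 \<and> s' Input = s Input"
  have b: "s Input (s Ptr 0) = length bs" "s Input (s Ptr 0 + Suc j) = bs ! j"
    using bag j by (simp_all add: bag_at_def)
  show "ntrue (Lt (sc Jx) (Cell Input (sc Ptr))) s' \<and>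
    runs (Ver ::= Cell Input (Plus (sc Ptr) (Plus (Lit 1) (sc Jx))) ;; c ;; inc Jx) s' 0
      (\<lambda>s'. I (Suc j) s' \<and> s' Jx 0 = Suc j \<and> s' Ptr 0 = s Ptr 0 \<and> s' Input = s Input)"
  proof
    show "ntrue (Lt (sc Jx) (Cell Input (sc Ptr))) s'" using s' b j by simp
    have "runs (c ;; inc Jx) (upd s' Ver 0 (bs ! j)) 0
        (\<lambda>s'. I (Suc j) s' \<and> s' Jx 0 = Suc j \<and> s' Ptr 0 = s Ptr 0 \<and> s' Input = s Input)"
      by (rule runs_mono[OF step]) (use j s' in auto)
    then show "runs (Ver ::= Cell Input (Plus (sc Ptr) (Plus (Lit 1) (sc Jx))) ;; c ;; inc Jx) s' 0
        (\<lambda>s'. I (Suc j) s' \<and> s' Jx 0 = Suc j \<and> s' Ptr 0 = s Ptr 0 \<and> s' Input = s Input)"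
      using s' b by simp
  qed
next
  fix s' assume "I (length bs) s' \<and> s' Jx 0 = length bs \<and> s' Ptr 0 = s Ptr 0 \<and> s' Input = s Input"
  then show "\<not> ntrue (Lt (sc Jx) (Cell Input (sc Ptr))) s' \<and> runs d s' m Q"
    using stop bag by (simp add: bag_at_def)
qed (use assms(2,5) in auto)

lemma horner_take_Suc:
  "j < length bs \<Longrightarrow> horner (map f (take (Suc j) bs)) = 4 * horner (map f (take j bs)) + f (bs ! j)"
  by (simp add: take_Suc_conv_app_nth)

lemma sum_list_take_Suc:
  "j < length bs \<Longrightarrow> (\<Sum>u\<leftarrow>take (Suc j) bs. f u) = (\<Sum>u\<leftarrow>take j bs. f u) + f (bs ! j)"
  for f :: "'a \<Rightarrow> nat"
  by (simp add: take_Suc_conv_app_nth)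

section \<open>Specifications of the loops over a bag\<close>

lemma runs_decode_loop:
  assumes bag: "bag_at s (s Ptr 0) bs" "distinct bs" and c: "s Rs 0 < W"
    and tabs: "\<And>c. c < W \<Longrightarrow> s Quot c = c div 4 \<and> s Rem c = c mod 4"
    and init: "s Ia 0 = 0" "s Ir 0 = 0"
    and D: "D = decode bs (s Rs 0)"
    and cont: "\<And>s'. same_except {Ia, Ir, Rs, Jx, Ver, Dg, Val} s s' \<Longrightarrow>
      s' Ia 0 = horner (map (code_left \<circ> D) bs) \<Longrightarrow> s' Ir 0 = horner (map (code_union \<circ> D) bs) \<Longrightarrow>
      (\<And>u. u \<in> set bs \<Longrightarrow> s' Val u = code_right (D u)) \<Longrightarrow> runs d s' m Q"
    and "length bs + m \<le> m'"
  shows "runs (for_bag decode_digit ;; d) s m' Q"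
proof -
  let ?S = "{Ia, Ir, Rs, Jx, Ver, Dg, Val}"
  let ?I = "\<lambda>j s'. same_except ?S s s' \<and> s' Rs 0 = s Rs 0 div 4 ^ j \<and>
    s' Ia 0 = horner (map (code_left \<circ> D) (take j bs)) \<and>
    s' Ir 0 = horner (map (code_union \<circ> D) (take j bs)) \<and>
    (\<forall>i<j. s' Val (bs ! i) = code_right (D (bs ! i)))"
  show ?thesis
  proof (rule runs_for_bag[where bs = bs and m = m and I = ?I])
    fix j s'
    assume j: "j < length bs" and I: "?I j s'" and J: "s' Jx 0 = j" "s' Ptr 0 = s Ptr 0" "s' Input = s Input"
    have Q: "s' Quot = s Quot" "s' Rem = s Rem"
      using I by (auto intro: same_exceptD)
    \<comment> \<open>\<open>Quot\<close> and \<open>Rem\<close> are known only below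
      \<open>W\<close>; the successive quotients of the code stay in that range.\<close>
    have less: "s Rs 0 div 4 ^ j < W" using c by (meson div_le_dividend le_less_trans)
    have dig: "D (bs ! j) = s Rs 0 div 4 ^ j mod 4" using D decode_nth bag(2) j by simp
    have ne: "bs ! i \<noteq> bs ! j" if "i < j" for i
      using that j bag(2) by (simp add: nth_eq_iff_index_eq)
    have four: "s Rs 0 div 4 ^ j div 4 = s Rs 0 div 4 ^ Suc j"
      by (metis div_mult2_eq power_Suc2)
    have "D (bs ! j) < 4" using dig by simp
    then consider "D (bs ! j) = 0" | "D (bs ! j) = 1" | "D (bs ! j) = 2" | "D (bs ! j) = 3" by linarith
    then show "runs (decode_digit ;; inc Jx) (upd s' Ver 0 (bs ! j)) 0
        (\<lambda>s''. s'' Jx 0 = Suc j \<and> s'' Ptr 0 = s Ptr 0 \<and> s'' Input = s Input \<and> ?I (Suc j) s'')"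
      unfolding decode_digit_def
      by cases (use I J in \<open>simp_all add: Q less tabs dig[symmetric] four horner_take_Suc j ne
        less_Suc_eq code_left_def code_right_def code_union_def del: power_Suc\<close>)
  next
    fix s' assume "?I (length bs) s'"
    then show "runs d s' m Q" by (intro cont) (auto simp: in_set_conv_nth)
  qed (use assms in simp_all)
qed

lemma runs_decode_code:
  assumes bag: "bag_at s (s Bag (s Par 0)) bs" "distinct bs" and c: "s Cd 0 < W"
    and tabs: "\<And>c. c < W \<Longrightarrow> s Quot c = c div 4 \<and> s Rem c = c mod 4"
    and D: "D = decode bs (s Cd 0)"
    and cont: "\<And>s'. same_except {Ia, Ir, Rs, Jx, Ver, Dg, Val, Ptr} s s' \<Longrightarrow>
      s' Ia 0 = horner (map (code_left \<circ> D) bs) \<Longrightarrow> s' Ir 0 = horner (map (code_union \<circ> D) bs) \<Longrightarrow>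
      (\<And>u. u \<in> set bs \<Longrightarrow> s' Val u = code_right (D u)) \<Longrightarrow> runs d s' m Q"
    and "length bs + m \<le> m'"
  shows "runs (decode_code ;; d) s m' Q"
proof -
  let ?s = "upd (upd (upd (upd s Ia 0 0) Ir 0 0) Rs 0 (s Cd 0)) Ptr 0 (s Bag (s Par 0))"
  have "runs (for_bag decode_digit ;; d) ?s m' Q"
  proof (rule runs_decode_loop[where bs = bs and W = W and D = D and m = m])
    fix s'
    assume same: "same_except {Ia, Ir, Rs, Jx, Ver, Dg, Val} ?s s'"
      and vals: "s' Ia 0 = horner (map (code_left \<circ> D) bs)"
        "s' Ir 0 = horner (map (code_union \<circ> D) bs)" "\<And>u. u \<in> set bs \<Longrightarrow> s' Val u = code_right (D u)"
    show "runs d s' m Q"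
      using same by (intro cont vals) (auto simp: same_except_def upd_def)
  qed (use assms in \<open>simp_all add: bag_at_def\<close>)
  then show ?thesis by (simp add: decode_code_def)
qed

definition static_vars :: "var set" where
  "static_vars = {Input, Row, Adj, Bag, Seen, New, Codes, Quot, Rem, Wid}"

context elimination
begin

definition prepared :: "nat \<Rightarrow> var store \<Rightarrow> bool" where
  "prepared W s \<longleftrightarrow> s Input 0 = n \<and>
     (\<forall>j<N. bag_at s (s Bag j) (B j)) \<and>
     (\<forall>u<n. \<forall>v<n. 0 < s Adj (s Row u + v) \<longleftrightarrow> E u v) \<and>
     (\<forall>u<n. s Seen u = first u) \<and>
     (\<forall>v<n. s New (first v) = Suc v) \<and>
     (\<forall>j<N. (\<forall>v<n. first v \<noteq> j) \<longrightarrow> s New j = 0) \<and>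
     (\<forall>j<N. s Codes j = 4 ^ length (B j) \<and> 4 ^ length (B j) \<le> W) \<and>
     s Wid 0 = W \<and> (\<forall>c<W. s Quot c = c div 4 \<and> s Rem c = c mod 4)"

lemma prepared_same:
  assumes "prepared W s" "same_except S s s'" "S \<inter> static_vars = {}"
  shows "prepared W s'"
proof -
  have "s' x = s x" if "x \<in> static_vars" for x
    using assms(2,3) that by (auto intro: same_exceptD)
  then show ?thesis using assms(1) by (simp add: prepared_def static_vars_def bag_at_def)
qed

text \<open>\<open>Val\<close> is trusted only away from \<open>v\<close>: this vertex is not in the
  target bag, so its cell may be a leftover of an earlier elimination.\<close>

lemma runs_scan_forgotten:
  assumes prepared: "prepared W s" and h: "h < N" "s Hd 0 = h" and v: "v < n" "s Fv 0 = v"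
    and f: "\<And>u. u \<in> set (B h) \<Longrightarrow> u \<noteq> v \<Longrightarrow> s Val u = f u"
    and cont: "\<And>s'. same_except {Idel, Ikeep, Imat, Cnt, Dg, Jx, Ver, Ptr} s s' \<Longrightarrow>
      s' Idel 0 = horner (map (f(v := 0)) (B h)) \<Longrightarrow> s' Ikeep 0 = horner (map (f(v := 2)) (B h)) \<Longrightarrow>
      s' Imat 0 = horner (map (\<lambda>u. if u = v \<or> E v u \<and> f u \<noteq> 0 then 1 else f u) (B h)) \<Longrightarrow>
      s' Cnt 0 = (\<Sum>u\<leftarrow>B h. if u \<noteq> v \<and> E v u \<and> f u \<noteq> 0 then load_of (f u) else 0) \<Longrightarrow>
      runs d s' m Q"
    and "length (B h) + m \<le> m'"
  shows "runs (scan_forgotten ;; d) s m' Q"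
proof -
  let ?s = "upd (upd (upd (upd (upd s Idel 0 0) Ikeep 0 0) Imat 0 0) Cnt 0 0) Ptr 0 (s Bag h)"
  let ?S = "{Idel, Ikeep, Imat, Cnt, Dg, Jx, Ver, Ptr}"
  let ?w = "\<lambda>u. if u \<noteq> v \<and> E v u \<and> f u \<noteq> 0 then load_of (f u) else 0"
  let ?m = "\<lambda>u. if u = v \<or> E v u \<and> f u \<noteq> 0 then 1 else f u"
  let ?I = "\<lambda>j s'. same_except ?S s s' \<and>
    s' Idel 0 = horner (map (f(v := 0)) (take j (B h))) \<and> s' Ikeep 0 = horner (map (f(v := 2)) (take j (B h))) \<and>
    s' Imat 0 = horner (map ?m (take j (B h))) \<and> s' Cnt 0 = (\<Sum>u\<leftarrow>take j (B h). ?w u)"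
  have "runs (for_bag scan_vertex ;; d) ?s m' Q"
  proof (rule runs_for_bag[where bs = "B h" and m = m and I = ?I])
    fix j s'
    assume j: "j < length (B h)" and I: "?I j s'"
      and J: "s' Jx 0 = j" "s' Ptr 0 = ?s Ptr 0" "s' Input = ?s Input"
    have frame: "s' Val = s Val" "s' Adj = s Adj" "s' Row = s Row" "s' Fv = s Fv"
      using I by (auto intro: same_exceptD)
    let ?u = "B h ! j"
    have u: "?u \<in> set (B h)" "?u < n" using j B_less[OF h(1)] nth_mem by blast+
    have adj: "0 < s Adj (s Row v + ?u) \<longleftrightarrow> E v ?u"
      using prepared v(1) u(2) by (simp add: prepared_def)
    have val: "?u \<noteq> v \<Longrightarrow> s Val ?u = f ?u" using f u(1) by blast
    have eq: "(\<not> ?u < v \<and> \<not> v < ?u) = (?u = v)" by auto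
    show "runs (scan_vertex ;; inc Jx) (upd s' Ver 0 ?u) 0
        (\<lambda>s''. s'' Jx 0 = Suc j \<and> s'' Ptr 0 = ?s Ptr 0 \<and> s'' Input = ?s Input \<and> ?I (Suc j) s'')"
    proof (cases "?u = v")
      case True
      then show ?thesis
        using I J v by (simp add: scan_vertex_def frame horner_take_Suc j sum_list_take_Suc)
    next
      case False
      then have ne: "?u < v \<or> v < ?u" by auto
      show ?thesis
        using I J v ne False adj val[OF False]
        by (auto simp: scan_vertex_def frame horner_take_Suc j sum_list_take_Suc load_of_def)
    qed
  next
    fix s' assume "?I (length (B h)) s'"
    then show "runs d s' m Q" by (intro cont) simp_all
  next
    show "bag_at ?s (?s Ptr 0) (B h)" using prepared h by (simp add: prepared_def bag_at_def)
  qed (use assms in simp_all)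
  then show ?thesis using h by (simp add: scan_forgotten_def)
qed

lemma runs_find_target:
  assumes prepared: "prepared W s" and h: "h < N" "s Hd 0 = h" and v: "s Fv 0 = v"
    and cont: "\<And>s'. same_except {Par, Jx, Ver, Ptr} s s' \<Longrightarrow> s' Par 0 = target h v \<Longrightarrow> runs d s' m Q"
    and "length (B h) + m \<le> m'"
  shows "runs (find_target ;; d) s m' Q"
proof -
  let ?s = "upd (upd s Par 0 0) Ptr 0 (s Bag h)"
  let ?S = "{Par, Jx, Ver, Ptr}"
  let ?A = "\<lambda>j. insert 0 (first ` (set (take j (B h)) - {v}))"
  let ?I = "\<lambda>j s'. same_except ?S s s' \<and> s' Par 0 = Max (?A j)"
  have "runs (for_bag raise_target ;; d) ?s m' Q"
  proof (rule runs_for_bag[where bs = "B h" and m = m and I = ?I])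
    fix j s'
    assume j: "j < length (B h)" and I: "?I j s'"
      and J: "s' Jx 0 = j" "s' Ptr 0 = ?s Ptr 0" "s' Input = ?s Input"
    have frame: "s' Seen = s Seen" "s' Fv = s Fv"
      using I by (auto intro: same_exceptD)
    let ?u = "B h ! j"
    have u: "?u < n" using j B_less[OF h(1)] nth_mem by blast
    have seen: "s Seen ?u = first ?u" using prepared u by (simp add: prepared_def)
    have A: "?A (Suc j) = (if ?u = v then ?A j else insert (first ?u) (?A j))"
      using j by (auto simp: take_Suc_conv_app_nth)
    have M: "Max (?A (Suc j)) = (if ?u = v then Max (?A j) else max (first ?u) (Max (?A j)))"
      unfolding A by (simp only: if_split Max_insert[OF finite_insert[THEN iffD2]]) auto
    show "runs (raise_target ;; inc Jx) (upd s' Ver 0 ?u) 0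
        (\<lambda>s''. s'' Jx 0 = Suc j \<and> s'' Ptr 0 = ?s Ptr 0 \<and> s'' Input = ?s Input \<and> ?I (Suc j) s'')"
    proof -
      define a where "a = Max (?A j)"
      have "same_except ?S s s'" "s' Par 0 = a" using I by (simp_all add: a_def)
      moreover have "?u < v \<or> v < ?u \<longleftrightarrow> ?u \<noteq> v" by auto
      ultimately show ?thesis
        unfolding M a_def[symmetric] using J v seen by (auto simp: raise_target_def frame)
    qed
  next
    fix s' assume "?I (length (B h)) s'"
    then show "runs d s' m Q" by (intro cont) (simp_all add: target_def)
  next
    show "bag_at ?s (?s Ptr 0) (B h)" using prepared h by (simp add: prepared_def bag_at_def)
  qed (use assms in simp_all)
  then show ?thesis using h by (simp add: find_target_def)
qed

end

lemma runs_choose_value: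
  assumes "t = s Tab (s Base (s Hd 0) + s Idel 0)"
    and "b = (if s Cnt 0 = 0 then max t (1 + s Tab (s Base (s Hd 0) + s Ikeep 0))
       else if s Cnt 0 = 1 then max t (1 + s Tab (s Base (s Hd 0) + s Imat 0)) else t)"
    and cont: "\<And>s'. same_except {Opt, Rs} s s' \<Longrightarrow> s' Opt 0 = b \<Longrightarrow> runs d s' m Q"
  shows "runs (choose_value ;; d) s m Q"
proof -
  consider "s Cnt 0 = 0" | "s Cnt 0 = 1" | "s Cnt 0 > 1" by linarith
  then show ?thesis
    by cases (simp_all add: choose_value_def assms(1,2) cont max_def)
qed

lemma runs_record_value:
  assumes "a = s Tab (s Base (s Par 0) + s Ia 0) + s Opt 0"
    and cont: "\<And>s'. same_except {Opt, Tab} s s' \<Longrightarrow>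
      s' Tab = (s Tab)(s Free 0 + s Ir 0 := max (s Tab (s Free 0 + s Ir 0)) a) \<Longrightarrow> runs d s' m Q"
  shows "runs (record_value ;; d) s m Q"
  by (cases "s Tab (s Free 0 + s Ir 0) < a")
    (simp_all add: record_value_def assms(1)[symmetric] cont max_def)

context elimination
begin

text \<open>Tables end before \<open>Free\<close> and everything from there on is zero, so filling
  the next block disturbs no table in use. Positions whose base-4 digits include a 3 are left open,
  as only labellings with values up to 2 are looked up.\<close>

definition tables :: "nat \<Rightarrow> nat \<Rightarrow> (nat \<Rightarrow> nat set) \<Rightarrow> var store \<Rightarrow> bool" where
  "tables W h F s \<longleftrightarrow>
     (\<forall>j<h. s Base j + W \<le> s Free 0) \<and>
     (\<forall>j<h. \<forall>f. (\<forall>u. f u \<le> 2) \<longrightarrow> s Tab (s Base j + horner (map f (B j))) = best E (F j) f) \<and>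
     (\<forall>a\<ge>s Free 0. s Tab a = 0)"

context
  fixes h v :: nat and F :: "nat \<Rightarrow> nat set" and W p :: nat
  assumes h: "h < N" and v: "v < n" "first v = h" and parts: "parts (Suc h) F"
    and p: "p = target h v" and W: "4 ^ length (B p) \<le> W" "4 ^ length (B h) \<le> W"
begin

private abbreviation "D c \<equiv> decode (B p) c"
private abbreviation "index c \<equiv> horner (map (code_union \<circ> D c) (B p))"
private abbreviation "val c \<equiv> merge_value h v F (D c)"
private abbreviation "F' \<equiv> F(p := F p \<union> insert v (F h))"

private lemma p_less: "p < h" and B_sub: "set (B h) - {v} \<subseteq> set (B p)"
  using target_less[OF h _ v(2)] target_B[OF h _ v(2)] first_in[OF v(1)] v(2) p by auto

private lemma p_N: "p < N"
  using p_less h by simp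

private lemma horner_less_W:
  assumes "\<And>u. f u \<le> 3" "4 ^ length bs \<le> W" shows "horner (map f bs) < W"
proof -
  have "horner (map f bs) < 4 ^ length (map f bs)"
  proof (rule horner_less)
    fix d assume "d \<in> set (map f bs)"
    then obtain u where "d = f u" by auto
    then show "d < 4" using assms(1)[of u] by simp
  qed
  then show ?thesis using assms(2) by simp
qed

text \<open>The maximum of all values written to one cell. By \<open>horner_inj\<close>, codes with
  the same index label the target bag alike; the inserted 0 is the initial content of the
  cell.\<close>

lemma merged_table:
  assumes f: "\<And>u. f u \<le> 2"
  shows "Max (insert 0 (val ` {c. c < 4 ^ length (B p) \<and> index c = horner (map f (B p))})) = best E (F' p) f"
proof (rule antisym)
  let ?C = "{c. c < 4 ^ length (B p) \<and> index c = horner (map f (B p))}"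
  have "val c \<le> best E (F' p) f" if "c \<in> ?C" for c
  proof -
    have "map (code_union \<circ> D c) (B p) = map f (B p)"
    proof (rule horner_inj)
      show "horner (map (code_union \<circ> D c) (B p)) = horner (map f (B p))" using that by simp
    next
      fix d assume "d \<in> set (map f (B p))"
      then obtain u where "d = f u" by auto
      then show "d < 4" using f[of u] by simp
    qed (auto simp: code_union_def)
    then have "best E (F' p) (code_union \<circ> D c) = best E (F' p) f"
      using best_merged_cong[OF h v parts, of "code_union \<circ> D c" f] by (simp add: p)
    then show ?thesis using merge_value_le[OF h v parts, of "D c"] by (simp add: p decode_le)
  qed
  then show "Max (insert 0 (val ` ?C)) \<le> best E (F' p) f" by (intro Max.boundedI) auto
  obtain D' where D': "\<And>u. D' u \<le> 3" "code_union \<circ> D' = f" "best E (F' p) f \<le> merge_value h v F D'"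
    using merge_value_ge[OF h v parts, of f] f unfolding p fun_upd_same by blast
  obtain c where c: "c < 4 ^ length (B p)" "\<forall>u\<in>set (B p). D c u = D' u"
    using encode_exists[OF B_distinct[OF p_N], of D'] D'(1) by blast
  have "val c = merge_value h v F D'"
    using c(2) by (intro merge_value_cong[OF h v parts]) (simp add: p)
  moreover have "map (code_union \<circ> D c) (B p) = map f (B p)"
    using c(2) by (auto simp: D'(2)[symmetric])
  then have "index c = horner (map f (B p))" by (rule arg_cong)
  then have "c \<in> ?C" using c(1) by blast
  then have "val c \<le> Max (insert 0 (val ` ?C))" by (intro Max_ge) auto
  ultimately show "best E (F' p) f \<le> Max (insert 0 (val ` ?C))" using D'(3) by simp
qed

text \<open>\<open>s0\<close> is a state in which the tables are correct. Earlier codes of the same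
  elimination have changed \<open>Tab\<close> only from \<open>Free\<close> on, whereas all table
  lookups of \<open>merge_value\<close> stay below.\<close>

lemma runs_merge_code:
  assumes prep: "prepared W s" and tab: "tables W (Suc h) F s0"
    and same: "s Base = s0 Base" "s Free = s0 Free" "\<And>a. a < s0 Free 0 \<Longrightarrow> s Tab a = s0 Tab a"
    and vars: "s Hd 0 = h" "s Fv 0 = v" "s Par 0 = p" "s Cd 0 = c" "c < 4 ^ length (B p)"
    and cont: "\<And>s'. same_except {Ia, Ir, Rs, Jx, Ver, Dg, Val, Ptr, Idel, Ikeep, Imat, Cnt, Opt, Tab} s s' \<Longrightarrow>
      s' Tab = (s Tab)(s Free 0 + index c := max (s Tab (s Free 0 + index c)) (val c)) \<Longrightarrow>
      runs d s' m Q"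
    and m': "length (B p) + length (B h) + m \<le> m'"
  shows "runs (decode_code ;; scan_forgotten ;; choose_value ;; record_value ;; d) s m' Q"
proof (rule runs_decode_code[where bs = "B p" and W = W and D = "D c" and m = "length (B h) + m"])
  show "bag_at s (s Bag (s Par 0)) (B p)" using prep p_N vars(3) by (simp add: prepared_def)
  show "distinct (B p)" using B_distinct p_N .
  show "s Cd 0 < W" using vars W by simp
  show "s Quot c = c div 4 \<and> s Rem c = c mod 4" if "c < W" for c
    using prep that by (simp add: prepared_def)
  show "D c = decode (B p) (s Cd 0)" using vars by simp
  show "length (B p) + (length (B h) + m) \<le> m'" using m' by simp
next
  fix s'
  let ?S1 = "{Ia, Ir, Rs, Jx, Ver, Dg, Val, Ptr}"
  assume s': "same_except ?S1 s s'" "s' Ia 0 = horner (map (code_left \<circ> D c) (B p))" "s' Ir 0 = index c"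
    "\<And>u. u \<in> set (B p) \<Longrightarrow> s' Val u = code_right (D c u)"
  note f1 = same_exceptD[OF s'(1)]
  define f where "f = code_right \<circ> D c"
  have prep1: "prepared W s'" using prep s'(1) by (rule prepared_same) (simp add: static_vars_def)
  show "runs (scan_forgotten ;; choose_value ;; record_value ;; d) s' (length (B h) + m) Q"
  proof (rule runs_scan_forgotten[OF prep1 h _ v(1), where f = f and m = m])
    show "s' Hd 0 = h" "s' Fv 0 = v" using vars by (simp_all add: f1)
    show "s' Val u = f u" if "u \<in> set (B h)" "u \<noteq> v" for u
      using s'(4)[of u] that B_sub by (auto simp: f_def)
  next
    fix s1
    let ?S2 = "{Idel, Ikeep, Imat, Cnt, Dg, Jx, Ver, Ptr}"
    assume s1: "same_except ?S2 s' s1"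
      "s1 Idel 0 = horner (map (f(v := 0)) (B h))" "s1 Ikeep 0 = horner (map (f(v := 2)) (B h))"
      "s1 Imat 0 = horner (map (\<lambda>u. if u = v \<or> E v u \<and> f u \<noteq> 0 then 1 else f u) (B h))"
      "s1 Cnt 0 = (\<Sum>u\<leftarrow>B h. if u \<noteq> v \<and> E v u \<and> f u \<noteq> 0 then load_of (f u) else 0)"
    have f2: "s1 x = s x" if "x \<notin> ?S1" "x \<notin> ?S2" for x
      using same_exceptD[OF s1(1) that(2)] f1[OF that(1)] by simp
    note f3 = same_exceptD[OF s1(1)]
    have read: "s Tab (s Base j + horner (map g (B j))) = best E (F j) g"
      if "j \<in> {p, h}" "\<And>u. g u \<le> 2" for j g
    proof -
      have j: "j < Suc h" "4 ^ length (B j) \<le> W" using that(1) p_less W by auto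
      have "g u \<le> 3" for u using that(2)[of u] by simp
      then have "horner (map g (B j)) < W" using j(2) by (rule horner_less_W)
      moreover have "s0 Base j + W \<le> s0 Free 0" using tab j(1) by (simp add: tables_def)
      ultimately have "s0 Base j + horner (map g (B j)) < s0 Free 0" by linarith
      then show ?thesis using tab j(1) that(2) by (simp add: same tables_def)
    qed
    have f_le: "f u \<le> 2" for u by (simp add: f_def code_right_def)
    let ?bd = "boundary E (F h) f v"
    have bd: "u \<in> ?bd \<longleftrightarrow> u \<noteq> v \<and> E v u \<and> f u \<noteq> 0" if "u \<in> set (B h)" for u
      using boundary_eq[OF h v parts, of f] that by auto
    have Imat: "s1 Imat 0 = horner (map (\<lambda>u. if u = v \<or> u \<in> ?bd then 1 else f u) (B h))"
      unfolding s1(4) by (intro arg_cong[where f = horner] map_cong) (auto simp: bd)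
    have "s1 Cnt 0 = (\<Sum>u\<in>set (B h). if u \<noteq> v \<and> E v u \<and> f u \<noteq> 0 then load_of (f u) else 0)"
      unfolding s1(5) using B_distinct[OF h] by (simp add: sum_list_distinct_conv_sum_set)
    also have "\<dots> = (\<Sum>u\<in>?bd. load_of (f u))"
      unfolding boundary_eq[OF h v parts, of f] by (rule sum.inter_filter[symmetric]) simp
    finally have Cnt: "s1 Cnt 0 = (\<Sum>u\<in>?bd. load_of (f u))" .
    have t: "best E (F h) (f(v := 0)) = s1 Tab (s1 Base (s1 Hd 0) + s1 Idel 0)"
      using read[of h "f(v := 0)"] f_le vars by (simp add: f2 s1(2))
    have k: "best E (F h) (f(v := 2)) = s1 Tab (s1 Base (s1 Hd 0) + s1 Ikeep 0)"
      using read[of h "f(v := 2)"] f_le vars by (simp add: f2 s1(3))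
    have m: "best E (F h) (\<lambda>u. if u = v \<or> u \<in> ?bd then 1 else f u) =
        s1 Tab (s1 Base (s1 Hd 0) + s1 Imat 0)"
      using read[of h "\<lambda>u. if u = v \<or> u \<in> ?bd then 1 else f u"] f_le vars by (simp add: f2 Imat)
    have l: "best E (F p) (code_left \<circ> D c) = s1 Tab (s1 Base (s1 Par 0) + s1 Ia 0)"
      using read[of p "code_left \<circ> D c"] vars by (simp add: f2 f3 s'(2) code_left_def)
    have Ir: "s1 Ir 0 = index c" by (simp add: f3 s'(3))
    show "runs (choose_value ;; record_value ;; d) s1 m Q"
    proof (rule runs_choose_value[where s = s1, OF t, where b = "step_value E (F h) f v"])
      show "step_value E (F h) f v =
        (if s1 Cnt 0 = 0 then max (best E (F h) (f(v := 0))) (1 + s1 Tab (s1 Base (s1 Hd 0) + s1 Ikeep 0))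
         else if s1 Cnt 0 = 1 then max (best E (F h) (f(v := 0))) (1 + s1 Tab (s1 Base (s1 Hd 0) + s1 Imat 0))
         else best E (F h) (f(v := 0)))"
        unfolding k[symmetric] m[symmetric] Cnt step_value_def Let_def ..
    next
      fix s3 assume s3: "same_except {Opt, Rs} s1 s3" "s3 Opt 0 = step_value E (F h) f v"
      note f4 = same_exceptD[OF s3(1)]
      show "runs (record_value ;; d) s3 m Q"
      proof (rule runs_record_value[where a = "val c"])
        show "val c = s3 Tab (s3 Base (s3 Par 0) + s3 Ia 0) + s3 Opt 0"
          unfolding merge_value_def[OF h v parts] s3(2) p[symmetric] f_def[symmetric] by (simp add: f4 l)
      next
        fix s2 assume s2: "same_except {Opt, Tab} s3 s2"
          "s2 Tab = (s3 Tab)(s3 Free 0 + s3 Ir 0 := max (s3 Tab (s3 Free 0 + s3 Ir 0)) (val c))"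
        have "same_except {Ia, Ir, Rs, Jx, Ver, Dg, Val, Ptr, Idel, Ikeep, Imat, Cnt, Opt, Tab} s s2"
          using s'(1) s1(1) s3(1) s2(1) by (simp add: same_except_def)
        then show "runs d s2 m Q" using s2(2) by (intro cont) (simp_all add: f2 f4 Ir)
      qed
    qed
  qed simp
qed

lemma runs_eliminate:
  assumes prep: "prepared W s" and tab: "tables W (Suc h) F s" and Hd: "s Hd 0 = h"
    and cont: "\<And>s'. prepared W s' \<Longrightarrow> tables W h F' s' \<Longrightarrow> s' Hd 0 = h \<Longrightarrow> Q s'"
    and m: "length (B h) + 4 ^ length (B p) * (1 + length (B p) + length (B h)) \<le> m"
  shows "runs eliminate s m Q"
proof -
  let ?s = "upd s Fv 0 v"
  have New: "s New h = Suc v" using prep v by (auto simp: prepared_def)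
  have start: "runs eliminate s m Q \<longleftrightarrow> runs (find_target ;; Cd ::= Lit 0 ;;
     Loop (Lt (sc Cd) (Cell Codes (sc Par)))
       (try_code) ;;
     replace_table) ?s m Q"
    by (simp add: eliminate_def Hd New upd_def)
  have prep': "prepared W ?s"
    using prep by (rule prepared_same[where S = "{Fv}"]) (simp_all add: static_vars_def)
  show ?thesis
    unfolding start
  proof (rule runs_find_target[OF prep' h,
        where v = v and m = "4 ^ length (B p) * (1 + length (B p) + length (B h))"])
    fix s'
    let ?S = "{Par, Jx, Ver, Ptr}"
    assume s': "same_except ?S ?s s'" "s' Par 0 = target h v"
    let ?s' = "upd s' Cd 0 0"
    let ?S' = "{Ia, Ir, Rs, Jx, Ver, Dg, Val, Ptr, Idel, Ikeep, Imat, Cnt, Opt, Tab, Cd, Fv, Par}"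
    let ?a = "s Free 0"
    \<comment> \<open>Each new cell holds the maximum over the codes tried so far with that index,
      or 0 if there is none.\<close>
    let ?I = "\<lambda>c s1. same_except ?S' s s1 \<and> s1 Fv 0 = v \<and> s1 Par 0 = p \<and> s1 Cd 0 = c \<and>
      (\<forall>a<?a. s1 Tab a = s Tab a) \<and>
      (\<forall>i. s1 Tab (?a + i) = Max (insert 0 (val ` {c'. c' < c \<and> index c' = i})))"
    have prep'': "prepared W s1" if "same_except ?S' s s1" for s1
      using prep that by (rule prepared_same) (simp add: static_vars_def)
    have "same_except ?S' s ?s'" using s'(1) by (auto simp: same_except_def upd_def)
    moreover have "s' Tab = s Tab" "s' Fv 0 = v" using s'(1) by (simp_all add: same_except_def)
    ultimately have init: "?I 0 ?s'" using s'(2) tab p by (simp add: tables_def)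
    show "runs (Cd ::= Lit 0 ;; Loop (Lt (sc Cd) (Cell Codes (sc Par)))
        (try_code) ;;
      replace_table) s'
      (4 ^ length (B p) * (1 + length (B p) + length (B h))) Q"
      unfolding runs_simps nval.simps
    proof (rule runs_for_Then[where I = ?I and M = "4 ^ length (B p)" and m = 0
          and f = "\<lambda>_. length (B p) + length (B h)"])
      show "?I 0 ?s'" by (rule init)
    next
      fix c s1 assume c: "c < 4 ^ length (B p)" and I: "?I c s1"
      have frame: "s1 x = s x" if "x \<notin> ?S'" for x using I that by (intro same_exceptD) auto
      have P: "prepared W s1" using prep'' I by blast
      have Codes: "s1 Codes p = 4 ^ length (B p)" using P p_N by (simp add: prepared_def)
      show "ntrue (Lt (sc Cd) (Cell Codes (sc Par))) s1 \<and>
        runs (try_code) s1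
          (length (B p) + length (B h)) (?I (Suc c))"
      proof
        show "ntrue (Lt (sc Cd) (Cell Codes (sc Par))) s1" using I c Codes by simp
        show "runs (try_code) s1
            (length (B p) + length (B h)) (?I (Suc c))"
        proof (rule runs_merge_code[OF P tab, where c = c and m = 0])
          fix s2
          assume s2: "same_except {Ia, Ir, Rs, Jx, Ver, Dg, Val, Ptr, Idel, Ikeep, Imat, Cnt, Opt, Tab} s1 s2"
            "s2 Tab = (s1 Tab)(s1 Free 0 + index c := max (s1 Tab (s1 Free 0 + index c)) (val c))"
          have same: "same_except ?S' s s2" using s2(1) I by (simp add: same_except_def)
          have vars: "s2 Fv 0 = v" "s2 Par 0 = p" "s2 Cd 0 = c"
            using s2(1) I by (simp_all add: same_except_def)
          have T: "s2 Tab = (s1 Tab)(?a + index c := max (s1 Tab (?a + index c)) (val c))"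
            using s2(2) by (simp add: frame)
          have "s2 Tab (?a + i) = Max (insert 0 (val ` {c'. c' < Suc c \<and> index c' = i}))" for i
          proof -
            let ?C = "{c'. c' < c \<and> index c' = i}"
            have C: "{c'. c' < Suc c \<and> index c' = i} = (if index c = i then insert c ?C else ?C)"
              by (auto simp: less_Suc_eq)
            have old: "s1 Tab (?a + i) = Max (insert 0 (val ` ?C))" using I by blast
            show ?thesis
            proof (cases "index c = i")
              case True
              have "Max (insert 0 (val ` insert c ?C)) = Max (insert (val c) (insert 0 (val ` ?C)))"
                by (simp add: insert_commute)
              also have "\<dots> = max (val c) (Max (insert 0 (val ` ?C)))" by (intro Max_insert) auto
              finally show ?thesis using True C T old by (simp add: max.commute)
            next
              case False
              then show ?thesis using C T old by simp
            qed
          qed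
          then show "runs (inc Cd) s2 0 (?I (Suc c))"
            using same vars T I by simp
        qed (use I c Hd in \<open>simp_all add: frame\<close>)
      qed
    next
      fix s1 assume I: "?I (4 ^ length (B p)) s1"
      have frame: "s1 x = s x" if "x \<notin> ?S'" for x using I that by (intro same_exceptD) auto
      have P: "prepared W s1" using prep'' I by blast
      have Codes: "s1 Codes p = 4 ^ length (B p)" and Wid: "s1 Wid 0 = W"
        using P p_N by (simp_all add: prepared_def)
      let ?s1 = "upd (upd s1 Base p ?a) Free 0 (?a + W)"
      have "prepared W ?s1"
        using P by (rule prepared_same[where S = "{Base, Free}"]) (simp_all add: static_vars_def)
      moreover have "tables W h F' ?s1"
        unfolding tables_def
      proof (intro conjI allI impI)
        fix j assume "j < h"
        then have "s Base j + W \<le> ?a" using tab by (simp add: tables_def)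
        then show "?s1 Base j + W \<le> ?s1 Free 0" by (simp add: frame)
      next
        fix j and f :: "nat \<Rightarrow> nat" assume j: "j < h" and f: "\<forall>u. f u \<le> 2"
        show "?s1 Tab (?s1 Base j + horner (map f (B j))) = best E (F' j) f"
        proof (cases "j = p")
          case True
          then show ?thesis using I merged_table[of f] f by simp
        next
          case False
          have "f u \<le> 3" for u using spec[OF f, of u] by simp
          moreover have "4 ^ length (B j) \<le> W" using prep j h by (simp add: prepared_def)
          ultimately have "horner (map f (B j)) < W" by (rule horner_less_W)
          moreover have "s Base j + W \<le> ?a" using tab j by (simp add: tables_def)
          ultimately have "s Base j + horner (map f (B j)) < ?a" by linarith
          then show ?thesis using False I tab j f by (simp add: frame tables_def)
        qed
      next
        fix a assume "?s1 Free 0 \<le> a"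
        \<comment> \<open>All indices are below \<open>W\<close>, so nothing was written past the
          new block.\<close>
        then obtain i where i: "a = ?a + i" "W \<le> i" by (metis add.assoc fun_upd_same le_Suc_ex le_add1 upd_simps(1))
        have "index c < W" for c using W(1) by (intro horner_less_W) (auto simp: code_union_def)
        then have none: "{c. c < 4 ^ length (B p) \<and> index c = i} = {}" using i(2) by (auto simp: not_less[symmetric])
        have "s1 Tab (?a + i) = Max (insert 0 (val ` {c. c < 4 ^ length (B p) \<and> index c = i}))"
          using I by blast
        then show "?s1 Tab a = 0" unfolding none i(1) by simp
      qed
      moreover have "?s1 Hd 0 = h" using Hd by (simp add: frame)
      ultimately have "Q ?s1" by (rule cont)
      then show "\<not> ntrue (Lt (sc Cd) (Cell Codes (sc Par))) s1 \<and>
        runs (replace_table) s1 0 Q"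
        using I Codes Wid by (simp add: frame)
    qed simp
  qed (use m Hd in simp_all)
qed

end

lemma runs_eliminate_all:
  assumes prep: "prepared W s" and Num: "s Num 0 = N"
    and clean: "\<And>j. s Base j = 0" "\<And>a. s Tab a = 0"
    and b: "\<And>j. j < N \<Longrightarrow> length (B j) \<le> b"
    and cont: "\<And>s'. s' Tab (s' Base 0) = best E {..<n} (\<lambda>_. 0) \<Longrightarrow> s' Input 0 = n \<Longrightarrow> Q s'"
    and m: "N + n * (b + 4 ^ b * (1 + 2 * b)) \<le> m"
  shows "runs eliminate_all s m Q"
proof -
  let ?c = "b + 4 ^ b * (1 + 2 * b)"
  let ?s = "upd (upd s Free 0 W) Hd 0 N"
  \<comment> \<open>A full merge is charged only at positions that are the first bag of some
    vertex.\<close>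
  let ?f = "\<lambda>k. if N - Suc k \<in> first ` {..<n} then ?c else 0"
  let ?I = "\<lambda>k s'. s' Hd 0 = N - k \<and> prepared W s' \<and> (\<exists>F. parts (N - k) F \<and> tables W (N - k) F s')"
  let ?body = "Decr Hd ;; Branch (Lt (Lit 0) (Cell New (sc Hd))) eliminate Nop"
  have Wid: "s Wid 0 = W" using prep by (simp add: prepared_def)
  have loop: "runs (Loop (Lt (Lit 1) (sc Hd)) ?body) ?s (\<Sum>k<N - 1. 1 + ?f k) Q"
  proof (rule runs_for[where I = ?I])
    have "prepared W ?s"
      using prep by (rule prepared_same[where S = "{Free, Hd}"]) (simp_all add: static_vars_def)
    moreover have "tables W N (\<lambda>_. {}) ?s" using clean by (simp add: tables_def)
    ultimately show "?I 0 ?s" using parts_start by auto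
  next
    fix k s' assume k: "k < N - 1" and I: "?I k s'"
    define h where "h = N - Suc k"
    have h: "h < N" "0 < h" "N - k = Suc h" using k by (auto simp: h_def)
    obtain F where F: "parts (Suc h) F" "tables W (Suc h) F s'" using I h(3) by auto
    let ?s' = "upd s' Hd 0 h"
    have P: "prepared W ?s'"
      by (rule prepared_same[where S = "{Hd}" and s = s']) (use I in \<open>simp_all add: static_vars_def\<close>)
    have tab: "tables W (Suc h) F ?s'" using F(2) by (simp add: tables_def)
    have "runs (Branch (Lt (Lit 0) (Cell New (sc Hd))) eliminate Nop) ?s' (?f k) (?I (Suc k))"
    proof (cases "\<exists>v<n. first v = h")
      case True
      then obtain v where v: "v < n" "first v = h" by blast
      define p where "p = target h v"
      have pN: "p < N" using target_less[OF h(1) _ v(2)] first_in[OF v(1)] v(2) h(1) p_def by auto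
      have W: "4 ^ length (B p) \<le> W" "4 ^ length (B h) \<le> W"
        using P pN h(1) by (simp_all add: prepared_def)
      have "N - Suc k \<in> first ` {..<n}" using v unfolding h_def[symmetric] by blast
      then have fk: "?f k = ?c" by simp
      have "(4::nat) ^ length (B p) \<le> 4 ^ b" using b[OF pN] by (intro power_increasing) auto
      then have cost: "length (B h) + 4 ^ length (B p) * (1 + length (B p) + length (B h)) \<le> ?f k"
        unfolding fk using b[OF pN] b[OF h(1)]
        by (intro add_mono[OF _ mult_mono[where c = "1 + length (B p) + length (B h)"]]) simp_all
      have "runs eliminate ?s' (?f k) (?I (Suc k))"
      proof (rule runs_eliminate[OF h(1) v F(1) p_def W P tab _ _ cost])
        fix s1 assume "prepared W s1" "tables W h (F(p := F p \<union> insert v (F h))) s1" "s1 Hd 0 = h"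
        then show "?I (Suc k) s1"
          using parts_step[OF h(1) v F(1)] unfolding h_def[symmetric] p_def by blast
      qed simp
      moreover have "s' New h = Suc v" using P v by (auto simp: prepared_def)
      ultimately show ?thesis by simp
    next
      case False
      then have "s' New h = 0" using P h(1) by (simp add: prepared_def)
      moreover have "parts h F" using parts_skip[OF F(1) h(2)] False by blast
      moreover have "tables W h F ?s'" using tab by (simp add: tables_def)
      ultimately show ?thesis using P by (auto simp: h_def[symmetric])
    qed
    then show "ntrue (Lt (Lit 1) (sc Hd)) s' \<and> runs ?body s' (?f k) (?I (Suc k))"
      using I h by simp
  next
    fix s' assume I: "?I (N - 1) s'"
    have N: "N - (N - 1) = 1" using N_pos by simp
    from I obtain F where F: "parts 1 F" "tables W 1 F s'" unfolding N by blast
    have "s' Tab (s' Base 0 + horner (map (\<lambda>_. 0) (B 0))) = best E (F 0) (\<lambda>_. 0)"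
      using F(2) unfolding tables_def by (elim conjE allE[of _ 0]) simp
    then have "s' Tab (s' Base 0) = best E {..<n} (\<lambda>_. 0)" using parts_stop[OF F(1)] B_0 by simp
    then show "\<not> ntrue (Lt (Lit 1) (sc Hd)) s' \<and> Q s'"
      using I N by (auto simp: prepared_def intro: cont)
  qed
  have "(\<Sum>k<N - 1. 1 + ?f k) \<le> N + n * ?c"
  proof -
    \<comment> \<open>These positions inject into the image of \<open>first\<close>, so there are at
      most \<open>n\<close> of them however large \<open>N\<close> is.\<close>
    let ?K = "{k \<in> {..<N - 1}. N - Suc k \<in> first ` {..<n}}"
    have "card ?K \<le> card (first ` {..<n})"
      by (rule card_inj_on_le[where f = "\<lambda>k. N - Suc k"]) (auto simp: inj_on_def)
    also have "\<dots> \<le> n" using card_image_le[of "{..<n}" first] by simp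
    finally have "card ?K * ?c \<le> n * ?c" by (rule mult_right_mono) simp
    moreover have "(\<Sum>k<N - 1. ?f k) = card ?K * ?c"
      by (simp only: sum.inter_filter[OF finite_lessThan, symmetric] sum_constant of_nat_id)
    moreover have "(\<Sum>k<N - 1. 1 + ?f k) = (N - 1) + (\<Sum>k<N - 1. ?f k)"
      by (simp only: sum.distrib) simp
    ultimately show ?thesis by linarith
  qed
  then have "runs (Loop (Lt (Lit 1) (sc Hd)) ?body) ?s m Q"
    using runs_mono[OF loop] m by (meson le_trans)
  then show ?thesis by (simp add: eliminate_all_def Wid Num)
qed

end

section \<open>Reading the instance\<close>

abbreviation make_row :: "var ncom" where
  "make_row \<equiv>
    Store Row (Plus (sc Ix) (Lit 1)) (Plus (Cell Row (sc Ix)) (Cell Input (Lit 0))) ;; inc Ix"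

definition make_rows :: "var ncom" where
  "make_rows =
    (Ix ::= Lit 0 ;;
     Loop (Lt (sc Ix) (Cell Input (Lit 0)))
       (make_row))"

definition read_edges :: "var ncom" where
  "read_edges =
    (Ptr ::= Lit 3 ;; Ix ::= Lit 0 ;;
     Loop (Lt (sc Ix) (Cell Input (Lit 2)))
       (Store Adj (Plus (Cell Row (Cell Input (sc Ptr))) (Cell Input (Plus (sc Ptr) (Lit 1)))) (Lit 1) ;;
        Store Adj (Plus (Cell Row (Cell Input (Plus (sc Ptr) (Lit 1)))) (Cell Input (sc Ptr))) (Lit 1) ;;
        Ptr ::= Plus (sc Ptr) (Lit 2) ;; inc Ix))"

definition skip_list :: "var ncom" where
  "skip_list = (Ptr ::= Plus (sc Ptr) (Plus (Lit 1) (Cell Input (sc Ptr))))"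

abbreviation locate_node :: "var ncom" where
  "locate_node \<equiv>
    Store Off (sc Ix) (sc Ptr) ;; skip_list ;; skip_list ;; inc Ix"

definition locate_nodes :: "var ncom" where
  "locate_nodes =
    (Num ::= Cell Input (sc Ptr) ;; Store Queue (Lit 0) (Cell Input (Plus (sc Ptr) (Lit 1))) ;;
     Ptr ::= Plus (sc Ptr) (Lit 2) ;; Ix ::= Lit 0 ;;
     Loop (Lt (sc Ix) (sc Num))
       (locate_node))"

definition enqueue :: "var ncom" where
  "enqueue = (Store Queue (sc Tl) (sc Ver) ;; inc Tl)"

text \<open>In \<open>Seen\<close>, 0 means unseen, which is safe because the root bag is empty and
  so \<open>first\<close> is positive. Pushing the digit 0 multiplies \<open>Rs\<close> by 4 and
  thus builds the number of codes of the bag.\<close>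

definition mark :: "var ncom" where
  "mark =
    (Branch (Lt (Cell Seen (sc Ver)) (Lit 1))
       (Store Seen (sc Ver) (sc Hd) ;; Store New (sc Hd) (Plus (sc Ver) (Lit 1))) Nop ;;
     push Rs (Lit 0))"

abbreviation store_size :: "var ncom" where
  "store_size \<equiv>
    Store Codes (sc Hd) (sc Rs) ;; Branch (Lt (sc Wid) (sc Rs)) (Wid ::= sc Rs) Nop ;; inc Hd"

definition visit :: "var ncom" where
  "visit =
    (Ptr ::= Cell Off (Cell Queue (sc Hd)) ;; for_bag enqueue ;; skip_list ;;
     Store Bag (sc Hd) (sc Ptr) ;; Rs ::= Lit 1 ;; for_bag mark ;;
     store_size)"

definition traverse :: "var ncom" where
  "traverse =
    (Hd ::= Lit 0 ;; Tl ::= Lit 1 ;; Wid ::= Lit 1 ;; Loop (Lt (sc Hd) (sc Num)) visit)"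

abbreviation fill_entry :: "var ncom" where
  "fill_entry \<equiv>
    Store Quot (sc Ix) (sc Rs) ;; Store Rem (sc Ix) (sc Dg) ;; Branch (Lt (sc Dg) (Lit 3)) (inc Dg) (Dg ::= Lit 0 ;; inc Rs) ;; inc Ix"

definition fill_tables :: "var ncom" where
  "fill_tables =
    (Ix ::= Lit 0 ;; Dg ::= Lit 0 ;; Rs ::= Lit 0 ;;
     Loop (Lt (sc Ix) (sc Wid))
       (fill_entry))"

definition solve :: "var ncom" where
  "solve = (make_rows ;; read_edges ;; locate_nodes ;; traverse ;; fill_tables ;; eliminate_all)"

section \<open>Preprocessing loops that do not involve the tree\<close>

lemma runs_fill_tables:
  assumes cont: "\<And>s'. same_except {Quot, Rem, Ix, Dg, Rs} s s' \<Longrightarrow>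
      (\<And>c. c < s Wid 0 \<Longrightarrow> s' Quot c = c div 4 \<and> s' Rem c = c mod 4) \<Longrightarrow> runs d s' m Q"
    and "s Wid 0 + m \<le> m'"
  shows "runs (fill_tables ;; d) s m' Q"
proof -
  let ?S = "{Quot, Rem, Ix, Dg, Rs}"
  let ?s = "upd (upd (upd s Ix 0 0) Dg 0 0) Rs 0 0"
  let ?I = "\<lambda>k s'. same_except ?S s s' \<and> s' Ix 0 = k \<and> s' Dg 0 = k mod 4 \<and> s' Rs 0 = k div 4 \<and>
    (\<forall>c<k. s' Quot c = c div 4 \<and> s' Rem c = c mod 4)"
  have "runs (Loop (Lt (sc Ix) (sc Wid))
       (fill_entry) ;; d) ?s m' Q"
  proof (rule runs_for_Then[where I = ?I and M = "s Wid 0" and f = "\<lambda>_. 0" and m = m])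
    fix k s' assume k: "k < s Wid 0" and I: "?I k s'"
    have W: "s' Wid = s Wid" using I by (auto intro: same_exceptD)
    have s: "k mod 4 < 3 \<Longrightarrow> Suc k mod 4 = Suc (k mod 4) \<and> Suc k div 4 = k div 4"
      "\<not> k mod 4 < 3 \<Longrightarrow> Suc k mod 4 = 0 \<and> Suc k div 4 = Suc (k div 4)"
      by presburger+
    show "ntrue (Lt (sc Ix) (sc Wid)) s' \<and>
      runs (fill_entry) s' 0 (?I (Suc k))"
    proof (cases "k mod 4 < 3")
      case True
      with I k s(1) show ?thesis by (simp add: W less_Suc_eq)
    next
      case False
      with I k s(2) show ?thesis by (simp add: W less_Suc_eq)
    qed
  next
    fix s' assume I: "?I (s Wid 0) s'"
    then have "s' Wid = s Wid" by (auto intro: same_exceptD)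
    with I show "\<not> ntrue (Lt (sc Ix) (sc Wid)) s' \<and> runs d s' m Q" by (auto intro: cont)
  qed (use assms(2) in simp_all)
  then show ?thesis by (simp add: fill_tables_def)
qed

lemma runs_make_rows:
  assumes n: "s Input 0 = n" and R: "\<And>i. s Row i = 0"
    and cont: "\<And>s'. same_except {Row, Ix} s s' \<Longrightarrow> (\<And>i. i \<le> n \<Longrightarrow> s' Row i = i * n) \<Longrightarrow> runs d s' m Q"
    and "n + m \<le> m'"
  shows "runs (make_rows ;; d) s m' Q"
proof -
  let ?S = "{Row, Ix}"
  let ?I = "\<lambda>k s'. same_except ?S s s' \<and> s' Ix 0 = k \<and> (\<forall>i\<le>k. s' Row i = i * n)"
  have "runs (Loop (Lt (sc Ix) (Cell Input (Lit 0)))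
       (make_row) ;; d)
      (upd s Ix 0 0) m' Q"
  proof (rule runs_for_Then[where I = ?I and M = n and f = "\<lambda>_. 0" and m = m])
    fix k s' assume k: "k < n" and I: "?I k s'"
    have W: "s' Input = s Input" using I by (auto intro: same_exceptD)
    show "ntrue (Lt (sc Ix) (Cell Input (Lit 0))) s' \<and>
      runs (make_row) s' 0 (?I (Suc k))"
      using I k by (simp add: W n le_Suc_eq)
  next
    fix s' assume I: "?I n s'"
    then have "s' Input = s Input" by (auto intro: same_exceptD)
    with I n show "\<not> ntrue (Lt (sc Ix) (Cell Input (Lit 0))) s' \<and> runs d s' m Q" by (auto intro: cont)
  qed (use assms in simp_all)
  then show ?thesis by (simp add: make_rows_def)
qed

lemma row_index_inject:
  fixes n :: nat
  assumes "v < n" "v' < n"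
  shows "u * n + v = u' * n + v' \<longleftrightarrow> u = u' \<and> v = v'"
proof
  assume eq: "u * n + v = u' * n + v'"
  have "u = (u * n + v) div n" "u' = (u' * n + v') div n" using assms by simp_all
  then have "u = u'" using eq by simp
  with eq show "u = u' \<and> v = v'" by simp
qed simp

lemma runs_read_edges:
  assumes len: "s Input 2 = length es" and R: "\<And>i. i < n \<Longrightarrow> s Row i = i * n" and A: "\<And>i. s Adj i = 0"
    and es: "\<And>i. i < length es \<Longrightarrow> s Input (3 + 2 * i) = fst (es ! i) \<and> s Input (4 + 2 * i) = snd (es ! i) \<and>
      fst (es ! i) < n \<and> snd (es ! i) < n"
    and cont: "\<And>s'. same_except {Adj, Ptr, Ix} s s' \<Longrightarrow> s' Ptr 0 = 3 + 2 * length es \<Longrightarrow>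
      (\<And>u v. u < n \<Longrightarrow> v < n \<Longrightarrow> 0 < s' Adj (u * n + v) \<longleftrightarrow> (u, v) \<in> set es \<or> (v, u) \<in> set es) \<Longrightarrow>
      runs d s' m Q"
    and "length es + m \<le> m'"
  shows "runs (read_edges ;; d) s m' Q"
proof -
  let ?S = "{Adj, Ptr, Ix}"
  let ?s = "upd (upd s Ptr 0 3) Ix 0 0"
  let ?I = "\<lambda>k s'. same_except ?S s s' \<and> s' Ix 0 = k \<and> s' Ptr 0 = 3 + 2 * k \<and>
    (\<forall>u<n. \<forall>v<n. 0 < s' Adj (u * n + v) \<longleftrightarrow> (u, v) \<in> set (take k es) \<or> (v, u) \<in> set (take k es))"
  let ?body = "Store Adj (Plus (Cell Row (Cell Input (sc Ptr))) (Cell Input (Plus (sc Ptr) (Lit 1)))) (Lit 1) ;;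
        Store Adj (Plus (Cell Row (Cell Input (Plus (sc Ptr) (Lit 1)))) (Cell Input (sc Ptr))) (Lit 1) ;;
        Ptr ::= Plus (sc Ptr) (Lit 2) ;; inc Ix"
  have "runs (Loop (Lt (sc Ix) (Cell Input (Lit 2))) ?body ;; d) ?s m' Q"
  proof (rule runs_for_Then[where I = ?I and M = "length es" and f = "\<lambda>_. 0" and m = m])
    fix k s' assume k: "k < length es" and I: "?I k s'"
    have W: "s' Input = s Input" "s' Row = s Row" using I by (auto intro: same_exceptD)
    obtain a b where ab: "es ! k = (a, b)" by (cases "es ! k")
    have e: "s Input (3 + 2 * k) = a" "s Input (4 + 2 * k) = b" "a < n" "b < n"
      using es[OF k] ab by simp_all
    define A where "A = (s' Adj)(a * n + b := 1, b * n + a := (1::nat))"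
    have A: "0 < A (u * n + v) \<longleftrightarrow> (u, v) \<in> set (take (Suc k) es) \<or> (v, u) \<in> set (take (Suc k) es)"
      if "u < n" "v < n" for u v
      using I that e(3,4) ab k
      by (auto simp: A_def row_index_inject take_Suc_conv_app_nth)
    have "4 + 2 * k = Suc (3 + 2 * k)" by simp
    then have e': "s Input (Suc (3 + 2 * k)) = b" using e(2) by metis
    have "runs ?body s' 0 (?I (Suc k)) \<longleftrightarrow>
      ?I (Suc k) (upd (upd (upd (upd s' Adj (a * n + b) 1) Adj (b * n + a) 1) Ptr 0 (3 + 2 * Suc k)) Ix 0 (Suc k))"
      using I e(1,3,4) e' by (simp add: W R)
    also have "\<dots>" using I A by (simp add: A_def)
    finally show "ntrue (Lt (sc Ix) (Cell Input (Lit 2))) s' \<and> runs ?body s' 0 (?I (Suc k))"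
      using I k by (simp add: W len)
  next
    fix s' assume I: "?I (length es) s'"
    then have "s' Input = s Input" by (auto intro: same_exceptD)
    with I len show "\<not> ntrue (Lt (sc Ix) (Cell Input (Lit 2))) s' \<and> runs d s' m Q" by (auto intro: cont)
  qed (use assms in simp_all)
  then show ?thesis by (simp add: read_edges_def)
qed

lemma concat_map_upt_split:
  assumes "t < N"
  shows "concat (map f [0..<N]) = concat (map f [0..<t]) @ f t @ concat (map f [Suc t..<N])"
proof -
  have "[0..<N] = [0..<t] @ t # [Suc t..<N]"
    using assms by (metis le0 less_imp_le_nat upt_add_eq_append upt_conv_Cons le_add_diff_inverse)
  then show ?thesis by simp
qed

lemma length_concat_upt: "length (concat (map f [0..<t])) = (\<Sum>i<t. length (f i))"
  by (induction t) simp_all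

section \<open>The layout of the input and the traversal of the tree\<close>

locale encoded = nice_decomposition T r N cs G X n
  for T :: "nat graph" and r N :: nat and cs :: "nat \<Rightarrow> nat list" and G :: "nat graph"
    and X :: "nat \<Rightarrow> nat set" and n :: nat +
  fixes es :: "(nat \<times> nat) list" and bs :: "nat \<Rightarrow> nat list" and b :: nat
  assumes es: "(\<lambda>(u, v). {u, v}) ` set es = edges G"
    and bs: "\<And>t. t < N \<Longrightarrow> distinct (bs t) \<and> set (bs t) = X t"
    and b: "\<And>t. t < N \<Longrightarrow> card (X t) \<le> b"
begin

definition node :: "nat \<Rightarrow> nat list" where
  "node t = length (cs t) # cs t @ length (bs t) # bs t"

text \<open>Position 1 holds 0 instead of the parameter, which may be negative and is kept outside
  the arrays of naturals.\<close>

definition input :: "nat list" where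
  "input = [n, 0, length es] @ concat (map (\<lambda>(u, v). [u, v]) es) @ [N, r] @ concat (map node [0..<N])"

definition start :: "var store" where
  "start x i = (if x = Input \<and> i < length input then input ! i else 0)"

definition off :: "nat \<Rightarrow> nat" where
  "off t = 5 + 2 * length es + (\<Sum>i<t. length (node i))"

definition bag :: "nat \<Rightarrow> nat list" where
  "bag i = bs (bfs ! i)"

definition adjacent :: "nat \<Rightarrow> nat \<Rightarrow> bool" where
  "adjacent u v \<longleftrightarrow> {u, v} \<in> edges G"

lemma start_split:
  assumes "input = as @ xs @ ys" "j < length xs"
  shows "start Input (length as + j) = xs ! j"
  using assms by (simp add: start_def nth_append)

lemma edges_length: "length (concat (map (\<lambda>(u, v). [u, v]) l)) = 2 * length l"
  by (induction l) auto

lemma start_head: "start Input 0 = n" "start Input 2 = length es"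
  using start_split[of "[]" "[n, 0, length es]" _ 0] start_split[of "[]" "[n, 0, length es]" _ 2]
  by (simp_all add: input_def numeral_2_eq_2)

lemma start_edges:
  assumes "i < length es"
  shows "start Input (3 + 2 * i) = fst (es ! i)" "start Input (4 + 2 * i) = snd (es ! i)"
proof -
  let ?f = "\<lambda>(u, v). [u, v :: nat]"
  have "es = take i es @ es ! i # drop (Suc i) es" using assms by (rule id_take_nth_drop)
  then have "concat (map ?f es) = concat (map ?f (take i es)) @ [fst (es ! i), snd (es ! i)] @
      concat (map ?f (drop (Suc i) es))"
    by (metis (no_types, lifting) concat.simps(2) concat_append list.simps(9) map_append case_prod_beta')
  then have split: "input = ([n, 0, length es] @ concat (map ?f (take i es))) @ [fst (es ! i), snd (es ! i)] @
      (concat (map ?f (drop (Suc i) es)) @ [N, r] @ concat (map node [0..<N]))"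
    by (simp add: input_def)
  have len: "length ([n, 0, length es] @ concat (map ?f (take i es))) = 3 + 2 * i"
    using edges_length[of "take i es"] assms by simp
  show "start Input (3 + 2 * i) = fst (es ! i)" "start Input (4 + 2 * i) = snd (es ! i)"
    using start_split[OF split, of 0] start_split[OF split, of 1] unfolding len by simp_all
qed

lemma start_tree:
  "start Input (3 + 2 * length es) = N" "start Input (4 + 2 * length es) = r"
proof -
  let ?f = "\<lambda>(u, v). [u, v :: nat]"
  have split: "input = ([n, 0, length es] @ concat (map ?f es)) @ [N, r] @ concat (map node [0..<N])"
    by (simp add: input_def)
  have len: "length ([n, 0, length es] @ concat (map ?f es)) = 3 + 2 * length es"
    using edges_length[of es] by simp
  show "start Input (3 + 2 * length es) = N" "start Input (4 + 2 * length es) = r"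
    using start_split[OF split, of 0] start_split[OF split, of 1] unfolding len by simp_all
qed

lemma start_node:
  assumes "t < N" "j < length (node t)"
  shows "start Input (off t + j) = node t ! j"
proof -
  let ?f = "\<lambda>(u, v). [u, v :: nat]"
  have split: "input = ([n, 0, length es] @ concat (map ?f es) @ [N, r] @ concat (map node [0..<t])) @ node t @
      concat (map node [Suc t..<N])"
    by (simp add: input_def concat_map_upt_split[OF assms(1)])
  have len: "length ([n, 0, length es] @ concat (map ?f es) @ [N, r] @ concat (map node [0..<t])) = off t"
    unfolding off_def length_append edges_length length_concat_upt by simp
  show ?thesis using start_split[OF split assms(2)] unfolding len .
qed

lemma start_lists:
  assumes "t < N" "s Input = start Input"
  shows "bag_at s (off t) (cs t)" "bag_at s (off t + Suc (length (cs t))) (bs t)"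
proof -
  note s = start_node[OF assms(1)]
  have "start Input (off t) = length (cs t)" using s[of 0] by (simp add: node_def)
  moreover have "start Input (off t + Suc j) = cs t ! j" if "j < length (cs t)" for j
    using s[of "Suc j"] that by (simp add: node_def nth_append)
  ultimately show "bag_at s (off t) (cs t)" using assms(2) by (simp add: bag_at_def)
  have "start Input (off t + Suc (length (cs t))) = length (bs t)"
    using s[of "Suc (length (cs t))"] by (simp add: node_def nth_append)
  moreover have "start Input (off t + Suc (length (cs t)) + Suc j) = bs t ! j" if "j < length (bs t)" for j
    using s[of "Suc (length (cs t)) + Suc j"] that by (simp add: node_def nth_append add.assoc)
  ultimately show "bag_at s (off t + Suc (length (cs t))) (bs t)" using assms(2) by (simp add: bag_at_def)
qed

lemma edge_ends: "adjacent u v \<Longrightarrow> u < n \<and> v < n \<and> u \<noteq> v"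
  using simple verts_G unfolding adjacent_def simple_graph_def by (fastforce simp: doubleton_eq_iff)

lemma adjacent_iff: "adjacent u v \<longleftrightarrow> (u, v) \<in> set es \<or> (v, u) \<in> set es"
  unfolding adjacent_def es[symmetric] by (auto simp: image_iff doubleton_eq_iff)

lemma length_bag: "i < N \<Longrightarrow> length (bag i) \<le> b"
  using bs[OF bfs_less] b[OF bfs_less] distinct_card by (metis bag_def)

sublocale elimination n N adjacent bag first
proof
  have bag: "distinct (bag i)" "set (bag i) = X (bfs ! i)" if "i < N" for i
    using bs[OF bfs_less[OF that]] by (simp_all add: bag_def)
  have N: "0 < N" using root verts_T by auto
  show "symp adjacent" by (auto simp: adjacent_def symp_def insert_commute)
  show "\<not> adjacent v v" for v using edge_ends by blast
  show "adjacent u v \<Longrightarrow> u < n" for u v using edge_ends by blast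
  show "0 < N" by (rule N)
  show "bag 0 = []" using bag(2)[OF N] bag_root bfs_0 by simp
  show "set (bag i) \<subseteq> {..<n}" if "i < N" for i using bag(2)[OF that] bag_subset bfs_less that by simp
  show "distinct (bag i)" if "i < N" for i using bag that by blast
  show "0 < first v" if "v < n" for v using first_pos that .
  show "first v < N" if "v < n" for v using first that by blast
  show "v \<in> set (bag (first v))" if "v < n" for v using first[OF that] bag(2) by blast
  show "first v \<le> i" if "i < N" "v \<in> set (bag i)" for i v using first_le that bag(2) by blast
  show "u = v" if "u < n" "v < n" "first u = first v" for u v using first_inj that by blast
  show "u \<in> set (bag (first v))"
    if "i < N" "u \<in> set (bag i)" "v \<in> set (bag i)" "first u \<le> first v" for i u v
  proof -
    have "v < n" using bag(2)[OF that(1)] bag_subset bfs_less that by blast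
    then have "first v < N" using first by blast
    then show ?thesis using first_bag[of i u v] that bag(2) by blast
  qed
  show "\<exists>i<N. u \<in> set (bag i) \<and> v \<in> set (bag i)" if "adjacent u v" for u v
    using edge_bag[of u v] that bag(2) by (auto simp: adjacent_def)
qed

end

context encoded
begin

lemma off_Suc: "off (Suc t) = off t + Suc (length (cs t)) + Suc (length (bs t))"
  by (simp add: off_def node_def)

lemma runs_locate_nodes:
  assumes inp: "s Input = start Input" and Ptr: "s Ptr 0 = 3 + 2 * length es"
    and cont: "\<And>s'. same_except {Num, Queue, Ptr, Ix, Off} s s' \<Longrightarrow> s' Num 0 = N \<Longrightarrow> s' Queue 0 = r \<Longrightarrow>
      (\<And>t. t < N \<Longrightarrow> s' Off t = off t) \<Longrightarrow> runs d s' m Q"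
    and "N + m \<le> m'"
  shows "runs (locate_nodes ;; d) s m' Q"
proof -
  let ?S = "{Num, Queue, Ptr, Ix, Off}"
  let ?s = "upd (upd (upd (upd s Num 0 N) Queue 0 r) Ptr 0 (off 0)) Ix 0 0"
  let ?I = "\<lambda>k s'. same_except ?S s s' \<and> s' Num 0 = N \<and> s' Queue 0 = r \<and> s' Ix 0 = k \<and> s' Ptr 0 = off k \<and>
    (\<forall>t<k. s' Off t = off t)"
  have "runs (Loop (Lt (sc Ix) (sc Num)) (locate_node) ;; d)
    ?s m' Q"
  proof (rule runs_for_Then[where I = ?I and M = N and f = "\<lambda>_. 0" and m = m])
    fix k s' assume k: "k < N" and I: "?I k s'"
    have W: "s' Input = start Input" using I inp by (auto dest: same_exceptD)
    have "start Input (off k) = length (cs k)" "start Input (off k + Suc (length (cs k))) = length (bs k)"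
      using start_lists[OF k, of s', OF W] by (simp_all add: bag_at_def W)
    then show "ntrue (Lt (sc Ix) (sc Num)) s' \<and>
      runs (locate_node) s' 0 (?I (Suc k))"
      using I k by (simp add: W skip_list_def off_Suc less_Suc_eq)
  next
    fix s' assume "?I N s'"
    then show "\<not> ntrue (Lt (sc Ix) (sc Num)) s' \<and> runs d s' m Q" by (auto intro: cont)
  qed (use assms in simp_all)
  moreover have "start Input (Suc (3 + 2 * length es)) = r" using start_tree(2) by simp
  then have "start Input (Suc (Suc (Suc (Suc (2 * length es))))) = r" by (simp add: numeral_3_eq_3)
  moreover have "off 0 = 5 + 2 * length es" by (simp add: off_def)
  ultimately show ?thesis using start_tree by (simp add: locate_nodes_def inp Ptr)
qed

definition marked :: "nat set \<Rightarrow> var store \<Rightarrow> bool" where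
  "marked A s \<longleftrightarrow> (\<forall>u<n. s Seen u = (if u \<in> A then first u else 0)) \<and>
     (\<forall>v\<in>A. s New (first v) = Suc v) \<and> (\<forall>i. i \<notin> first ` A \<longrightarrow> s New i = 0)"

text \<open>Since \<open>first\<close> is injective, the entry of \<open>New\<close> for
  \<open>u\<close> overwrites no earlier one.\<close>

lemma marked_insert:
  assumes "marked A s" "A \<subseteq> {..<n}" "u < n" "u \<notin> A"
  shows "marked (insert u A) (upd (upd s Seen u (first u)) New (first u) (Suc u))"
proof -
  have "first v \<noteq> first u" if "v \<in> A" for v
    using first_inj[of v u] that assms(2-4) by auto
  then show ?thesis using assms(1) by (auto simp: marked_def)
qed

definition seen_before :: "nat \<Rightarrow> nat set" where
  "seen_before h = {v. v < n \<and> first v < h}"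

lemma first_less_bag: "h < N \<Longrightarrow> u \<in> set (bag h) \<Longrightarrow> u < n \<and> first u \<le> h"
  using B_less first_le by blast

lemma seen_before_Suc: "h < N \<Longrightarrow> seen_before (Suc h) = seen_before h \<union> set (bag h)"
  using first_less_bag first_in by (fastforce simp: seen_before_def less_Suc_eq)

definition visited :: "nat \<Rightarrow> var store \<Rightarrow> bool" where
  "visited h s \<longleftrightarrow> s Hd 0 = h \<and> s Num 0 = N \<and> s Tl 0 = length (bfs_upto h) \<and>
     (\<forall>i<length (bfs_upto h). s Queue i = bfs_upto h ! i) \<and> (\<forall>t<N. s Off t = off t) \<and>
     (\<forall>j<h. bag_at s (s Bag j) (bag j) \<and> s Codes j = 4 ^ length (bag j) \<and> 4 ^ length (bag j) \<le> s Wid 0) \<and>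
     s Wid 0 \<le> 4 ^ b \<and> marked (seen_before h) s"

lemma runs_enqueue_children:
  assumes bag: "bag_at s (s Ptr 0) ts" and Tl: "s Tl 0 = length q"
    and Q: "\<And>i. i < length q \<Longrightarrow> s Queue i = q ! i"
    and cont: "\<And>s'. same_except {Queue, Tl, Jx, Ver} s s' \<Longrightarrow> s' Tl 0 = length (q @ ts) \<Longrightarrow>
      (\<And>i. i < length (q @ ts) \<Longrightarrow> s' Queue i = (q @ ts) ! i) \<Longrightarrow> runs d s' m R"
    and "length ts + m \<le> m'"
  shows "runs (for_bag enqueue ;; d) s m' R"
proof -
  let ?I = "\<lambda>j s'. same_except {Queue, Tl, Jx, Ver} s s' \<and> s' Tl 0 = length q + j \<and>
    (\<forall>i<length q + j. s' Queue i = (q @ ts) ! i)"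
  show ?thesis
  proof (rule runs_for_bag[where bs = ts and m = m and I = ?I, OF bag])
    fix j s' assume "j < length ts" "?I j s'" "s' Jx 0 = j" "s' Ptr 0 = s Ptr 0" "s' Input = s Input"
    then show "runs (enqueue ;; inc Jx) (upd s' Ver 0 (ts ! j)) 0
      (\<lambda>s''. s'' Jx 0 = Suc j \<and> s'' Ptr 0 = s Ptr 0 \<and> s'' Input = s Input \<and> ?I (Suc j) s'')"
      by (simp add: enqueue_def less_Suc_eq nth_append)
  next
    fix s' assume "?I (length ts) s'"
    then show "runs d s' m R" by (intro cont) simp_all
  qed (use assms in \<open>simp_all add: nth_append\<close>)
qed

lemma runs_mark_bag:
  assumes h: "h < N" "s Hd 0 = h" and bag: "bag_at s (s Ptr 0) (bag h)"
    and mk: "marked (seen_before h) s" and Rs: "s Rs 0 = 1"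
    and cont: "\<And>s'. same_except {Seen, New, Rs, Jx, Ver} s s' \<Longrightarrow> s' Rs 0 = 4 ^ length (bag h) \<Longrightarrow>
      marked (seen_before (Suc h)) s' \<Longrightarrow> runs d s' m Q"
    and "length (bag h) + m \<le> m'"
  shows "runs (for_bag mark ;; d) s m' Q"
proof -
  let ?S = "{Seen, New, Rs, Jx, Ver}"
  let ?A = "\<lambda>j. seen_before h \<union> set (take j (bag h))"
  let ?I = "\<lambda>j s'. same_except ?S s s' \<and> s' Rs 0 = 4 ^ j \<and> marked (?A j) s'"
  show ?thesis
  proof (rule runs_for_bag[where bs = "bag h" and m = m and I = ?I, OF bag])
    fix j s' assume j: "j < length (bag h)" and I: "?I j s'"
      and J: "s' Jx 0 = j" "s' Ptr 0 = s Ptr 0" "s' Input = s Input"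
    let ?u = "bag h ! j"
    have u: "?u < n" "first ?u \<le> h" using first_less_bag[OF h(1)] j nth_mem by blast+
    have Hd: "s' Hd = s Hd" using I by (auto intro: same_exceptD)
    have A: "?A (Suc j) = insert ?u (?A j)" using j by (simp add: take_Suc_conv_app_nth)
    have sub: "?A j \<subseteq> {..<n}"
      using first_less_bag[OF h(1)] by (auto simp: seen_before_def dest: in_set_takeD)
    have seen: "s' Seen ?u = (if ?u \<in> ?A j then first ?u else 0)"
      using I u(1) unfolding marked_def by blast
    show "runs (mark ;; inc Jx) (upd s' Ver 0 ?u) 0
      (\<lambda>s''. s'' Jx 0 = Suc j \<and> s'' Ptr 0 = s Ptr 0 \<and> s'' Input = s Input \<and> ?I (Suc j) s'')"
    proof (cases "?u \<in> ?A j")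
      case True
      then have pos: "0 < s' Seen ?u" using seen first_pos[OF u(1)] by simp
      have "?A (Suc j) = ?A j" using True A by auto
      then have "marked (?A (Suc j)) s'" using I by simp
      then show ?thesis using I J pos by (simp add: mark_def marked_def)
    next
      case False
      then have zero: "s' Seen ?u = 0" using seen by simp
      have "first ?u = h" using False u by (auto simp: seen_before_def)
      moreover have "marked (insert ?u (?A j)) (upd (upd s' Seen ?u (first ?u)) New (first ?u) (Suc ?u))"
        using I sub u(1) False by (intro marked_insert) auto
      ultimately have "marked (?A (Suc j)) (upd (upd s' Seen ?u h) New h (Suc ?u))" using A by simp
      then show ?thesis using I J zero by (simp add: mark_def marked_def Hd h(2))
    qed
  next
    fix s' assume "?I (length (bag h)) s'"
    then show "runs d s' m Q" by (intro cont) (simp_all add: seen_before_Suc[OF h(1)])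
  qed (use assms in \<open>simp_all add: marked_def\<close>)
qed

lemma runs_visit:
  assumes h: "h < N" and inp: "s Input = start Input" and vis: "visited h s"
    and cont: "\<And>s'. same_except {Ptr, Queue, Tl, Jx, Ver, Bag, Rs, Seen, New, Codes, Wid, Hd} s s' \<Longrightarrow>
      visited (Suc h) s' \<Longrightarrow> Q s'"
    and m: "length (cs (bfs ! h)) + length (bag h) \<le> m"
  shows "runs visit s m Q"
proof -
  define t where "t = bfs ! h"
  have t: "t < N" using bfs_less h t_def by simp
  have q: "h < length (bfs_upto h)" "bfs_upto h ! h = t"
    using length_bfs_upto[of h] bfs_upto_nth[of h h] h t_def by auto
  have hd: "s Hd 0 = h" "s Queue h = t" "s Off t = off t" "s Tl 0 = length (bfs_upto h)"
    using vis q t by (simp_all add: visited_def)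
  have bag: "bag h = bs t" by (simp add: bag_def t_def)
  let ?s = "upd s Ptr 0 (off t)"
  have "runs (for_bag enqueue ;; skip_list ;;
     Store Bag (sc Hd) (sc Ptr) ;; Rs ::= Lit 1 ;; for_bag mark ;;
     store_size) ?s m Q"
  proof (rule runs_enqueue_children[where ts = "cs t" and q = "bfs_upto h" and m = "length (bag h)"])
    show "bag_at ?s (?s Ptr 0) (cs t)" using start_lists(1)[OF t, of ?s] inp by simp
    show "?s Tl 0 = length (bfs_upto h)" using hd by simp
    show "?s Queue i = bfs_upto h ! i" if "i < length (bfs_upto h)" for i
      using vis that by (simp add: visited_def)
    show "length (cs t) + length (bag h) \<le> m" using m by (simp add: t_def)
  next
    fix s' assume s': "same_except {Queue, Tl, Jx, Ver} ?s s'" "s' Tl 0 = length (bfs_upto h @ cs t)"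
      "\<And>i. i < length (bfs_upto h @ cs t) \<Longrightarrow> s' Queue i = (bfs_upto h @ cs t) ! i"
    note f1 = same_exceptD[OF s'(1)]
    let ?p = "off t + Suc (length (cs t))"
    let ?s' = "upd (upd (upd s' Ptr 0 ?p) Bag h ?p) Rs 0 1"
    have inp1: "?s' Input = start Input" using inp by (simp add: f1)
    have len: "s' Input (off t) = length (cs t)"
      using start_lists(1)[OF t, of s'] inp1 by (simp add: bag_at_def)
    have "runs (for_bag mark ;; store_size) ?s' (length (bag h)) Q"
    proof (rule runs_mark_bag[OF h, where m = 0])
      show "?s' Hd 0 = h" using hd by (simp add: f1)
      show "bag_at ?s' (?s' Ptr 0) (bag h)" using start_lists(2)[OF t, of ?s', OF inp1] bag by simp
      show "marked (seen_before h) ?s'" using vis by (simp add: visited_def marked_def f1)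
    next
      fix s1 assume s1: "same_except {Seen, New, Rs, Jx, Ver} ?s' s1" "s1 Rs 0 = 4 ^ length (bag h)"
        "marked (seen_before (Suc h)) s1"
      note f2 = same_exceptD[OF s1(1)]
      let ?w = "max (s Wid 0) (4 ^ length (bag h))"
      let ?s1 = "\<lambda>w. upd w Hd 0 (Suc h)"
      let ?P = "upd s1 Codes h (4 ^ length (bag h))"
      \<comment> \<open>Covers both outcomes of the comparison that updates
        \<open>Wid\<close>.\<close>
      have fin: "Q (upd s2 Hd 0 (Suc h))" if s2: "same_except {Wid} ?P s2" "s2 Wid 0 = ?w" for s2
      proof (rule cont)
        have f3: "s2 x = ?P x" if "x \<noteq> Wid" for x using s2(1) that by (intro same_exceptD) auto
        let ?S = "{Ptr, Queue, Tl, Jx, Ver, Bag, Rs, Seen, New, Codes, Wid, Hd}"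
        have "same_except ?S s s'" using s'(1) by (auto simp: same_except_def upd_def)
        then have "same_except ?S s s1" using s1(1) by (auto simp: same_except_def upd_def)
        then have "same_except ?S s s2" using s2(1) by (auto simp: same_except_def upd_def)
        then show "same_except ?S s (upd s2 Hd 0 (Suc h))" by simp
        have inp3: "s2 Input = start Input" using inp by (simp add: f1 f2 f3)
        have bfs: "bfs_upto (Suc h) = bfs_upto h @ cs t" using q by simp
        have Bag: "s2 Bag = (s Bag)(h := ?p)" "s2 Codes = (s Codes)(h := 4 ^ length (bag h))"
          by (simp_all add: f1 f2 f3 fun_eq_iff)
        have "bag_at s2 (s2 Bag j) (bag j) \<and> s2 Codes j = 4 ^ length (bag j) \<and> 4 ^ length (bag j) \<le> s2 Wid 0"
          if "j < Suc h" for j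
        proof (cases "j = h")
          case True
          then show ?thesis using start_lists(2)[OF t, of s2, OF inp3] bag s2(2) by (simp add: Bag)
        next
          case False
          then have "j < h" using that by simp
          then have "bag_at s (s Bag j) (bag j) \<and> s Codes j = 4 ^ length (bag j) \<and> 4 ^ length (bag j) \<le> s Wid 0"
            using vis by (simp add: visited_def)
          then show ?thesis using False s2(2) inp inp3 by (simp add: Bag bag_at_def le_max_iff_disj)
        qed
        moreover have "?w \<le> 4 ^ b"
          using vis length_bag[OF h] by (simp add: visited_def)
        moreover have "marked (seen_before (Suc h)) s2" using s1(3) by (simp add: marked_def f3)
        moreover have "s2 Tl 0 = length (bfs_upto h @ cs t)" using s'(2) by (simp add: f1 f2 f3)
        moreover have "\<forall>i<length (bfs_upto h @ cs t). s2 Queue i = (bfs_upto h @ cs t) ! i"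
          using s'(3) by (simp add: f2 f3)
        moreover have "\<forall>t<N. s2 Off t = off t" "s2 Num 0 = N"
          using vis by (simp_all add: visited_def f1 f2 f3)
        ultimately show "visited (Suc h) (upd s2 Hd 0 (Suc h))"
          unfolding visited_def bfs using s2(2) by (simp add: marked_def bag_at_def)
      qed
      have "s1 Hd 0 = h" "s1 Wid 0 = s Wid 0" using hd by (simp_all add: f1 f2)
      moreover have "Q (upd (upd ?P Wid 0 (4 ^ length (bag h))) Hd 0 (Suc h))"
        if "s Wid 0 < 4 ^ length (bag h)"
        using that by (intro fin) simp_all
      moreover have "Q (upd ?P Hd 0 (Suc h))" if "\<not> s Wid 0 < 4 ^ length (bag h)"
        using that \<open>s1 Wid 0 = s Wid 0\<close> by (intro fin) simp_all
      ultimately show "runs (store_size) s1 0 Q"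
        using s1(2) by simp
    qed simp_all
    then show "runs (skip_list ;; Store Bag (sc Hd) (sc Ptr) ;; Rs ::= Lit 1 ;; for_bag mark ;;
     store_size) s'
     (length (bag h)) Q"
      using hd len by (simp add: skip_list_def f1)
  qed
  then show ?thesis using hd by (simp add: visit_def)
qed

lemma runs_traverse:
  assumes inp: "s Input = start Input" and Num: "s Num 0 = N" and Que: "s Queue 0 = r"
    and Off: "\<And>t. t < N \<Longrightarrow> s Off t = off t" and clean: "\<And>u. s Seen u = 0" "\<And>i. s New i = 0"
    and cont: "\<And>s'. same_except {Ptr, Queue, Tl, Jx, Ver, Bag, Rs, Seen, New, Codes, Wid, Hd} s s' \<Longrightarrow>
      visited N s' \<Longrightarrow> runs d s' m Q"
    and m: "(\<Sum>t<N. length (node t)) + m \<le> m'"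
  shows "runs (traverse ;; d) s m' Q"
proof -
  let ?S = "{Ptr, Queue, Tl, Jx, Ver, Bag, Rs, Seen, New, Codes, Wid, Hd}"
  let ?s = "upd (upd (upd s Hd 0 0) Tl 0 1) Wid 0 1"
  let ?I = "\<lambda>h s'. same_except ?S s s' \<and> visited h s'"
  let ?f = "\<lambda>h. length (cs (bfs ! h)) + length (bag h)"
  have "runs (Loop (Lt (sc Hd) (sc Num)) visit ;; d) ?s m' Q"
  proof (rule runs_for_Then[where I = ?I and M = N and f = ?f and m = m])
    have "seen_before 0 = {}" by (simp add: seen_before_def)
    then show "?I 0 ?s" using assms by (simp add: visited_def marked_def)
  next
    fix h s' assume h: "h < N" and I: "?I h s'"
    have "s' Input = start Input" using I inp by (simp add: same_except_def)
    then have "runs visit s' (?f h) (?I (Suc h))"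
    proof (rule runs_visit[OF h])
      fix s1 assume "same_except ?S s' s1" "visited (Suc h) s1"
      then show "?I (Suc h) s1" using I by (simp add: same_except_def)
    qed (use I in simp_all)
    then show "ntrue (Lt (sc Hd) (sc Num)) s' \<and> runs visit s' (?f h) (?I (Suc h))"
      using I h by (simp add: visited_def)
  next
    fix s' assume "?I N s'"
    then show "\<not> ntrue (Lt (sc Hd) (sc Num)) s' \<and> runs d s' m Q"
      using cont by (simp add: visited_def)
  next
    \<comment> \<open>\<open>bfs\<close> permutes the nodes, so the traversal costs at most the
      total length of the node records.\<close>
    have "(\<Sum>h<N. 1 + ?f h) \<le> (\<Sum>h<N. length (node (bfs ! h)))"
      by (intro sum_mono) (simp add: node_def bag_def)
    also have "\<dots> = (\<Sum>t\<in>(\<lambda>h. bfs ! h) ` {..<N}. length (node t))"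
      using distinct_bfs length_bfs by (subst sum.reindex) (auto simp: inj_on_def nth_eq_iff_index_eq)
    also have "(\<lambda>h. bfs ! h) ` {..<N} = set bfs" by (auto simp: set_conv_nth length_bfs)
    also have "set bfs = {..<N}" by (rule set_bfs)
    finally show "(\<Sum>h<N. 1 + ?f h) + m \<le> m'" using m by simp
  qed
  then show ?thesis by (simp add: traverse_def)
qed

lemma runs_solve:
  assumes cont: "\<And>s'. s' Tab (s' Base 0) = best adjacent {..<n} (\<lambda>_. 0) \<Longrightarrow> s' Input 0 = n \<Longrightarrow> Q s'"
    and m: "2 * length input + n + 4 ^ b + n * (b + 4 ^ b * (1 + 2 * b)) \<le> m"
  shows "runs solve start m Q"
proof -
  let ?m0 = "N + n * (b + 4 ^ b * (1 + 2 * b))"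
  let ?m1 = "4 ^ b + ?m0"
  let ?s = "\<Sum>t<N. length (node t)"
  have "length input = 5 + 2 * length es + ?s"
    by (simp add: input_def edges_length length_concat_upt)
  \<comment> \<open>Every record contains its two list lengths, which pays for the loop that locates
    the nodes.\<close>
  moreover have "(\<Sum>t<N. 2) \<le> ?s" by (intro sum_mono) (simp add: node_def)
  ultimately have total: "n + (length es + (N + (?s + ?m1))) \<le> m" using m by simp
  have zero: "start x i = 0" if "x \<noteq> Input" for x i using that by (simp add: start_def)
  show ?thesis
    unfolding solve_def
  proof (rule runs_make_rows[where s = start, OF start_head(1) _ _ total])
    fix s1 assume s1: "same_except {Row, Ix} start s1" "\<And>i. i \<le> n \<Longrightarrow> s1 Row i = i * n"
    note f1 = same_exceptD[OF s1(1)]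
    show "runs (read_edges ;; locate_nodes ;; traverse ;; fill_tables ;; eliminate_all) s1
      (length es + (N + (?s + ?m1))) Q"
    proof (rule runs_read_edges[where n = n and es = es and m = "N + (?s + ?m1)"])
      fix i assume "i < length es"
      then have "es ! i \<in> set es" by simp
      then have "adjacent (fst (es ! i)) (snd (es ! i))" by (simp add: adjacent_iff)
      then show "s1 Input (3 + 2 * i) = fst (es ! i) \<and> s1 Input (4 + 2 * i) = snd (es ! i) \<and>
        fst (es ! i) < n \<and> snd (es ! i) < n"
        using edge_ends start_edges[OF \<open>i < length es\<close>] by (simp add: f1)
    next
      fix s2 assume s2: "same_except {Adj, Ptr, Ix} s1 s2" "s2 Ptr 0 = 3 + 2 * length es"
        "\<And>u v. u < n \<Longrightarrow> v < n \<Longrightarrow> 0 < s2 Adj (u * n + v) \<longleftrightarrow> (u, v) \<in> set es \<or> (v, u) \<in> set es"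
      note f2 = same_exceptD[OF s2(1)]
      have inp2: "s2 Input = start Input" by (simp add: f1 f2)
      show "runs (locate_nodes ;; traverse ;; fill_tables ;; eliminate_all) s2 (N + (?s + ?m1)) Q"
      proof (rule runs_locate_nodes[OF inp2 s2(2), where m = "?s + ?m1"])
        fix s3 assume s3: "same_except {Num, Queue, Ptr, Ix, Off} s2 s3" "s3 Num 0 = N" "s3 Queue 0 = r"
          "\<And>t. t < N \<Longrightarrow> s3 Off t = off t"
        note f3 = same_exceptD[OF s3(1)]
        have inp3: "s3 Input = start Input" by (simp add: inp2 f3)
        show "runs (traverse ;; fill_tables ;; eliminate_all) s3 (?s + ?m1) Q"
        proof (rule runs_traverse[OF inp3 s3(2,3,4), where m = ?m1])
          fix s4
          let ?S = "{Ptr, Queue, Tl, Jx, Ver, Bag, Rs, Seen, New, Codes, Wid, Hd}"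
          assume s4: "same_except ?S s3 s4" "visited N s4"
          note f4 = same_exceptD[OF s4(1)]
          have W: "s4 Wid 0 \<le> 4 ^ b" using s4(2) by (simp add: visited_def)
          show "runs (fill_tables ;; eliminate_all) s4 ?m1 Q"
          proof (rule runs_fill_tables[where m = ?m0])
            fix s5 assume s5: "same_except {Quot, Rem, Ix, Dg, Rs} s4 s5"
              "\<And>c. c < s4 Wid 0 \<Longrightarrow> s5 Quot c = c div 4 \<and> s5 Rem c = c mod 4"
            note f5 = same_exceptD[OF s5(1)]
            have seen: "seen_before N = {..<n}" using first_less by (auto simp: seen_before_def)
            have marked: "marked {..<n} s4" using s4(2) seen by (simp add: visited_def)
            have adj: "0 < s5 Adj (s5 Row u + v) \<longleftrightarrow> adjacent u v" if "u < n" "v < n" for u v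
              using that s1(2)[of u] s2(3)[of u v] by (simp add: f2 f3 f4 f5 adjacent_iff)
            have bags: "bag_at s5 (s5 Bag j) (bag j)" "s5 Codes j = 4 ^ length (bag j)"
              "4 ^ length (bag j) \<le> s4 Wid 0" if "j < N" for j
              using s4(2) that by (simp_all add: visited_def f5 bag_at_def)
            have none: "s4 New j = 0" if "\<forall>v<n. first v \<noteq> j" for j
            proof -
              have "j \<notin> first ` {..<n}" using that by auto
              then show ?thesis using marked unfolding marked_def by blast
            qed
            have "prepared (s4 Wid 0) s5"
              unfolding prepared_def
              using adj bags marked none s5(2) start_head(1) inp3
              by (auto simp: f4 f5 marked_def)
            then show "runs eliminate_all s5 ?m0 Q"
            proof (rule runs_eliminate_all[where b = b])
              show "s5 Num 0 = N" using s3(2) by (simp add: f4 f5)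
              show "s5 Base j = 0" "s5 Tab j = 0" for j by (simp_all add: f1 f2 f3 f4 f5 zero)
            qed (use length_bag cont in auto)
          qed (use W in simp)
        qed (simp_all add: f1 f2 f3 zero)
      qed simp
    qed (simp_all add: f1 start_head s1(2) zero)
  qed (simp add: zero)
qed

end

section \<open>The machine program and its running time\<close>

definition all_vars :: "var list" where
  "all_vars = [Input, Row, Adj, Off, Queue, Bag, Seen, New, Base, Tab, Quot, Rem, Codes, Val,
     Ix, Jx, Ptr, Ver, Hd, Tl, Num, Wid, Free, Fv, Par, Cd, Rs, Dg,
     Ia, Ir, Idel, Ikeep, Imat, Cnt, Opt]"

definition var_num :: "var \<Rightarrow> nat" where
  "var_num x = length (takeWhile (\<lambda>y. y \<noteq> x) all_vars)"

lemma var_num_less: "var_num x < length all_vars" and all_vars_nth: "all_vars ! var_num x = x"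
proof -
  have "x \<in> set all_vars" by (cases x) (simp_all add: all_vars_def)
  then obtain ys zs where all: "all_vars = ys @ x # zs" "x \<notin> set ys" by (metis split_list_first)
  then have "takeWhile (\<lambda>y. y \<noteq> x) all_vars = ys"
    unfolding all(1) by (subst takeWhile_append2) auto
  then have "var_num x = length ys" by (simp add: var_num_def)
  then show "var_num x < length all_vars" "all_vars ! var_num x = x" unfolding all(1) by simp_all
qed

interpretation ram: layout var_num "length all_vars"
proof
  show "inj var_num" by (metis all_vars_nth injI)
qed (rule var_num_less)

lemma var_num_0_iff: "var_num x = 0 \<longleftrightarrow> x = Input"
proof
  assume "var_num x = 0"
  then show "x = Input" using all_vars_nth[of x] by (simp add: all_vars_def)
qed (simp add: var_num_def all_vars_def)

text \<open>The parameter is moved to the unused address -1, since it may be negative.\<close>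

definition main_program :: com where
  "main_program =
    Seq (Put (Const (- 1)) (Get (Const 1))) (Seq (Put (Const 1) (Const 0))
     (Seq (ram.compile solve)
       (Cond (Less (Add (Get (Const (- 1))) (ram.comp_exp (Cell Tab (sc Base)))) (Get (Const 0)))
         (Put (Const 0) (Const 0)) (Put (Const 0) (Const 1)))))"

lemma exec_answer:
  "exec (Cond b (Put (Const 0) (Const 0)) (Put (Const 0) (Const 1))) s (bcost b + 4)
    (s(0 := if bval b s then 0 else 1))"
proof -
  have put: "exec (Put (Const 0) (Const i)) s 3 (s(0 := i))" for i
    using exec_Put[of "Const 0" "Const i" s] by (simp add: eval_nat_numeral)
  show ?thesis
    using exec_CondT[where b = b, OF _ put[of 0]] exec_CondF[where b = b, OF _ put[of 1]]
    by (cases "bval b s") (simp_all add: add.commute)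
qed

context encoded
begin

definition full_input :: "int \<Rightarrow> int list" where
  "full_input k = [int n, k, int (length es)] @ concat (map (\<lambda>(u, v). [int u, int v]) es) @ [int N, int r] @
     concat (map (\<lambda>t. int (length (cs t)) # map int (cs t) @ int (length (bs t)) # map int (bs t)) [0..<N])"

lemma full_input: "full_input k = (map int input)[1 := k]"
proof -
  have "map int (concat (map (\<lambda>(u, v). [u, v]) es)) = concat (map (\<lambda>(u, v). [int u, int v]) es)"
    by (induction es) auto
  moreover have "map int (concat (map node l)) =
      concat (map (\<lambda>t. int (length (cs t)) # map int (cs t) @ int (length (bs t)) # map int (bs t)) l)" for l
    by (induction l) (simp_all add: node_def)
  ultimately show ?thesis by (simp add: full_input_def input_def)
qed

lemma length_full_input: "length (full_input k) = length input"
  by (simp add: full_input)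

text \<open>Addresses outside the loaded list are zero, and -1 belongs to no array, so the parameter
  stored there is invisible to the represented store.\<close>

lemma represents_start: "ram.represents ((load (full_input k))(- 1 := k, 1 := 0)) start"
proof -
  have i1: "1 < length input" "input ! 1 = 0" by (simp_all add: input_def)
  have "((load (full_input k))(- 1 := k, 1 := 0)) (ram.addr x (int i)) = int (start x i)" for x i
  proof (cases "x = Input")
    case True
    then have a: "ram.addr x (int i) = int i" by (simp add: ram.addr_def var_num_0_iff)
    show ?thesis
    proof (cases "i = 1")
      case True
      then show ?thesis using i1 \<open>x = Input\<close> unfolding a by (simp add: start_def)
    next
      case False
      then show ?thesis
        using \<open>x = Input\<close> unfolding a by (simp add: start_def load_def full_input)
    qed
  next
    case False
    then have "ram.addr x (int i) < 0"
    proof -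
      have "0 \<le> int (length all_vars) * int i" by simp
      then show ?thesis unfolding ram.addr_def var_num_0_iff if_not_P[OF False] by linarith
    qed
    moreover have "ram.addr x (int i) \<noteq> - 1" by (rule ram.addr_neq)
    ultimately show ?thesis using False by (auto simp: load_def start_def)
  qed
  then show ?thesis by (simp add: ram.represents_def)
qed

lemma main_program_correct:
  "\<exists>m s. exec main_program (load (full_input k)) m s \<and>
     s 0 = (if TM_Deletion {P3} G k then 1 else 0) \<and>
     m \<le> csize main_program *
       (2 + (2 * length input + n + 4 ^ b + n * (b + 4 ^ b * (1 + 2 * b))))"
proof -
  let ?t = "2 * length input + n + 4 ^ b + n * (b + 4 ^ b * (1 + 2 * b))"
  let ?s0 = "load (full_input k)"
  let ?s1 = "?s0(- 1 := k)"
  let ?s2 = "?s1(1 := 0)"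
  let ?b = "best adjacent {..<n} (\<lambda>_. 0)"
  have "runs solve start ?t (\<lambda>\<tau>. \<tau> Tab (\<tau> Base 0) = ?b \<and> \<tau> Input 0 = n)"
    by (rule runs_solve) simp_all
  then obtain t \<tau> where \<tau>: "nexec solve start t \<tau>" "t \<le> ?t" "\<tau> Tab (\<tau> Base 0) = ?b" "\<tau> Input 0 = n"
    unfolding runs_def by blast
  obtain m s where s: "exec (ram.compile solve) ?s2 m s" "ram.represents s \<tau>" "s (- 1) = ?s2 (- 1)"
    "m \<le> csize (ram.compile solve) * (1 + t)"
    using ram.compile_correct[OF \<tau>(1) represents_start] by blast
  have k: "?s0 1 = k" by (simp add: load_def full_input_def)
  have first: "exec (Put (Const (- 1)) (Get (Const 1))) ?s0 4 ?s1"
    using exec_Put[of "Const (- 1)" "Get (Const 1)" ?s0] by (simp add: k eval_nat_numeral)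
  have second: "exec (Put (Const 1) (Const 0)) ?s1 3 ?s2"
    using exec_Put[of "Const 1" "Const 0" ?s1] by (simp add: eval_nat_numeral)
  let ?test = "Less (Add (Get (Const (- 1))) (ram.comp_exp (Cell Tab (sc Base)))) (Get (Const 0))"
  have "ram.addr Input (int 0) = 0" by (simp add: ram.addr_def var_num_0_iff)
  then have "s 0 = int n" using s(2) \<tau>(4) unfolding ram.represents_def by metis
  moreover have "aval (ram.comp_exp (Cell Tab (sc Base))) s = int ?b"
    using ram.aval_comp_exp[OF s(2), of "Cell Tab (sc Base)"] \<tau>(3) by simp
  ultimately have test: "bval ?test s \<longleftrightarrow> k + int ?b < int n"
    using s(3) by (simp del: ram.comp_exp.simps)
  have "adjacent = (\<lambda>u v. {u, v} \<in> edges G)" by (simp add: fun_eq_iff adjacent_def)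
  then have answer: "TM_Deletion {P3} G k \<longleftrightarrow> \<not> k + int ?b < int n"
    using TM_Deletion_P3_iff[OF simple, of k "\<lambda>_. 0"] by (simp add: verts_G not_less)
  let ?a = "if TM_Deletion {P3} G k then 1 else 0 :: int"
  let ?last = "Cond ?test (Put (Const 0) (Const 0)) (Put (Const 0) (Const 1))"
  have last: "exec ?last s (bcost ?test + 4) (s(0 := ?a))"
    using exec_answer[of ?test s] test answer by (simp only: if_not_P if_P split: if_split) auto
  have "exec main_program ?s0 (4 + (3 + (m + (bcost ?test + 4)))) (s(0 := ?a))"
    unfolding main_program_def by (rule exec_Seq[OF first exec_Seq[OF second exec_Seq[OF s(1) last]]])
  moreover have "4 + (3 + (m + (bcost ?test + 4))) \<le> csize main_program * (2 + ?t)"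
  proof -
    have size: "csize main_program = 4 + (3 + (csize (ram.compile solve) + (1 + bcost ?test + 3 + 3)))"
      by (simp add: main_program_def)
    have "m \<le> csize (ram.compile solve) * (2 + ?t)"
      using s(4) \<tau>(2) by (meson add_mono le_trans mult_le_mono2 one_le_numeral)
    moreover have "4 + 3 + (1 + bcost ?test + 3 + 3) \<le> (4 + 3 + (1 + bcost ?test + 3 + 3)) * (2 + ?t)"
      by simp
    ultimately have "4 + 3 + (1 + bcost ?test + 3 + 3) + m \<le>
      (4 + 3 + (1 + bcost ?test + 3 + 3)) * (2 + ?t) + csize (ram.compile solve) * (2 + ?t)"
      by (rule add_mono[rotated])
    also have "\<dots> = csize main_program * (2 + ?t)"
      unfolding size by (simp only: distrib_right[symmetric] ac_simps)
    finally show ?thesis by simp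
  qed
  ultimately show ?thesis by (intro exI conjI) (assumption, simp, assumption)
qed

text \<open>Each edge is charged to the end that is first seen later: by \<open>first_bag\<close>
  the other end lies in the first bag of that vertex, so every vertex pays for at most
  \<open>b\<close> edges.\<close>

lemma card_edges_le: "card (edges G) \<le> n * b"
proof -
  let ?f = "\<lambda>v. (\<lambda>u. {u, v}) ` X (bfs ! first v)"
  have c: "finite (X (bfs ! first v)) \<and> card (X (bfs ! first v)) \<le> b" if "v < n" for v
    using b[OF bfs_less] bag_subset[OF bfs_less] first_less[OF that] finite_subset by blast
  have "edges G \<subseteq> (\<Union>v<n. ?f v)"
  proof
    fix e assume e: "e \<in> edges G"
    then obtain u v where uv: "e = {u, v}" "u < n" "v < n"
      using simple verts_G unfolding simple_graph_def by auto
    have ed: "\<exists>i<N. u \<in> X (bfs ! i) \<and> v \<in> X (bfs ! i)" using edge_bag e uv(1) by blast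
    show "e \<in> (\<Union>v<n. ?f v)"
    proof (cases "first u \<le> first v")
      case True
      then have "u \<in> X (bfs ! first v)" using first_bag ed by blast
      then show ?thesis using uv by blast
    next
      case False
      then have "v \<in> X (bfs ! first u)" using first_bag[of _ v u] ed by auto
      then have "{v, u} \<in> ?f u" by blast
      then show ?thesis using uv by (auto simp: insert_commute)
    qed
  qed
  then have "card (edges G) \<le> card (\<Union>v<n. ?f v)"
    using c by (intro card_mono) auto
  also have "\<dots> \<le> (\<Sum>v<n. card (?f v))" by (rule card_UN_le) simp
  also have "\<dots> \<le> (\<Sum>v<n. b)"
    using c by (intro sum_mono) (meson card_image_le le_trans lessThan_iff)
  finally show ?thesis by simp
qed

lemma length_input_le:
  assumes "distinct (map (\<lambda>(u, v). {u, v}) es)"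
  shows "length input \<le> 5 + 2 * (n * b) + N * (4 + b)"
proof -
  have "length es = card (edges G)"
    using distinct_card[OF assms] es by (simp add: image_set[symmetric] del: image_set)
  then have "length es \<le> n * b" using card_edges_le by simp
  moreover have "(\<Sum>t<N. length (node t)) \<le> (\<Sum>t<N. 4 + b)"
  proof (rule sum_mono)
    fix t assume "t \<in> {..<N}"
    then have t: "t < N" by simp
    have "card (children T r t) \<le> 2"
      using nice t verts_T by (simp add: nice_tree_decomposition_def)
    then have "length (cs t) \<le> 2" using cs[OF t] distinct_card by metis
    moreover have "length (bs t) \<le> b" using bs[OF t] b[OF t] distinct_card by metis
    ultimately show "length (node t) \<le> 4 + b" by (simp add: node_def)
  qed
  moreover have "length input = 5 + 2 * length es + (\<Sum>t<N. length (node t))"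
    by (simp add: input_def edges_length length_concat_upt)
  ultimately show ?thesis by simp
qed

end

text \<open>Bags have at most \<open>w + 1\<close> vertices. With \<open>M = max 1 w\<close>, the
  bounds \<open>w + 1 <= 2 * M\<close> and \<open>1 + 2 * (w + 1) <= 5 * M\<close> make all
  eliminations cost at most \<open>(2 + 4 * 5) * P\<close>; the other terms without \<open>L\<close>
  add at most \<open>7 * P\<close>, and 30 is a round bound.\<close>

lemma ticks_le:
  fixes w n L :: nat
  defines "P \<equiv> 9 ^ w * max 1 w * max 1 n"
  shows "2 + (2 * L + n + 4 ^ (w + 1) + n * (w + 1 + 4 ^ (w + 1) * (1 + 2 * (w + 1)))) \<le> 30 * (P + L)"
proof -
  define M where "M = max 1 w"
  define n' where "n' = max 1 n"
  have P: "P = 9 ^ w * M * n'" by (simp add: P_def M_def n'_def)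
  have M: "1 \<le> M" "w + 1 \<le> 2 * M" "1 + 2 * (w + 1) \<le> 5 * M" by (auto simp: M_def)
  have n: "1 \<le> n'" "n \<le> n'" by (auto simp: n'_def)
  have p: "(1::nat) \<le> 9 ^ w" "(4::nat) ^ w \<le> 9 ^ w" by (simp_all add: power_mono)
  have 1: "1 * 1 * 1 \<le> 9 ^ w * M * n'" by (intro mult_le_mono p M n)
  have 2: "1 * 1 * n \<le> 9 ^ w * M * n'" by (intro mult_le_mono p M n)
  have 3: "4 ^ w * 1 * 1 \<le> 9 ^ w * M * n'" by (intro mult_le_mono p M n)
  have 4: "1 * (w + 1) * n \<le> 9 ^ w * (2 * M) * n'" by (intro mult_le_mono p M n)
  have 5: "4 ^ w * (1 + 2 * (w + 1)) * n \<le> 9 ^ w * (5 * M) * n'" by (intro mult_le_mono p M n)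
  have "n * (w + 1 + 4 ^ (w + 1) * (1 + 2 * (w + 1))) = 1 * (w + 1) * n + 4 * (4 ^ w * (1 + 2 * (w + 1)) * n)"
    by (simp add: algebra_simps)
  also have "\<dots> \<le> 2 * P + 4 * (5 * P)" using 4 5 unfolding P by (simp add: algebra_simps)
  finally have 6: "n * (w + 1 + 4 ^ (w + 1) * (1 + 2 * (w + 1))) \<le> 22 * P" by simp
  have "4 ^ (w + 1) \<le> 4 * P" using 3 unfolding P by simp
  with 1 2 6 show ?thesis unfolding P[symmetric] by simp
qed

text \<open>Records of length at most \<open>w + 5\<close> for \<open>c * w * n\<close> nodes
  contribute a factor \<open>w\<close> twice, one of which is absorbed by \<open>w < 9 ^ w\<close>.
  Header and edges give 5 + 4, the nodes \<open>6 * c\<close>.\<close>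

lemma input_length_le:
  fixes w n N c :: nat
  assumes "N \<le> c * max 1 w * max 1 n"
  shows "5 + 2 * (n * (w + 1)) + N * (4 + (w + 1)) \<le> (9 + 6 * c) * (9 ^ w * max 1 w * max 1 n)"
proof -
  define M where "M = max 1 w"
  define n' where "n' = max 1 n"
  have M: "1 \<le> M" "w + 1 \<le> 2 * M" "4 + (w + 1) \<le> 6 * M" by (auto simp: M_def)
  have n: "1 \<le> n'" "n \<le> n'" by (auto simp: n'_def)
  have "w < 9 ^ w" by (rule less_le_trans[OF less_exp]) (simp add: power_mono)
  then have p: "(1::nat) \<le> 9 ^ w" "M \<le> 9 ^ w" by (simp_all add: M_def)
  have 1: "1 * 1 * 1 \<le> 9 ^ w * M * n'" by (intro mult_le_mono p M n)
  have 2: "1 * (w + 1) * n \<le> 9 ^ w * (2 * M) * n'" by (intro mult_le_mono p M n)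
  have "N * (4 + (w + 1)) \<le> (c * M * n') * (6 * M)"
    using assms M(3) unfolding M_def[symmetric] n'_def[symmetric] by (rule mult_le_mono)
  also have "\<dots> = 6 * c * (M * M * n')" by (simp add: algebra_simps)
  also have "\<dots> \<le> 6 * c * (9 ^ w * M * n')" by (intro mult_le_mono p le_refl)
  finally have 3: "N * (4 + (w + 1)) \<le> 6 * c * (9 ^ w * M * n')" .
  define Q where "Q = 9 ^ w * M * n'"
  have "1 \<le> Q" using 1 unfolding Q_def by simp
  moreover have "n * (w + 1) \<le> 2 * Q" using 2 unfolding Q_def by (simp add: algebra_simps)
  ultimately have "5 + 2 * (n * (w + 1)) \<le> 9 * (9 ^ w * M * n')" unfolding Q_def[symmetric] by linarith
  with 3 show ?thesis unfolding M_def[symmetric] n'_def[symmetric] by (simp add: distrib_right)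
qed

lemma card_bag_le_width:
  assumes "finite (verts T)" "t \<in> verts T"
  shows "card (X t) \<le> nat (width T X) + 1"
proof -
  have "card (X t) \<le> Max ((\<lambda>t. card (X t)) ` verts T)" using assms by (intro Max_ge) auto
  then show ?thesis by (simp add: width_def)
qed

lemma encodesE:
  assumes "encodes xs G k T r X" "simple_graph G" "nice_tree_decomposition G T r X"
  obtains N cs es bs where "encoded T r N cs G X (card (verts G)) es bs (nat (width T X) + 1)"
    "verts T = {..<N}" "distinct (map (\<lambda>(u, v). {u, v}) es)"
    "xs = encoded.full_input r N cs (card (verts G)) es bs k"
proof -
  obtain n N es cs bs where e: "verts G = {..<n}" "verts T = {..<N}"
    "distinct (map (\<lambda>(u, v). {u, v}) es)" "(\<lambda>(u, v). {u, v}) ` set es = edges G"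
    "\<forall>t < N. distinct (cs t) \<and> set (cs t) = children T r t"
    "\<forall>t < N. distinct (bs t) \<and> set (bs t) = X t"
    "xs = [int n, k, int (length es)] @ concat (map (\<lambda>(u, v). [int u, int v]) es) @
       [int N, int r] @
       concat (map (\<lambda>t. int (length (cs t)) # map int (cs t) @
                        int (length (bs t)) # map int (bs t)) [0..<N])"
    using assms(1) unfolding encodes_def by blast
  have n: "card (verts G) = n" using e(1) by simp
  have tree: "is_tree T" "r \<in> verts T"
    using assms(3) by (simp_all add: nice_tree_decomposition_def tree_decomposition_def)
  have enc: "encoded T r N cs G X n es bs (nat (width T X) + 1)"
  proof
    show "card (X t) \<le> nat (width T X) + 1" if "t < N" for t
      using card_bag_le_width[of T t X] e(2) that by simp
  qed (use tree e assms in auto)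
  show ?thesis
    using that[of N cs es bs] enc e(2,3,7) unfolding n encoded.full_input_def[OF enc] by blast
qed

text \<open>A nice tree decomposition may have arbitrarily many nodes, and the encoding must be
  read. So the bound without the input length is stated for decompositions of
  \<open>O(w * n)\<close> nodes, with a constant depending on \<open>c\<close>, and the other bound
  adds the input length. The maxima with 1 keep the bounds positive for width or vertex number 0;
  \<open>nat\<close> turns the width -1 into 0.\<close>

theorem theorem5:
  "\<exists>prog :: com. \<forall>c :: nat. \<exists>C :: nat.
     \<forall>(G :: nat graph) (T :: nat graph) (r :: nat) (X :: nat \<Rightarrow> nat set) (k :: int)
      (xs :: int list) (n :: nat) (w :: nat).
       simple_graph G \<and> n = card (verts G) \<and>
       nice_tree_decomposition G T r X \<and> w = nat (width T X) \<and>
       encodes xs G k T r X \<longrightarrow>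
       (\<exists>m s. exec prog (load xs) m s \<and>
              s 0 = (if TM_Deletion {P3} G k then 1 else 0) \<and>
              (card (verts T) \<le> c * max 1 w * max 1 n \<longrightarrow>
               m \<le> C * (9 ^ w * max 1 w * max 1 n)) \<and>
              m \<le> C * (9 ^ w * max 1 w * max 1 n + length xs))"
proof (rule exI[of _ main_program], intro allI)
  fix c :: nat
  let ?S = "30 * csize main_program"
  show "\<exists>C :: nat.
     \<forall>(G :: nat graph) (T :: nat graph) (r :: nat) (X :: nat \<Rightarrow> nat set) (k :: int)
      (xs :: int list) (n :: nat) (w :: nat).
       simple_graph G \<and> n = card (verts G) \<and>
       nice_tree_decomposition G T r X \<and> w = nat (width T X) \<and>
       encodes xs G k T r X \<longrightarrow>
       (\<exists>m s. exec main_program (load xs) m s \<and>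
              s 0 = (if TM_Deletion {P3} G k then 1 else 0) \<and>
              (card (verts T) \<le> c * max 1 w * max 1 n \<longrightarrow>
               m \<le> C * (9 ^ w * max 1 w * max 1 n)) \<and>
              m \<le> C * (9 ^ w * max 1 w * max 1 n + length xs))"
  \<comment> \<open>The factor 30 in \<open>?S\<close> stems from \<open>ticks_le\<close>;
    \<open>10 + 6 * c\<close> is \<open>1 + (9 + 6 * c)\<close>, which absorbs the input length by
    \<open>input_length_le\<close>.\<close>
  proof (rule exI[of _ "?S * (10 + 6 * c)"], intro allI impI, elim conjE)
    fix G T :: "nat graph" and r :: nat and X :: "nat \<Rightarrow> nat set" and k :: int
      and xs :: "int list" and n w :: nat
    assume a: "simple_graph G" "n = card (verts G)" "nice_tree_decomposition G T r X"
      "w = nat (width T X)" "encodes xs G k T r X"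
    obtain N cs es bs where enc: "encoded T r N cs G X n es bs (w + 1)"
      and N: "verts T = {..<N}" and dist: "distinct (map (\<lambda>(u, v). {u, v}) es)"
      and xs: "xs = encoded.full_input r N cs n es bs k"
      using encodesE[OF a(5,1,3)] unfolding a(2,4) by blast
    interpret encoded T r N cs G X n es bs "w + 1" by (rule enc)
    let ?P = "9 ^ w * max 1 w * max 1 n"
    have len: "length xs = length input" unfolding xs by (rule length_full_input)
    obtain m s where ms: "exec main_program (load xs) m s"
      "s 0 = (if TM_Deletion {P3} G k then 1 else 0)"
      "m \<le> csize main_program * (2 + (2 * length xs + n + 4 ^ (w + 1) +
        n * (w + 1 + 4 ^ (w + 1) * (1 + 2 * (w + 1)))))"
      using main_program_correct[of k] unfolding xs[symmetric] len by blast
    have "m \<le> csize main_program * (30 * (?P + length xs))"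
      using ms(3) ticks_le[of "length xs" n w] by (meson le_trans mult_le_mono2)
    then have m: "m \<le> ?S * (?P + length xs)" by (simp add: mult.assoc mult.left_commute)
    have "?S * (?P + length xs) \<le> ?S * (10 + 6 * c) * (?P + length xs)"
      by (rule mult_le_mono1) simp
    with m have "m \<le> ?S * (10 + 6 * c) * (?P + length xs)" by (rule le_trans)
    moreover have "m \<le> ?S * (10 + 6 * c) * ?P" if "card (verts T) \<le> c * max 1 w * max 1 n"
    proof -
      have "N \<le> c * max 1 w * max 1 n" using that N by simp
      then have "length xs \<le> (9 + 6 * c) * ?P"
        unfolding len by (rule le_trans[OF length_input_le[OF dist] input_length_le])
      moreover have "p + l \<le> (10 + 6 * c) * p" if "l \<le> (9 + 6 * c) * p" for p l
        using that by (simp add: algebra_simps)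
      ultimately have "?P + length xs \<le> (10 + 6 * c) * ?P" by blast
      then have "?S * (?P + length xs) \<le> ?S * ((10 + 6 * c) * ?P)" by (rule mult_le_mono2)
      with m show ?thesis by (simp only: mult.assoc)
    qed
    ultimately show "\<exists>m s. exec main_program (load xs) m s \<and>
              s 0 = (if TM_Deletion {P3} G k then 1 else 0) \<and>
              (card (verts T) \<le> c * max 1 w * max 1 n \<longrightarrow>
               m \<le> ?S * (10 + 6 * c) * ?P) \<and>
              m \<le> ?S * (10 + 6 * c) * (?P + length xs)"
      using ms(1,2) by blast
  qed
qed

end
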